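(* Let $(M,g)$ be a connected closed Riemannian manifold of dimension $d\ge2$, let $\epsilon>0$ and let $\varphi$ be the Levi-Civita phase function. Then, in any local coordinates $x$ and $y$, for all $t\in\mathbb{R}$ and $(y,\eta)\in T'M$, $$\varphi_{x^\alpha\eta_\mu}\big|_{x=x^*}=g_{\alpha\beta}(x^* )\left[p^{\beta\mu}-i\,\epsilon\,h(y,\eta)\,q^{\beta\mu}\right],$$ where $$q^{\alpha\mu}:=\frac{\partial x^{*\alpha}}{\partial\eta_\mu},\qquad p^{\alpha\mu}:=g^{\alpha\gamma}(x^* )\left[\frac{\partial\xi^*_\gamma}{\partial\eta_\mu}-\Gamma^\rho{}_{\gamma\beta}(x^* )\,\xi^*_\rho\,\frac{\partial x^{*\beta}}{\partial\eta_\mu}\right].$$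
   Context: $T'M=T^*M\setminus\{0\}$; $h(x,\xi)=(g^{\alpha\beta}(x)\xi_\alpha\xi_\beta)^{1/2}$; $\Gamma$ are the Christoffel symbols of $g$; summation over repeated indices. $(x^*,\xi^* )=(x^*(t;y,\eta),\xi^*(t;y,\eta))$ is the solution of $\dot x^*=h_\xi(x^*,\xi^* )$, $\dot\xi^*=-h_x(x^*,\xi^* )$, $(x^*,\xi^* )|_{t=0}=(y,\eta)$. The Levi-Civita phase function $\varphi:\mathbb{R}\times M\times T'M\times(0,+\infty)\to\mathbb{C}$ is the smooth function given by $$\varphi(t,x;y,\eta;\epsilon)=\int_\gamma\zeta\,dz+\frac{i\epsilon}{2}h(y,\eta)\operatorname{dist}^2(x,x^*(t;y,\eta))$$ when $x$ lies in a geodesic neighbourhood of $x^*(t;y,\eta)$, and continued smoothly elsewhere so that $\operatorname{Im}\varphi\ge0$. Here $\operatorname{dist}$ is the geodesic distance, $\gamma$ is the unique shortest geodesic from $x^*(t;y,\eta)$ to $x$, and $\zeta$ is the parallel transport of $\xi^*(t;y,\eta)$ along $\gamma$. *)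

theory Defs
  imports "HOL-Analysis.Analysis"
begin

section \<open>Calculus in Euclidean space\<close>

text \<open>\<open>C\<^sup>k\<close> and \<open>C\<^sup>\<infinity>\<close> maps; only used for open \<open>S\<close>.\<close>

primrec Ck_on :: "nat \<Rightarrow> 'a::real_normed_vector set \<Rightarrow> ('a \<Rightarrow> 'b::real_normed_vector) \<Rightarrow> bool" where
  "Ck_on 0 S f \<longleftrightarrow> continuous_on S f"
| "Ck_on (Suc k) S f \<longleftrightarrow>
     (\<forall>x\<in>S. f differentiable (at x)) \<and> (\<forall>v. Ck_on k S (\<lambda>x. frechet_derivative f (at x) v))"

definition smooth_on :: "'a::real_normed_vector set \<Rightarrow> ('a \<Rightarrow> 'b::real_normed_vector) \<Rightarrow> bool" where
  "smooth_on S f \<longleftrightarrow> (\<forall>k. Ck_on k S f)"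

definition pdiff :: "'n::finite \<Rightarrow> (real ^ 'n \<Rightarrow> 'b::real_normed_vector) \<Rightarrow> real ^ 'n \<Rightarrow> 'b" where
  "pdiff i f u = vector_derivative (\<lambda>s. f (u + s *\<^sub>R axis i 1)) (at 0)"


section \<open>Smooth manifolds\<close>

text \<open>
  The manifold is the type \<open>'m\<close>, the model space is \<open>real ^ 'n\<close>. A chart is a pair of a
  coordinate domain and a coordinate map; the map is irrelevant outside the domain.
\<close>

type_synonym ('m, 'n) chart = "'m set \<times> ('m \<Rightarrow> real ^ 'n)"

abbreviation chart_dom :: "('m, 'n::finite) chart \<Rightarrow> 'm set" where
  "chart_dom c \<equiv> fst c"

abbreviation coord :: "('m, 'n::finite) chart \<Rightarrow> 'm \<Rightarrow> real ^ 'n" where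
  "coord c \<equiv> snd c"

abbreviation coord_inv :: "('m, 'n::finite) chart \<Rightarrow> real ^ 'n \<Rightarrow> 'm" where
  "coord_inv c \<equiv> inv_into (chart_dom c) (coord c)"

definition smooth_atlas :: "('m::t2_space, 'n::finite) chart set \<Rightarrow> bool" where
  "smooth_atlas A \<longleftrightarrow>
     (\<Union>c\<in>A. chart_dom c) = UNIV \<and>
     (\<forall>c\<in>A. open (chart_dom c) \<and> open (coord c ` chart_dom c) \<and>
        homeomorphism (chart_dom c) (coord c ` chart_dom c) (coord c) (coord_inv c)) \<and>
     (\<forall>c\<in>A. \<forall>d\<in>A. smooth_on (coord c ` (chart_dom c \<inter> chart_dom d)) (coord d \<circ> coord_inv c))"

text \<open>
  Connected, compact, without boundary. The atlas need not be maximal, but it may be: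
  quantifying over the charts of an arbitrary atlas thus covers all local coordinates.
\<close>

definition connected_closed_manifold :: "('m::t2_space, 'n::finite) chart set \<Rightarrow> bool" where
  "connected_closed_manifold A \<longleftrightarrow>
     smooth_atlas A \<and> compact (UNIV :: 'm set) \<and> connected (UNIV :: 'm set)"

definition chart_at :: "('m, 'n::finite) chart set \<Rightarrow> 'm \<Rightarrow> ('m, 'n) chart" where
  "chart_at A x = (SOME c. c \<in> A \<and> x \<in> chart_dom c)"

text \<open>The entry in row \<open>i\<close> and column \<open>j\<close> is \<open>\<partial>d\<^sup>i/\<partial>c\<^sup>j\<close> at the point \<open>x\<close>.\<close>

definition transition_jacobian :: "('m, 'n::finite) chart \<Rightarrow> ('m, 'n) chart \<Rightarrow> 'm \<Rightarrow> real ^ 'n ^ 'n" where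
  "transition_jacobian c d x = jacobian (coord d \<circ> coord_inv c) (at (coord c x))"


section \<open>The cotangent bundle\<close>

text \<open>
  A covector at \<open>x\<close> assigns to each chart around \<open>x\<close> its components, subject to the
  covariant transformation law. It is set to 0 on everything that is not a chart around \<open>x\<close>,
  so that equality of covectors is equality of functions.
\<close>

type_synonym ('m, 'n) covector = "('m, 'n) chart \<Rightarrow> real ^ 'n"

definition is_covector :: "('m, 'n::finite) chart set \<Rightarrow> 'm \<Rightarrow> ('m, 'n) covector \<Rightarrow> bool" where
  "is_covector A x \<xi> \<longleftrightarrow>
     (\<forall>c\<in>A. \<forall>d\<in>A. x \<in> chart_dom c \<inter> chart_dom d \<longrightarrow>
        \<xi> c = transpose (transition_jacobian c d x) *v \<xi> d) \<and>
     (\<forall>c. \<not> (c \<in> A \<and> x \<in> chart_dom c) \<longrightarrow> \<xi> c = 0)"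

text \<open>The covector at \<open>x\<close> whose components in the chart \<open>c\<close> are \<open>v\<close>.\<close>

definition covector_of :: "('m, 'n::finite) chart set \<Rightarrow> ('m, 'n) chart \<Rightarrow> 'm \<Rightarrow> real ^ 'n \<Rightarrow> ('m, 'n) covector" where
  "covector_of A c x v =
     (\<lambda>d. if d \<in> A \<and> x \<in> chart_dom d then transpose (transition_jacobian d c x) *v v else 0)"

definition punctured_cotangent :: "('m, 'n::finite) chart set \<Rightarrow> ('m \<times> ('m, 'n) covector) set" where
  "punctured_cotangent A = {(y, \<eta>). is_covector A y \<eta> \<and> \<eta> \<noteq> (\<lambda>c. 0)}"


section \<open>Riemannian metrics\<close>

text \<open>\<open>g c u\<close> is the matrix \<open>g\<^sub>\<alpha>\<^sub>\<beta>\<close> in the chart \<open>c\<close>, at the point with coordinates \<open>u\<close>.\<close>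

type_synonym ('m, 'n) metric = "('m, 'n) chart \<Rightarrow> real ^ 'n \<Rightarrow> real ^ 'n ^ 'n"

definition riemannian_metric :: "('m, 'n::finite) chart set \<Rightarrow> ('m, 'n) metric \<Rightarrow> bool" where
  "riemannian_metric A g \<longleftrightarrow>
     (\<forall>c\<in>A. smooth_on (coord c ` chart_dom c) (g c)) \<and>
     (\<forall>c\<in>A. \<forall>u\<in>coord c ` chart_dom c.
        transpose (g c u) = g c u \<and> (\<forall>v. v \<noteq> 0 \<longrightarrow> v \<bullet> (g c u *v v) > 0)) \<and>
     (\<forall>c\<in>A. \<forall>d\<in>A. \<forall>x\<in>chart_dom c \<inter> chart_dom d.
        g c (coord c x) =
          transpose (transition_jacobian c d x) ** g d (coord d x) ** transition_jacobian c d x)"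

abbreviation inv_metric :: "('m, 'n::finite) metric \<Rightarrow> ('m, 'n) chart \<Rightarrow> real ^ 'n \<Rightarrow> real ^ 'n ^ 'n" where
  "inv_metric g c u \<equiv> matrix_inv (g c u)"

text \<open>\<open>christoffel g c u \<alpha> \<beta> \<gamma>\<close> is \<open>\<Gamma>\<^sup>\<alpha>\<^sub>\<beta>\<^sub>\<gamma>\<close> at the point with coordinates \<open>u\<close>.\<close>

definition christoffel :: "('m, 'n::finite) metric \<Rightarrow> ('m, 'n) chart \<Rightarrow> real ^ 'n \<Rightarrow> 'n \<Rightarrow> 'n \<Rightarrow> 'n \<Rightarrow> real" where
  "christoffel g c u \<alpha> \<beta> \<gamma> =
     (1 / 2) * (\<Sum>\<delta>\<in>UNIV. inv_metric g c u $ \<alpha> $ \<delta> *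
        (pdiff \<beta> (\<lambda>w. g c w $ \<delta> $ \<gamma>) u + pdiff \<gamma> (\<lambda>w. g c w $ \<delta> $ \<beta>) u
          - pdiff \<delta> (\<lambda>w. g c w $ \<beta> $ \<gamma>) u))"

definition ham_coord :: "('m, 'n::finite) metric \<Rightarrow> ('m, 'n) chart \<Rightarrow> real ^ 'n \<Rightarrow> real ^ 'n \<Rightarrow> real" where
  "ham_coord g c u v =
     sqrt (\<Sum>\<alpha>\<in>UNIV. \<Sum>\<beta>\<in>UNIV. inv_metric g c u $ \<alpha> $ \<beta> * v $ \<alpha> * v $ \<beta>)"

text \<open>The value does not depend on which chart \<open>chart_at\<close> picks.\<close>

definition ham :: "('m, 'n::finite) chart set \<Rightarrow> ('m, 'n) metric \<Rightarrow> 'm \<times> ('m, 'n) covector \<Rightarrow> real" where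
  "ham A g = (\<lambda>(y, \<eta>). let c = chart_at A y in ham_coord g c (coord c y) (\<eta> c))"


section \<open>The Hamiltonian flow\<close>

definition hamiltonian_trajectory ::
  "('m::t2_space, 'n::finite) chart set \<Rightarrow> ('m, 'n) metric \<Rightarrow> 'm \<times> ('m, 'n) covector \<Rightarrow>
     (real \<Rightarrow> 'm) \<Rightarrow> (real \<Rightarrow> ('m, 'n) covector) \<Rightarrow> bool" where
  "hamiltonian_trajectory A g Y x \<xi> \<longleftrightarrow>
     (x 0, \<xi> 0) = Y \<and>
     continuous_on UNIV x \<and>
     (\<forall>t. (x t, \<xi> t) \<in> punctured_cotangent A) \<and>
     (\<forall>t. \<forall>c\<in>A. x t \<in> chart_dom c \<longrightarrow>
        ((\<lambda>s. coord c (x s)) has_vector_derivative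
           (\<chi> \<alpha>. pdiff \<alpha> (\<lambda>v. ham_coord g c (coord c (x t)) v) (\<xi> t c))) (at t) \<and>
        ((\<lambda>s. \<xi> s c) has_vector_derivative
           (\<chi> \<alpha>. - pdiff \<alpha> (\<lambda>u. ham_coord g c u (\<xi> t c)) (coord c (x t)))) (at t))"

text \<open>\<open>X t (y, \<eta>)\<close> and \<open>\<Xi> t (y, \<eta>)\<close> are \<open>x\<^sup>*(t; y, \<eta>)\<close> and \<open>\<xi>\<^sup>*(t; y, \<eta>)\<close>.\<close>

definition hamiltonian_flow ::
  "('m::t2_space, 'n::finite) chart set \<Rightarrow> ('m, 'n) metric \<Rightarrow>
     (real \<Rightarrow> 'm \<times> ('m, 'n) covector \<Rightarrow> 'm) \<Rightarrow>
     (real \<Rightarrow> 'm \<times> ('m, 'n) covector \<Rightarrow> ('m, 'n) covector) \<Rightarrow> bool" where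
  "hamiltonian_flow A g X \<Xi> \<longleftrightarrow>
     (\<forall>Y\<in>punctured_cotangent A. hamiltonian_trajectory A g Y (\<lambda>t. X t Y) (\<lambda>t. \<Xi> t Y))"


section \<open>Curves, distance, geodesics and parallel transport\<close>

definition velocity :: "real set \<Rightarrow> ('m, 'n::finite) chart \<Rightarrow> (real \<Rightarrow> 'm) \<Rightarrow> real \<Rightarrow> real ^ 'n" where
  "velocity I c \<gamma> s = vector_derivative (\<lambda>r. coord c (\<gamma> r)) (at s within I)"

definition C1_curve_on :: "('m::t2_space, 'n::finite) chart set \<Rightarrow> real set \<Rightarrow> (real \<Rightarrow> 'm) \<Rightarrow> bool" where
  "C1_curve_on A I \<gamma> \<longleftrightarrow>
     continuous_on I \<gamma> \<and>
     (\<forall>c\<in>A. \<forall>s\<in>I. \<gamma> s \<in> chart_dom c \<longrightarrow>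
        (\<lambda>r. coord c (\<gamma> r)) differentiable (at s within I) \<and>
        continuous (at s within I) (velocity I c \<gamma>))"

definition piecewise_C1_curve :: "('m::t2_space, 'n::finite) chart set \<Rightarrow> (real \<Rightarrow> 'm) \<Rightarrow> bool" where
  "piecewise_C1_curve A \<gamma> \<longleftrightarrow>
     (\<exists>k (\<tau> :: nat \<Rightarrow> real). \<tau> 0 = 0 \<and> \<tau> k = 1 \<and>
        (\<forall>i<k. \<tau> i < \<tau> (Suc i) \<and> C1_curve_on A {\<tau> i..\<tau> (Suc i)} \<gamma>))"

definition speed :: "('m, 'n::finite) chart set \<Rightarrow> ('m, 'n) metric \<Rightarrow> (real \<Rightarrow> 'm) \<Rightarrow> real \<Rightarrow> real" where
  "speed A g \<gamma> s =
     (let c = chart_at A (\<gamma> s); v = velocity {0..1} c \<gamma> s in sqrt (v \<bullet> (g c (coord c (\<gamma> s)) *v v)))"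

definition curve_length :: "('m, 'n::finite) chart set \<Rightarrow> ('m, 'n) metric \<Rightarrow> (real \<Rightarrow> 'm) \<Rightarrow> real" where
  "curve_length A g \<gamma> = integral {0..1} (speed A g \<gamma>)"

definition riem_dist :: "('m::t2_space, 'n::finite) chart set \<Rightarrow> ('m, 'n) metric \<Rightarrow> 'm \<Rightarrow> 'm \<Rightarrow> real" where
  "riem_dist A g p x =
     (INF \<gamma> \<in> {\<gamma>. piecewise_C1_curve A \<gamma> \<and> \<gamma> 0 = p \<and> \<gamma> 1 = x}. curve_length A g \<gamma>)"

text \<open>Geodesics are affinely parametrised by \<open>{0..1}\<close>; constant ones are allowed.\<close>

definition geodesic :: "('m::t2_space, 'n::finite) chart set \<Rightarrow> ('m, 'n) metric \<Rightarrow> (real \<Rightarrow> 'm) \<Rightarrow> bool" where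
  "geodesic A g \<gamma> \<longleftrightarrow>
     continuous_on {0..1} \<gamma> \<and>
     (\<forall>c\<in>A. \<forall>s\<in>{0..1}. \<gamma> s \<in> chart_dom c \<longrightarrow>
        (\<lambda>r. coord c (\<gamma> r)) differentiable (at s within {0..1}) \<and>
        (velocity {0..1} c \<gamma> has_vector_derivative
           (\<chi> \<alpha>. - (\<Sum>\<beta>\<in>UNIV. \<Sum>\<sigma>\<in>UNIV. christoffel g c (coord c (\<gamma> s)) \<alpha> \<beta> \<sigma> *
                      velocity {0..1} c \<gamma> s $ \<beta> * velocity {0..1} c \<gamma> s $ \<sigma>)))
          (at s within {0..1}))"

definition shortest_geodesic ::
  "('m::t2_space, 'n::finite) chart set \<Rightarrow> ('m, 'n) metric \<Rightarrow> 'm \<Rightarrow> 'm \<Rightarrow> (real \<Rightarrow> 'm) \<Rightarrow> bool" where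
  "shortest_geodesic A g p x \<gamma> \<longleftrightarrow>
     geodesic A g \<gamma> \<and> \<gamma> 0 = p \<and> \<gamma> 1 = x \<and> curve_length A g \<gamma> = riem_dist A g p x"

definition geodesic_neighbourhood ::
  "('m::t2_space, 'n::finite) chart set \<Rightarrow> ('m, 'n) metric \<Rightarrow> 'm \<Rightarrow> 'm set \<Rightarrow> bool" where
  "geodesic_neighbourhood A g p N \<longleftrightarrow>
     open N \<and> p \<in> N \<and>
     (\<forall>x\<in>N. \<exists>\<gamma>. shortest_geodesic A g p x \<gamma> \<and>
        (\<forall>\<gamma>'. shortest_geodesic A g p x \<gamma>' \<longrightarrow> (\<forall>s\<in>{0..1}. \<gamma>' s = \<gamma> s)))"

definition parallel_along ::
  "('m::t2_space, 'n::finite) chart set \<Rightarrow> ('m, 'n) metric \<Rightarrow> (real \<Rightarrow> 'm) \<Rightarrow>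
     (real \<Rightarrow> ('m, 'n) covector) \<Rightarrow> bool" where
  "parallel_along A g \<gamma> \<zeta> \<longleftrightarrow>
     (\<forall>s\<in>{0..1}. is_covector A (\<gamma> s) (\<zeta> s)) \<and>
     (\<forall>c\<in>A. \<forall>s\<in>{0..1}. \<gamma> s \<in> chart_dom c \<longrightarrow>
        ((\<lambda>r. \<zeta> r c) has_vector_derivative
           (\<chi> \<alpha>. \<Sum>\<rho>\<in>UNIV. \<Sum>\<beta>\<in>UNIV. christoffel g c (coord c (\<gamma> s)) \<rho> \<alpha> \<beta> *
                    \<zeta> s c $ \<rho> * velocity {0..1} c \<gamma> s $ \<beta>))
          (at s within {0..1}))"

text \<open>\<open>\<integral>\<^sub>\<gamma> \<zeta> dz\<close>\<close>

definition covector_integral ::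
  "('m, 'n::finite) chart set \<Rightarrow> (real \<Rightarrow> 'm) \<Rightarrow> (real \<Rightarrow> ('m, 'n) covector) \<Rightarrow> real" where
  "covector_integral A \<gamma> \<zeta> =
     integral {0..1} (\<lambda>s. let c = chart_at A (\<gamma> s) in \<zeta> s c \<bullet> velocity {0..1} c \<gamma> s)"


section \<open>The Levi-Civita phase function\<close>

definition smooth_phase ::
  "('m::t2_space, 'n::finite) chart set \<Rightarrow>
     (real \<Rightarrow> 'm \<Rightarrow> 'm \<times> ('m, 'n) covector \<Rightarrow> real \<Rightarrow> complex) \<Rightarrow> bool" where
  "smooth_phase A \<phi> \<longleftrightarrow>
     (\<forall>c\<in>A. \<forall>d\<in>A. smooth_on
        (UNIV \<times> coord c ` chart_dom c \<times> coord d ` chart_dom d \<times> (UNIV - {0}) \<times> {0<..})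
        (\<lambda>(t, u, w, v, \<epsilon>).
           \<phi> t (coord_inv c u) (coord_inv d w, covector_of A d (coord_inv d w) v) \<epsilon>))"

text \<open>
  The values outside the geodesic neighbourhoods are not determined; every smooth
  continuation with nonnegative imaginary part is admitted.
\<close>

definition levi_civita_phase ::
  "('m::t2_space, 'n::finite) chart set \<Rightarrow> ('m, 'n) metric \<Rightarrow>
     (real \<Rightarrow> 'm \<times> ('m, 'n) covector \<Rightarrow> 'm) \<Rightarrow>
     (real \<Rightarrow> 'm \<times> ('m, 'n) covector \<Rightarrow> ('m, 'n) covector) \<Rightarrow>
     (real \<Rightarrow> 'm \<Rightarrow> 'm \<times> ('m, 'n) covector \<Rightarrow> real \<Rightarrow> complex) \<Rightarrow> bool" where
  "levi_civita_phase A g X \<Xi> \<phi> \<longleftrightarrow>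
     smooth_phase A \<phi> \<and>
     (\<forall>t x. \<forall>Y\<in>punctured_cotangent A. \<forall>\<epsilon>>0. Im (\<phi> t x Y \<epsilon>) \<ge> 0) \<and>
     (\<forall>t. \<forall>Y\<in>punctured_cotangent A. \<exists>N. geodesic_neighbourhood A g (X t Y) N \<and>
        (\<forall>x\<in>N. \<forall>\<epsilon>>0. \<exists>\<gamma> \<zeta>.
           shortest_geodesic A g (X t Y) x \<gamma> \<and> parallel_along A g \<gamma> \<zeta> \<and> \<zeta> 0 = \<Xi> t Y \<and>
           \<phi> t x Y \<epsilon> = of_real (covector_integral A \<gamma> \<zeta>)
             + \<i> * of_real \<epsilon> / 2 * of_real (ham A g Y) * of_real ((riem_dist A g x (X t Y))\<^sup>2)))"

end

theory Submission
  imports Defs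
begin

text \<open>
  Put \<open>w = x - x\<^sup>*\<close> in local coordinates. Near \<open>x\<^sup>*\<close> the real part of the phase is the integral of the
  transported covector, and its imaginary part is \<open>\<epsilon> h / 2\<close> times the squared distance. To second order
  in \<open>w\<close>, the former is \<open>\<xi>\<^sub>\<alpha> w\<^sup>\<alpha> + \<Gamma>\<^sup>\<rho>\<^sub>\<alpha>\<^sub>\<beta> \<xi>\<^sub>\<rho> w\<^sup>\<alpha> w\<^sup>\<beta> / 2\<close> (\<open>covector_integral_expansion\<close>) and the squared
  distance is \<open>g\<^sub>\<alpha>\<^sub>\<beta> w\<^sup>\<alpha> w\<^sup>\<beta>\<close> (\<open>riem_dist_squared_expansion\<close>). A smooth function with a given quadratic
  expansion has the corresponding derivatives, so at \<open>x = x\<^sup>*\<close> the gradient of the phase is \<open>\<xi>\<^sup>*\<close> and its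
  Hessian is \<open>\<Gamma>\<^sup>\<rho>\<^sub>\<alpha>\<^sub>\<beta> \<xi>\<^sub>\<rho> + \<i> \<epsilon> h g\<^sub>\<alpha>\<^sub>\<beta>\<close> (\<open>phase_derivatives_on_flow\<close>).

  The first identity holds for all nonzero covectors \<open>\<eta>\<close>. Differentiating it in \<open>\<eta>\<close> gives
  \<open>\<phi>\<^sub>x\<^sub>\<eta> = \<partial>\<xi>\<^sup>* / \<partial>\<eta> - \<phi>\<^sub>x\<^sub>x \<partial>x\<^sup>* / \<partial>\<eta>\<close> (\<open>phase_mixed_derivative\<close>), and inserting the Hessian yields the
  claim, since lowering the index of \<open>p\<close> cancels the inverse metric in its definition.

  This presupposes that \<open>x\<^sup>*\<close> and \<open>\<xi>\<^sup>*\<close> are differentiable in \<open>\<eta>\<close>, and the smoothness of the phase provides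
  that. The position \<open>x\<^sup>*\<close> is a zero of the gradient of \<open>Im \<phi>\<close>, whose Hessian \<open>\<epsilon> h g\<close> there is positive
  definite; hence the gradient is strongly monotone near \<open>x\<^sup>*\<close> and its zero is locally unique
  (\<open>im_gradient_strongly_monotone\<close>). Since trajectories are continuous in time and all start at \<open>y\<close>, the
  positions for nearby covectors remain in the range of uniqueness, so \<open>x\<^sup>*\<close> is continuous in \<open>\<eta>\<close>
  (\<open>isCont_flow\<close>). Linearising the equation for the zero makes \<open>x\<^sup>*\<close> differentiable
  (\<open>differentiable_flow\<close>), and \<open>\<xi>\<^sup>*\<close>, the gradient of \<open>Re \<phi>\<close> at \<open>x\<^sup>*\<close>, inherits this.
\<close>

section \<open>Calculus\<close>

lemma smooth_on_imp_differentiable: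
  "smooth_on S f \<Longrightarrow> x \<in> S \<Longrightarrow> f differentiable (at x)"
  unfolding smooth_on_def by (metis Ck_on.simps(2))

lemma smooth_on_frechet_derivative:
  "smooth_on S f \<Longrightarrow> smooth_on S (\<lambda>x. frechet_derivative f (at x) v)"
  unfolding smooth_on_def by (metis Ck_on.simps(2))

lemma smooth_on_imp_continuous_on: "smooth_on S f \<Longrightarrow> continuous_on S f"
  unfolding smooth_on_def by (metis Ck_on.simps(1))

lemma smooth_on_has_derivative:
  "smooth_on S f \<Longrightarrow> x \<in> S \<Longrightarrow> (f has_derivative frechet_derivative f (at x)) (at x)"
  using smooth_on_imp_differentiable frechet_derivative_works by blast

lemma has_derivative_along_line:
  assumes "(f has_derivative f') (at (x + s *\<^sub>R a))"
  shows "((\<lambda>s. f (x + s *\<^sub>R a)) has_vector_derivative f' a) (at s)"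
proof -
  have "((\<lambda>s. x + s *\<^sub>R a) has_derivative (\<lambda>h. h *\<^sub>R a)) (at s)"
    by (auto intro!: derivative_eq_intros)
  from has_derivative_compose[OF this assms]
  have "((\<lambda>s. f (x + s *\<^sub>R a)) has_derivative (\<lambda>h. f' (h *\<^sub>R a))) (at s)" .
  moreover have "f' (h *\<^sub>R a) = h *\<^sub>R f' a" for h
    using assms has_derivative_bounded_linear linear_simps(5) by blast
  ultimately show ?thesis by (simp add: has_vector_derivative_def)
qed

lemma pdiff_eqI:
  "((\<lambda>s. f (u + s *\<^sub>R axis i 1)) has_vector_derivative D) (at 0) \<Longrightarrow> pdiff i f u = D"
  unfolding pdiff_def by (rule vector_derivative_at)

lemma pdiff_eq_frechet_derivative:
  assumes "(f has_derivative f') (at u)"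
  shows "pdiff i f u = f' (axis i 1)"
  by (rule pdiff_eqI) (use has_derivative_along_line[of f f' u 0] assms in simp)

lemma pdiff_cong:
  fixes f h :: "real ^ 'n \<Rightarrow> 'b::real_normed_vector"
  assumes "eventually (\<lambda>w. f w = h w) (nhds u)"
  shows "pdiff i f u = pdiff i h u"
proof -
  have "filterlim (\<lambda>s. u + s *\<^sub>R axis i 1 :: real^'n) (nhds u) (nhds (0::real))"
    using tendsto_at_iff_tendsto_nhds[of "\<lambda>s. u + s *\<^sub>R axis i 1 :: real^'n" "0::real"]
    by (auto intro!: tendsto_eq_intros)
  then have "eventually (\<lambda>s. f (u + s *\<^sub>R axis i 1) = h (u + s *\<^sub>R axis i 1)) (nhds 0)"
    by (rule eventually_compose_filterlim[OF assms])
  then show ?thesis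
    unfolding pdiff_def
    by (intro vector_derivative_cong_eq) (auto simp: eventually_at_filter)
qed

lemma isCont_eventually_less:
  fixes f :: "'a::t2_space \<Rightarrow> real"
  assumes "isCont f x" "f x < K"
  shows "eventually (\<lambda>u. f u < K) (nhds x)"
  using order_tendstoD(2)[OF assms(1)[unfolded isCont_def tendsto_at_iff_tendsto_nhds] assms(2)] .

text \<open>
  The double difference of \<open>R\<close> over a small parallelogram is \<open>o(s\<^sup>2)\<close> by flatness and, by two
  applications of the mean value theorem, equals \<open>s\<^sup>2\<close> times a value of \<open>R2\<close> near the corner. Unlike
  a Taylor expansion along lines this reaches the mixed derivatives directly.
\<close>

lemma mixed_derivative_zero_if_flat:
  fixes R R1 R2 :: "'a::real_normed_vector \<Rightarrow> real"
  assumes r: "r > 0"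
    and R1: "\<And>u. u \<in> ball u0 r \<Longrightarrow> ((\<lambda>s. R (u + s *\<^sub>R a)) has_real_derivative R1 u) (at 0)"
    and R2: "\<And>u. u \<in> ball u0 r \<Longrightarrow> ((\<lambda>s. R1 (u + s *\<^sub>R b)) has_real_derivative R2 u) (at 0)"
    and cont: "isCont R2 u0"
    and flat: "\<And>e. e > 0 \<Longrightarrow> \<exists>\<delta>>0. \<forall>w. norm w < \<delta> \<longrightarrow> \<bar>R (u0 + w)\<bar> \<le> e * (norm w)\<^sup>2"
  shows "R1 u0 = 0" "R2 u0 = 0"
proof -
  have shift: "((\<lambda>\<tau>. R (u + \<tau> *\<^sub>R a)) has_real_derivative R1 (u + s *\<^sub>R a)) (at s)"
    if "u + s *\<^sub>R a \<in> ball u0 r" for u s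
    using R1[OF that] DERIV_shift[of "\<lambda>\<tau>. R (u + \<tau> *\<^sub>R a)" _ 0 s]
    by (simp add: scaleR_add_left algebra_simps)
  have shift2: "((\<lambda>\<tau>. R1 (u + \<tau> *\<^sub>R b)) has_real_derivative R2 (u + s *\<^sub>R b)) (at s)"
    if "u + s *\<^sub>R b \<in> ball u0 r" for u s
    using R2[OF that] DERIV_shift[of "\<lambda>\<tau>. R1 (u + \<tau> *\<^sub>R b)" _ 0 s]
    by (simp add: scaleR_add_left algebra_simps)
  have R0: "R u0 = 0"
    using flat[of 1] by (auto dest!: spec[of _ 0])
  show "R1 u0 = 0"
  proof (rule ccontr)
    assume nz: "R1 u0 \<noteq> 0"
    have "((\<lambda>s. R (u0 + s *\<^sub>R a)) has_real_derivative R1 u0) (at 0)"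
      using R1 r by simp
    then have "((\<lambda>s. R (u0 + s *\<^sub>R a) / s) \<longlongrightarrow> R1 u0) (at 0)"
      by (simp add: DERIV_def R0)
    moreover have "((\<lambda>s. R (u0 + s *\<^sub>R a) / s) \<longlongrightarrow> 0) (at 0)"
    proof (rule Lim_null_comparison)
      obtain \<delta> where \<delta>: "\<delta> > 0" "\<And>w. norm w < \<delta> \<Longrightarrow> \<bar>R (u0 + w)\<bar> \<le> 1 * (norm w)\<^sup>2"
        using flat[of 1] by auto
      have "((\<lambda>s::real. norm (s *\<^sub>R a)) \<longlongrightarrow> 0) (at 0)"
        by (auto intro!: tendsto_eq_intros)
      then have "eventually (\<lambda>s::real. norm (s *\<^sub>R a) < \<delta>) (at 0)"
        using \<delta>(1) by (rule order_tendstoD)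
      then show "eventually (\<lambda>s. norm (R (u0 + s *\<^sub>R a) / s) \<le> \<bar>s\<bar> * (norm a)\<^sup>2) (at 0)"
      proof eventually_elim
        case (elim s)
        have "\<bar>R (u0 + s *\<^sub>R a)\<bar> \<le> \<bar>s\<bar>\<^sup>2 * (norm a)\<^sup>2"
          using \<delta>(2)[OF elim] by (simp add: power_mult_distrib)
        then show ?case
          by (cases "s = 0") (auto simp: divide_simps power2_eq_square mult_ac)
      qed
      show "((\<lambda>s. \<bar>s\<bar> * (norm a)\<^sup>2) \<longlongrightarrow> 0) (at 0)"
        by (auto intro!: tendsto_eq_intros)
    qed
    ultimately have "R1 u0 = 0"
      using LIM_unique by blast
    then show False using nz by simp
  qed
  show "R2 u0 = 0"
  proof (rule ccontr)
    assume "R2 u0 \<noteq> 0"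
    define k where "k = \<bar>R2 u0\<bar> / 2"
    have k: "k > 0" using \<open>R2 u0 \<noteq> 0\<close> by (simp add: k_def)
    obtain \<rho> where \<rho>: "\<rho> > 0" "\<And>u. dist u u0 < \<rho> \<Longrightarrow> \<bar>R2 u - R2 u0\<bar> < k"
      using cont k unfolding continuous_at_eps_delta by (auto simp: dist_real_def)
    define n where "n = norm a + norm b + 1"
    have n: "n > 0" "n \<ge> 1" "norm a \<le> n" "norm b \<le> n" by (auto simp: n_def add_nonneg_pos)
    obtain \<delta> where \<delta>: "\<delta> > 0" "\<And>w. norm w < \<delta> \<Longrightarrow> \<bar>R (u0 + w)\<bar> \<le> (k / (4 * n\<^sup>2)) * (norm w)\<^sup>2"
      using flat[of "k / (4 * n\<^sup>2)"] k n by auto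
    \<comment> \<open>small enough for the parallelogram to lie where flatness and continuity are available\<close>
    define s where "s = min \<rho> (min \<delta> r) / (2 * n)"
    have s: "s > 0" "s * n < \<rho>" "s * n < \<delta>" "s * n < r"
      using \<rho> \<delta> r n by (auto simp: s_def field_simps min_def)
    have close: "norm (\<sigma> *\<^sub>R b + \<tau> *\<^sub>R a) \<le> s * n" if "0 \<le> \<sigma>" "\<sigma> \<le> s" "0 \<le> \<tau>" "\<tau> \<le> s" for \<sigma> \<tau>
    proof -
      have "norm (\<sigma> *\<^sub>R b + \<tau> *\<^sub>R a) \<le> \<sigma> * norm b + \<tau> * norm a"
        by (rule order_trans[OF norm_triangle_ineq]) (use that in auto)
      also have "\<dots> \<le> s * norm b + s * norm a"
        using that by (intro add_mono mult_right_mono) auto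
      also have "\<dots> \<le> s * n" using s by (simp add: n_def algebra_simps)
      finally show ?thesis .
    qed
    have inb: "u0 + \<sigma> *\<^sub>R b + \<tau> *\<^sub>R a \<in> ball u0 r"  if "0 \<le> \<sigma>" "\<sigma> \<le> s" "0 \<le> \<tau>" "\<tau> \<le> s" for \<sigma> \<tau>
      using close[OF that] s by (simp add: dist_norm add.assoc) (metis norm_minus_cancel minus_add_distrib diff_0 le_less_trans add_uminus_conv_diff)
    define G where "G \<tau> = R (u0 + s *\<^sub>R b + \<tau> *\<^sub>R a) - R (u0 + \<tau> *\<^sub>R a)" for \<tau>
    have "\<exists>\<theta>. 0 < \<theta> \<and> \<theta> < s \<and> G s - G 0 = (s - 0) * (R1 (u0 + s *\<^sub>R b + \<theta> *\<^sub>R a) - R1 (u0 + \<theta> *\<^sub>R a))"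
    proof (rule MVT2[OF s(1)])
      fix \<tau> assume \<tau>: "0 \<le> \<tau>" "\<tau> \<le> s"
      have "((\<lambda>\<tau>. R (u0 + s *\<^sub>R b + \<tau> *\<^sub>R a)) has_real_derivative R1 (u0 + s *\<^sub>R b + \<tau> *\<^sub>R a)) (at \<tau>)"
        using shift[of "u0 + s *\<^sub>R b" \<tau>] inb[of s \<tau>] \<tau> s by simp
      moreover have "((\<lambda>\<tau>. R (u0 + \<tau> *\<^sub>R a)) has_real_derivative R1 (u0 + \<tau> *\<^sub>R a)) (at \<tau>)"
        using shift[of "u0" \<tau>] inb[of 0 \<tau>] \<tau> s by simp
      ultimately show "(G has_real_derivative R1 (u0 + s *\<^sub>R b + \<tau> *\<^sub>R a) - R1 (u0 + \<tau> *\<^sub>R a)) (at \<tau>)"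
        unfolding G_def by (rule DERIV_diff)
    qed
    then obtain \<theta> where \<theta>: "0 < \<theta>" "\<theta> < s"
        "G s - G 0 = s * (R1 (u0 + s *\<^sub>R b + \<theta> *\<^sub>R a) - R1 (u0 + \<theta> *\<^sub>R a))" by auto
    have "\<exists>\<sigma>. 0 < \<sigma> \<and> \<sigma> < s \<and> R1 (u0 + \<theta> *\<^sub>R a + s *\<^sub>R b) - R1 (u0 + \<theta> *\<^sub>R a + 0 *\<^sub>R b)
             = (s - 0) * R2 (u0 + \<theta> *\<^sub>R a + \<sigma> *\<^sub>R b)"
    proof (rule MVT2[OF s(1)])
      fix \<sigma> assume \<sigma>: "0 \<le> \<sigma>" "\<sigma> \<le> s"
      show "((\<lambda>\<sigma>. R1 (u0 + \<theta> *\<^sub>R a + \<sigma> *\<^sub>R b)) has_real_derivative R2 (u0 + \<theta> *\<^sub>R a + \<sigma> *\<^sub>R b)) (at \<sigma>)"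
        using shift2[of "u0 + \<theta> *\<^sub>R a" \<sigma>] inb[of \<sigma> \<theta>] \<sigma> \<theta> by (simp add: algebra_simps)
    qed
    then obtain \<sigma> where \<sigma>: "0 < \<sigma>" "\<sigma> < s"
        "R1 (u0 + \<theta> *\<^sub>R a + s *\<^sub>R b) - R1 (u0 + \<theta> *\<^sub>R a) = s * R2 (u0 + \<theta> *\<^sub>R a + \<sigma> *\<^sub>R b)" by auto
    let ?u = "u0 + \<theta> *\<^sub>R a + \<sigma> *\<^sub>R b"
    have eq: "G s - G 0 = s * (s * R2 ?u)"
      using \<theta>(3) \<sigma>(3) by (simp add: algebra_simps)
    have "dist ?u u0 < \<rho>"
      using close[of \<sigma> \<theta>] \<sigma> \<theta> s by (simp add: dist_norm algebra_simps)
    then have "\<bar>R2 ?u\<bar> > k" using \<rho>(2)[of ?u] k_def by linarith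
    then have lower: "\<bar>G s - G 0\<bar> > s\<^sup>2 * k"
      using s by (simp add: eq abs_mult power2_eq_square)
    have small: "\<bar>R (u0 + (\<sigma> *\<^sub>R b + \<tau> *\<^sub>R a))\<bar> \<le> k / 4 * s\<^sup>2"
      if "0 \<le> \<sigma>" "\<sigma> \<le> s" "0 \<le> \<tau>" "\<tau> \<le> s" for \<sigma> \<tau>
    proof -
      have "\<bar>R (u0 + (\<sigma> *\<^sub>R b + \<tau> *\<^sub>R a))\<bar> \<le> (k / (4 * n\<^sup>2)) * (norm (\<sigma> *\<^sub>R b + \<tau> *\<^sub>R a))\<^sup>2"
        using \<delta>(2) close[OF that] s by auto
      also have "\<dots> \<le> (k / (4 * n\<^sup>2)) * (s * n)\<^sup>2"
        using close[OF that] k n by (intro mult_left_mono power_mono) auto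
      also have "\<dots> = k / 4 * s\<^sup>2" using n by (simp add: power2_eq_square)
      finally show ?thesis .
    qed
    have "G s - G 0 = R (u0 + (s *\<^sub>R b + s *\<^sub>R a)) - R (u0 + (0 *\<^sub>R b + s *\<^sub>R a)) - R (u0 + (s *\<^sub>R b + 0 *\<^sub>R a))"
      by (simp add: G_def R0 add.assoc)
    moreover have "0 \<le> k / 4 * s\<^sup>2" using k by simp
    ultimately have "\<bar>G s - G 0\<bar> \<le> s\<^sup>2 * k"
      using small[of s s] small[of s 0] small[of 0 s] s by (simp add: mult.commute)
    then show False using lower by simp
  qed
qed


text \<open>
  A quadratic expansion known from elsewhere determines the first and second derivatives, once
  these are known to exist and to be continuous: the difference of the function and the quadratic
  polynomial is flat.
\<close>

lemma derivatives_from_quadratic_expansion: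
  fixes F F1 F2 :: "real ^ 'n \<Rightarrow> real"
  assumes S: "open S" "u0 \<in> S"
    and F1: "\<And>u. u \<in> S \<Longrightarrow> ((\<lambda>s. F (u + s *\<^sub>R a)) has_real_derivative F1 u) (at 0)"
    and F2: "\<And>u. u \<in> S \<Longrightarrow> ((\<lambda>s. F1 (u + s *\<^sub>R b)) has_real_derivative F2 u) (at 0)"
    and cont: "isCont F2 u0"
    and M: "transpose M = M"
    and exp: "\<And>e. e > 0 \<Longrightarrow> \<exists>\<delta>>0. \<forall>w. norm w < \<delta> \<longrightarrow>
               \<bar>F (u0 + w) - (k + l \<bullet> w + (w \<bullet> (M *v w)) / 2)\<bar> \<le> e * (norm w)\<^sup>2"
  shows "F1 u0 = l \<bullet> a" "F2 u0 = b \<bullet> (M *v a)"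
proof -
  obtain r where r: "r > 0" "ball u0 r \<subseteq> S"
    using S openE by blast
  define R where "R u = F u - (k + l \<bullet> (u - u0) + ((u - u0) \<bullet> (M *v (u - u0))) / 2)" for u
  define R1 where "R1 u = F1 u - (l \<bullet> a + (u - u0) \<bullet> (M *v a))" for u
  define R2 where "R2 u = F2 u - b \<bullet> (M *v a)" for u
  have sym: "x \<bullet> (M *v y) = y \<bullet> (M *v x)" for x y
    by (metis M dot_lmul_matrix inner_commute vector_transpose_matrix)
  have 1: "((\<lambda>s. R (u + s *\<^sub>R a)) has_real_derivative R1 u) (at 0)" if "u \<in> ball u0 r" for u
  proof -
    have *: "R (u + s *\<^sub>R a) = F (u + s *\<^sub>R a) - (k + l \<bullet> (u - u0) + ((u - u0) \<bullet> (M *v (u - u0))) / 2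
        + s * (l \<bullet> a + (u - u0) \<bullet> (M *v a)) + s\<^sup>2 * (a \<bullet> (M *v a)) / 2)" for s
    proof -
      have "(w + s *\<^sub>R a) \<bullet> (M *v (w + s *\<^sub>R a)) = w \<bullet> (M *v w) + 2 * s * (w \<bullet> (M *v a)) + s\<^sup>2 * (a \<bullet> (M *v a))" for w
        using sym[of a w] by (simp add: inner_add_left inner_add_right matrix_vector_right_distrib 
            matrix_vector_mult_scaleR power2_eq_square algebra_simps)
      moreover have "u + s *\<^sub>R a - u0 = (u - u0) + s *\<^sub>R a" by simp
      ultimately show ?thesis
        unfolding R_def by (simp only: inner_add_right inner_scaleR_right) (simp add: field_simps)
    qed
    show ?thesis
      unfolding * R1_def
      by (rule derivative_eq_intros F1 refl | use that r in force)+
  qed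
  have 2: "((\<lambda>s. R1 (u + s *\<^sub>R b)) has_real_derivative R2 u) (at 0)" if "u \<in> ball u0 r" for u
  proof -
    have *: "R1 (u + s *\<^sub>R b) = F1 (u + s *\<^sub>R b) - (l \<bullet> a + (u - u0) \<bullet> (M *v a) + s * (b \<bullet> (M *v a)))" for s
      by (simp add: R1_def inner_add_left inner_diff_left algebra_simps)
    show ?thesis
      unfolding * R2_def
      by (rule derivative_eq_intros F2 refl | use that r in force)+
  qed
  have 3: "isCont R2 u0"
    unfolding R2_def by (intro continuous_intros cont)
  have 4: "\<exists>\<delta>>0. \<forall>w. norm w < \<delta> \<longrightarrow> \<bar>R (u0 + w)\<bar> \<le> e * (norm w)\<^sup>2" if "e > 0" for e
    using exp[OF that] by (simp add: R_def)
  show "F1 u0 = l \<bullet> a" "F2 u0 = b \<bullet> (M *v a)"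
    using mixed_derivative_zero_if_flat[OF r(1) 1 2 3 4] by (simp_all add: R1_def R2_def)
qed

text \<open>
  Linearising \<open>\<psi> (x s, s) = 0\<close> at \<open>s = 0\<close> gives \<open>D (x s - x 0, s) = o(s)\<close>, where the Lipschitz bound
  turns errors that are small relative to \<open>x s - x 0\<close> into errors that are small relative to \<open>s\<close>;
  then the left inverse \<open>L\<close> solves for \<open>x s - x 0\<close>.
\<close>

lemma implicit_curve_has_vector_derivative:
  fixes \<psi> :: "'a::real_normed_vector \<times> real \<Rightarrow> 'b::real_normed_vector" and x :: "real \<Rightarrow> 'a"
  assumes D: "(\<psi> has_derivative D) (at (x 0, 0))"
    and L: "bounded_linear L" "\<And>a. L (D (a, 0)) = a"
    and zero: "eventually (\<lambda>s. \<psi> (x s, s) = 0) (nhds 0)"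
    and lip: "eventually (\<lambda>s. norm (x s - x 0) \<le> C * \<bar>s\<bar>) (nhds 0)"
  shows "(x has_vector_derivative - L (D (0, 1))) (at 0)"
proof -
  interpret D: bounded_linear D using D by (rule has_derivative_bounded_linear)
  interpret L: bounded_linear L by (rule L)
  obtain B where B: "B > 0" "\<And>y. norm (L y) \<le> norm y * B"
    using L.pos_bounded by blast
  have C: "norm (x s - x 0) \<le> (\<bar>C\<bar> + 1) * \<bar>s\<bar>" if "norm (x s - x 0) \<le> C * \<bar>s\<bar>" for s
    using that by (smt (verit) mult_right_mono abs_ge_zero)
  have split: "L (D (a, s)) = a + s *\<^sub>R L (D (0, 1))" for a s
  proof -
    have "(a, s) = (a, 0) + s *\<^sub>R (0, 1)" by simp
    then show ?thesis using L(2)[of a] by (simp only: D.add D.scaleR L.add L.scaleR)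
  qed
  have zero0: "\<psi> (x 0, 0) = 0" using eventually_nhds_x_imp_x[OF zero] .
  have "(x has_derivative (\<lambda>h. h *\<^sub>R - L (D (0, 1)))) (at 0)"
    unfolding has_derivative_at_alt
  proof (intro conjI allI impI)
    show "bounded_linear (\<lambda>h. h *\<^sub>R - L (D (0, 1)))"
      by (rule bounded_linear_scaleR_left)
    fix e :: real assume e: "e > 0"
    define e' where "e' = e / (B * (\<bar>C\<bar> + 2))"
    have e': "e' > 0" using e B by (simp add: e'_def)
    obtain d where d: "d > 0" "\<And>z. norm (z - (x 0, 0)) < d \<Longrightarrow>
        norm (\<psi> z - \<psi> (x 0, 0) - D (z - (x 0, 0))) \<le> e' * norm (z - (x 0, 0))"
      using D e' unfolding has_derivative_at_alt by blast
    obtain d1 where d1: "d1 > 0" "\<And>s. dist s 0 < d1 \<Longrightarrow> \<psi> (x s, s) = 0 \<and> norm (x s - x 0) \<le> C * \<bar>s\<bar>"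
      using eventually_conj[OF zero lip] unfolding eventually_nhds_metric by blast
    show "\<exists>d>0. \<forall>y. norm (y - 0) < d \<longrightarrow>
        norm (x y - x 0 - (y - 0) *\<^sub>R - L (D (0, 1))) \<le> e * norm (y - 0)"
    proof (intro exI[of _ "min d1 (d / (\<bar>C\<bar> + 2))"] conjI allI impI)
      show "0 < min d1 (d / (\<bar>C\<bar> + 2))" using d d1 by simp
      fix s :: real assume s: "norm (s - 0) < min d1 (d / (\<bar>C\<bar> + 2))"
      then have s1: "\<psi> (x s, s) = 0" "norm (x s - x 0) \<le> (\<bar>C\<bar> + 1) * \<bar>s\<bar>"
        using d1(2)[of s] C by auto
      have n: "norm ((x s, s) - (x 0, 0)) \<le> (\<bar>C\<bar> + 2) * \<bar>s\<bar>"
        using norm_Pair_le[of "x s - x 0" s] s1(2) by (simp add: algebra_simps)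
      also have "\<dots> < d" using s by (simp add: field_simps)
      finally have "norm (D ((x s, s) - (x 0, 0))) \<le> e' * norm ((x s, s) - (x 0, 0))"
        using d(2)[of "(x s, s)"] s1 zero0 by (simp only: diff_self diff_0 norm_minus_cancel)
      also have "\<dots> \<le> e' * ((\<bar>C\<bar> + 2) * \<bar>s\<bar>)"
        using n e' by (intro mult_left_mono) auto
      finally have "norm (L (D (x s - x 0, s))) \<le> e' * ((\<bar>C\<bar> + 2) * \<bar>s\<bar>) * B"
        using B by (smt (verit, best) mult_right_mono diff_Pair diff_zero)
      also have "\<dots> = e * \<bar>s\<bar> * (B * (\<bar>C\<bar> + 2) / (B * (\<bar>C\<bar> + 2)))" by (simp add: e'_def)
      also have "B * (\<bar>C\<bar> + 2) / (B * (\<bar>C\<bar> + 2)) = 1"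
        by (rule divide_self) (use B(1) in \<open>simp add: add_nonneg_eq_0_iff\<close>)
      also have "e * \<bar>s\<bar> * 1 = e * \<bar>s\<bar>" by simp
      finally show "norm (x s - x 0 - (s - 0) *\<^sub>R - L (D (0, 1))) \<le> e * norm (s - 0)"
        using split[of "x s - x 0" s] by simp
    qed
  qed
  then show ?thesis by (simp add: has_vector_derivative_def)
qed


section \<open>Quadratic forms\<close>

lemma norm_matrix_vector_mult_le:
  fixes A :: "real ^ 'n ^ 'n"
  shows "norm (A *v v) \<le> CARD('n) * norm A * norm v"
proof -
  have "norm (A *v v) \<le> (\<Sum>i\<in>UNIV. \<bar>(A *v v) $ i\<bar>)" by (rule norm_le_l1_cart)
  also have "\<dots> \<le> (\<Sum>i\<in>(UNIV::'n set). norm A * norm v)"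
  proof (rule sum_mono)
    fix i
    have "\<bar>(A *v v) $ i\<bar> \<le> norm (A $ i) * norm v"
      by (simp add: matrix_vector_mul_component Cauchy_Schwarz_ineq2)
    also have "\<dots> \<le> norm A * norm v" by (intro mult_right_mono Finite_Cartesian_Product.norm_nth_le) auto
    finally show "\<bar>(A *v v) $ i\<bar> \<le> norm A * norm v" .
  qed
  finally show ?thesis by simp
qed

lemma quadratic_form_perturbation:
  fixes A B :: "real ^ 'n ^ 'n"
  shows "\<bar>v \<bullet> (B *v v) - v \<bullet> (A *v v)\<bar> \<le> CARD('n) * norm (B - A) * (norm v)\<^sup>2"
proof -
  have "\<bar>v \<bullet> (B *v v) - v \<bullet> (A *v v)\<bar> = \<bar>v \<bullet> ((B - A) *v v)\<bar>"
    by (simp add: matrix_vector_mult_diff_rdistrib inner_diff_right)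
  also have "\<dots> \<le> norm v * norm ((B - A) *v v)" by (rule Cauchy_Schwarz_ineq2)
  also have "\<dots> \<le> norm v * (CARD('n) * norm (B - A) * norm v)"
    by (intro mult_left_mono norm_matrix_vector_mult_le) auto
  finally show ?thesis by (simp add: power2_eq_square mult_ac)
qed

lemma quadratic_form_le:
  fixes A :: "real ^ 'n ^ 'n"
  shows "v \<bullet> (A *v v) \<le> CARD('n) * norm A * (norm v)\<^sup>2"
  using quadratic_form_perturbation[of v A 0] by simp

lemma positive_definite_bounded_below:
  fixes A :: "real ^ 'n ^ 'n"
  assumes "\<And>v. v \<noteq> 0 \<Longrightarrow> v \<bullet> (A *v v) > 0"
  obtains m where "m > 0" "\<And>v. m * (norm v)\<^sup>2 \<le> v \<bullet> (A *v v)"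
proof -
  have "\<exists>x\<in>sphere (0::real^'n) 1. \<forall>y\<in>sphere 0 1. x \<bullet> (A *v x) \<le> y \<bullet> (A *v y)"
    by (rule continuous_attains_inf)
      (auto intro!: continuous_on_inner continuous_on_id linear_continuous_on[OF matrix_vector_mul_bounded_linear])
  then obtain x where x: "norm x = 1" "\<And>y. norm y = 1 \<Longrightarrow> x \<bullet> (A *v x) \<le> y \<bullet> (A *v y)"
    by auto
  show thesis
  proof
    show "x \<bullet> (A *v x) > 0" using assms[of x] x(1) by force
    fix v :: "real^'n"
    show "x \<bullet> (A *v x) * (norm v)\<^sup>2 \<le> v \<bullet> (A *v v)"
    proof (cases "v = 0")
      case False
      define y where "y = (1 / norm v) *\<^sub>R v"
      have v: "v = norm v *\<^sub>R y" "norm y = 1" using False by (simp_all add: y_def)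
      have "v \<bullet> (A *v v) = (norm v)\<^sup>2 * (y \<bullet> (A *v y))"
        by (subst (1 2) v(1)) (simp add: matrix_vector_mult_scaleR power2_eq_square)
      then show ?thesis using x(2)[OF v(2)] by (simp add: mult.commute[of "(norm v)\<^sup>2"] mult_right_mono)
    qed simp
  qed
qed

lemma positive_definite_Cauchy_Schwarz:
  fixes A :: "real ^ 'n ^ 'n"
  assumes sym: "transpose A = A" and pos: "\<And>v. v \<bullet> (A *v v) \<ge> 0"
  shows "x \<bullet> (A *v y) \<le> sqrt (x \<bullet> (A *v x)) * sqrt (y \<bullet> (A *v y))"
proof -
  define a b m where "a = x \<bullet> (A *v x)" and "b = y \<bullet> (A *v y)" and "m = x \<bullet> (A *v y)"
  have m: "y \<bullet> (A *v x) = m"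
    unfolding m_def by (metis sym dot_lmul_matrix inner_commute vector_transpose_matrix)
  have nn: "a \<ge> 0" "b \<ge> 0" using pos by (auto simp: a_def b_def)
  have "0 \<le> a - 2 * s * m + s\<^sup>2 * b" for s
  proof -
    have "0 \<le> (x - s *\<^sub>R y) \<bullet> (A *v (x - s *\<^sub>R y))" by (rule pos)
    also have "\<dots> = a - 2 * s * m + s\<^sup>2 * b"
      using m by (simp add: a_def b_def m_def matrix_vector_mult_diff_distrib matrix_vector_mult_scaleR
          inner_diff_left inner_diff_right power2_eq_square algebra_simps)
    finally show ?thesis .
  qed
  note q = this
  \<comment> \<open>nonpositive discriminant; in the degenerate case the polynomial in \<open>s\<close> is affine\<close>
  have "m\<^sup>2 \<le> a * b"
  proof (cases "b = 0")
    case True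
    have "m = 0"
    proof (rule ccontr)
      assume "m \<noteq> 0"
      then show False using q[of "(a + 1) / (2 * m)"] True nn by simp
    qed
    then show ?thesis using nn by simp
  next
    case False
    then show ?thesis using q[of "m / b"] nn by (simp add: field_simps power2_eq_square)
  qed
  then have "\<bar>m\<bar> \<le> sqrt (a * b)" by (simp add: real_le_rsqrt)
  then show ?thesis by (simp add: a_def b_def m_def real_sqrt_mult)
qed

text \<open>
  The mean value theorem along the segment between two points, tested against the segment itself,
  bounds the distance of the points by that of their images. Positivity persists near \<open>(z0, u0)\<close>,
  so the bound is uniform in the parameter.
\<close>

lemma strongly_monotone_near:
  fixes K :: "'z::metric_space \<Rightarrow> real ^ 'n \<Rightarrow> real ^ 'n" and M :: "'z \<Rightarrow> real ^ 'n \<Rightarrow> real ^ 'n ^ 'n"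
  assumes r: "r > 0"
    and D: "\<And>z u. z \<in> ball z0 r \<Longrightarrow> u \<in> ball u0 r \<Longrightarrow> (K z has_derivative (\<lambda>h. M z u *v h)) (at u)"
    and cont: "isCont (\<lambda>(z, u). M z u) (z0, u0)"
    and pos: "\<And>a. a \<noteq> 0 \<Longrightarrow> a \<bullet> (M z0 u0 *v a) > 0"
  obtains m \<delta> where "m > 0" "\<delta> > 0" "\<delta> \<le> r"
    "\<And>z u u'. z \<in> ball z0 \<delta> \<Longrightarrow> u \<in> ball u0 \<delta> \<Longrightarrow> u' \<in> ball u0 \<delta> \<Longrightarrow> m * norm (u - u') \<le> norm (K z u - K z u')"
proof -
  obtain m where m: "m > 0" "\<And>v. m * (norm v)\<^sup>2 \<le> v \<bullet> (M z0 u0 *v v)"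
    using positive_definite_bounded_below[OF pos] by blast
  define k where "k = m / (2 * CARD('n))"
  have k: "k > 0" using m by (simp add: k_def)
  obtain d where d: "d > 0" "\<And>z u. dist (z, u) (z0, u0) < d \<Longrightarrow> norm (M z u - M z0 u0) < k"
    using cont k unfolding continuous_at_eps_delta by (force simp: dist_norm)
  define \<delta> where "\<delta> = min r (d / 2)"
  have \<delta>: "\<delta> > 0" "\<delta> \<le> r" "2 * \<delta> \<le> d" using r d by (auto simp: \<delta>_def)
  show thesis
  proof
    show "m / 2 > 0" "\<delta> > 0" "\<delta> \<le> r" using m \<delta> by auto
    fix z u u' assume z: "z \<in> ball z0 \<delta>" and u: "u \<in> ball u0 \<delta>" "u' \<in> ball u0 \<delta>"
    define a where "a = u - u'"
    have lower: "m / 2 * (norm a)\<^sup>2 \<le> a \<bullet> (M z x *v a)" if "x \<in> ball u0 \<delta>" for x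
    proof -
      have "dist (z, x) (z0, u0) \<le> dist z z0 + dist x u0"
        using sqrt_sum_squares_le_sum[of "dist z z0" "dist x u0"] by (simp add: dist_Pair_Pair)
      then have "norm (M z x - M z0 u0) < k"
        using that z \<delta> by (intro d(2)) (auto simp: dist_commute)
      then have "CARD('n) * norm (M z x - M z0 u0) * (norm a)\<^sup>2 \<le> CARD('n) * k * (norm a)\<^sup>2"
        by (intro mult_right_mono mult_left_mono) auto
      also have "\<dots> = m / 2 * (norm a)\<^sup>2" by (simp add: k_def)
      finally show ?thesis
        using quadratic_form_perturbation[of a "M z x" "M z0 u0"] m(2)[of a] by linarith
    qed
    have seg: "u' + \<theta> *\<^sub>R a \<in> ball u0 \<delta>" if "0 \<le> \<theta>" "\<theta> \<le> 1" for \<theta>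
    proof -
      have "(1 - \<theta>) *\<^sub>R u' + \<theta> *\<^sub>R u \<in> ball u0 \<delta>"
        using convex_ball[of u0 \<delta>] u that unfolding convex_alt by blast
      then show ?thesis by (simp add: a_def algebra_simps)
    qed
    have "\<exists>\<theta>. 0 < \<theta> \<and> \<theta> < 1 \<and> a \<bullet> K z (u' + 1 *\<^sub>R a) - a \<bullet> K z (u' + 0 *\<^sub>R a) = (1 - 0) * (a \<bullet> (M z (u' + \<theta> *\<^sub>R a) *v a))"
    proof (rule MVT2)
      fix \<theta> :: real assume "0 \<le> \<theta>" "\<theta> \<le> 1"
      then have *: "u' + \<theta> *\<^sub>R a \<in> ball u0 \<delta>" using seg by blast
      have "(K z has_derivative (\<lambda>h. M z (u' + \<theta> *\<^sub>R a) *v h)) (at (u' + \<theta> *\<^sub>R a))"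
        using D[of z "u' + \<theta> *\<^sub>R a"] z * \<delta> by auto
      from has_derivative_along_line[OF this]
      have "((\<lambda>\<theta>. K z (u' + \<theta> *\<^sub>R a)) has_derivative (\<lambda>h. h *\<^sub>R (M z (u' + \<theta> *\<^sub>R a) *v a))) (at \<theta>)"
        by (simp add: has_vector_derivative_def)
      from has_derivative_inner_right[OF this, of a]
      show "((\<lambda>\<theta>. a \<bullet> K z (u' + \<theta> *\<^sub>R a)) has_real_derivative a \<bullet> (M z (u' + \<theta> *\<^sub>R a) *v a)) (at \<theta>)"
        by (simp add: has_field_derivative_def mult.commute[of "_ \<bullet> _"] inner_scaleR_right mult_commute_abs)
    qed simp
    then obtain \<theta> where \<theta>: "0 < \<theta>" "\<theta> < 1" "a \<bullet> (K z u - K z u') = a \<bullet> (M z (u' + \<theta> *\<^sub>R a) *v a)"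
      by (auto simp: a_def inner_diff_right)
    have "m / 2 * (norm a)\<^sup>2 \<le> a \<bullet> (K z u - K z u')"
      using lower[OF seg[of \<theta>]] \<theta> by simp
    also have "\<dots> \<le> norm a * norm (K z u - K z u')" by (rule norm_cauchy_schwarz)
    finally show "m / 2 * norm (u - u') \<le> norm (K z u - K z u')"
      by (cases "a = 0") (auto simp: a_def power2_eq_square mult_ac)
  qed
qed

section \<open>Charts, covectors and the metric\<close>

lemma transpose_matrix_vector_inner:
  fixes J :: "real ^ 'n ^ 'm"
  shows "(transpose J *v a) \<bullet> b = a \<bullet> (J *v b)"
  by (metis dot_lmul_matrix transpose_matrix_vector)

locale atlas =
  fixes A :: "('m::t2_space, 'n::finite) chart set"
  assumes atlas: "smooth_atlas A"
begin

lemma open_chart_dom: "c \<in> A \<Longrightarrow> open (chart_dom c)"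
  and open_chart_image: "c \<in> A \<Longrightarrow> open (coord c ` chart_dom c)"
  using atlas by (auto simp: smooth_atlas_def)

lemma chart_homeomorphism:
  "c \<in> A \<Longrightarrow> homeomorphism (chart_dom c) (coord c ` chart_dom c) (coord c) (coord_inv c)"
  using atlas by (auto simp: smooth_atlas_def)

lemma coord_inv_coord [simp]: "c \<in> A \<Longrightarrow> x \<in> chart_dom c \<Longrightarrow> coord_inv c (coord c x) = x"
  and coord_coord_inv: "c \<in> A \<Longrightarrow> u \<in> coord c ` chart_dom c \<Longrightarrow> coord c (coord_inv c u) = u"
  and coord_inv_in_dom: "c \<in> A \<Longrightarrow> u \<in> coord c ` chart_dom c \<Longrightarrow> coord_inv c u \<in> chart_dom c"
  and continuous_on_coord: "c \<in> A \<Longrightarrow> continuous_on (chart_dom c) (coord c)"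
  and continuous_on_coord_inv: "c \<in> A \<Longrightarrow> continuous_on (coord c ` chart_dom c) (coord_inv c)"
  using chart_homeomorphism unfolding homeomorphism_def by blast+

lemma open_coord_image:
  assumes "c \<in> A" "open V" "V \<subseteq> chart_dom c"
  shows "open (coord c ` V)"
proof -
  have "coord c ` V = coord c ` chart_dom c \<inter> coord_inv c -` V"
    using assms by (force simp: coord_inv_coord)
  then show ?thesis
    using continuous_open_preimage[OF continuous_on_coord_inv open_chart_image] assms by simp
qed

lemma in_coord_inv_image_iff:
  assumes "c \<in> A" "U \<subseteq> coord c ` chart_dom c"
  shows "x \<in> coord_inv c ` U \<longleftrightarrow> x \<in> chart_dom c \<and> coord c x \<in> U"
proof
  assume "x \<in> coord_inv c ` U"
  then show "x \<in> chart_dom c \<and> coord c x \<in> U"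
    using assms coord_coord_inv[OF assms(1)] coord_inv_in_dom[OF assms(1)] by auto
next
  assume "x \<in> chart_dom c \<and> coord c x \<in> U"
  then show "x \<in> coord_inv c ` U"
    using coord_inv_coord[OF assms(1), of x] by force
qed

lemma open_coord_inv_image:
  assumes "c \<in> A" "open U" "U \<subseteq> coord c ` chart_dom c"
  shows "open (coord_inv c ` U)"
proof -
  have "coord_inv c ` U = chart_dom c \<inter> coord c -` U"
    using in_coord_inv_image_iff assms(1,3) by blast
  then show ?thesis
    using continuous_open_preimage[OF continuous_on_coord open_chart_dom] assms by simp
qed

lemma closed_coord_inv_image:
  assumes "c \<in> A" "compact K" "K \<subseteq> coord c ` chart_dom c"
  shows "closed (coord_inv c ` K)"
  by (intro compact_imp_closed compact_continuous_image assms
      continuous_on_subset[OF continuous_on_coord_inv])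

lemma isCont_coord: "c \<in> A \<Longrightarrow> x \<in> chart_dom c \<Longrightarrow> isCont (coord c) x"
  and isCont_coord_inv: "c \<in> A \<Longrightarrow> u \<in> coord c ` chart_dom c \<Longrightarrow> isCont (coord_inv c) u"
  using continuous_on_coord open_chart_dom continuous_on_coord_inv open_chart_image
  by (metis continuous_on_eq_continuous_at)+

lemma chart_at_in_atlas: "chart_at A x \<in> A" and in_chart_at: "x \<in> chart_dom (chart_at A x)"
proof -
  have "x \<in> (\<Union>c\<in>A. chart_dom c)" using atlas unfolding smooth_atlas_def by (metis UNIV_I)
  then have "\<exists>c. c \<in> A \<and> x \<in> chart_dom c" by blast
  from someI_ex[OF this] show "chart_at A x \<in> A" "x \<in> chart_dom (chart_at A x)"
    by (auto simp: chart_at_def)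
qed

lemma transition_smooth:
  "c \<in> A \<Longrightarrow> d \<in> A \<Longrightarrow> smooth_on (coord c ` (chart_dom c \<inter> chart_dom d)) (coord d \<circ> coord_inv c)"
  using atlas by (auto simp: smooth_atlas_def)

lemma transition_jacobian_works:
  assumes "(coord d \<circ> coord_inv c has_derivative D) (at (coord c x))"
  shows "transition_jacobian c d x *v h = D h"
proof -
  have "frechet_derivative (coord d \<circ> coord_inv c) (at (coord c x)) = D"
    using assms frechet_derivative_at by metis
  moreover have "linear D" using assms has_derivative_linear by blast
  ultimately show ?thesis
    by (simp add: transition_jacobian_def jacobian_def)
qed

lemma transition_has_derivative:
  assumes "c \<in> A" "d \<in> A" "x \<in> chart_dom c" "x \<in> chart_dom d"
  shows "(coord d \<circ> coord_inv c has_derivative (\<lambda>h. transition_jacobian c d x *v h)) (at (coord c x))"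
proof -
  have *: "(coord d \<circ> coord_inv c has_derivative
       frechet_derivative (coord d \<circ> coord_inv c) (at (coord c x))) (at (coord c x))"
    using smooth_on_has_derivative[OF transition_smooth[OF assms(1,2)]] assms by auto
  have "frechet_derivative (coord d \<circ> coord_inv c) (at (coord c x)) = (\<lambda>h. transition_jacobian c d x *v h)"
    using transition_jacobian_works[OF *] by (simp add: fun_eq_iff)
  then show ?thesis using * by simp
qed

lemma transition_jacobian_self:
  assumes "c \<in> A" "x \<in> chart_dom c"
  shows "transition_jacobian c c x = mat 1"
proof -
  have "((\<lambda>u. u) has_derivative (\<lambda>h. h)) (at (coord c x))" by simp
  then have "(coord c \<circ> coord_inv c has_derivative (\<lambda>h. h)) (at (coord c x))"
    by (rule has_derivative_transform_within_open[OF _ open_chart_image])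
      (use assms in \<open>auto simp: coord_coord_inv\<close>)
  then show ?thesis
    using transition_jacobian_works by (metis matrix_eq matrix_vector_mul_lid)
qed

lemma transition_jacobian_cocycle:
  assumes "c \<in> A" "d \<in> A" "e \<in> A" "x \<in> chart_dom c" "x \<in> chart_dom d" "x \<in> chart_dom e"
  shows "transition_jacobian d e x ** transition_jacobian c d x = transition_jacobian c e x"
proof -
  let ?W = "coord c ` (chart_dom c \<inter> chart_dom d)"
  have W: "open ?W" by (intro open_coord_image open_Int open_chart_dom assms) auto
  have "(coord e \<circ> coord_inv d has_derivative (\<lambda>h. transition_jacobian d e x *v h))
      (at ((coord d \<circ> coord_inv c) (coord c x)))"
    using transition_has_derivative[of d e x] assms by simp
  from has_derivative_compose[OF transition_has_derivative[OF assms(1,2,4,5)] this]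
  have "((\<lambda>u. (coord e \<circ> coord_inv d) ((coord d \<circ> coord_inv c) u)) has_derivative
      (\<lambda>h. transition_jacobian d e x *v (transition_jacobian c d x *v h))) (at (coord c x))" .
  then have "(coord e \<circ> coord_inv c has_derivative
      (\<lambda>h. transition_jacobian d e x *v (transition_jacobian c d x *v h))) (at (coord c x))"
    by (rule has_derivative_transform_within_open[OF _ W]) (use assms in auto)
  from transition_jacobian_works[OF this] show ?thesis
    by (metis matrix_eq matrix_vector_mul_assoc)
qed

lemma covector_of_self:
  "c \<in> A \<Longrightarrow> x \<in> chart_dom c \<Longrightarrow> covector_of A c x v c = v"
  by (simp add: covector_of_def transition_jacobian_self transpose_mat)

lemma is_covector_covector_of:
  assumes "c \<in> A" "x \<in> chart_dom c"
  shows "is_covector A x (covector_of A c x v)"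
  unfolding is_covector_def
proof (intro conjI ballI allI impI)
  fix d e assume de: "d \<in> A" "e \<in> A" "x \<in> chart_dom d \<inter> chart_dom e"
  show "covector_of A c x v d = transpose (transition_jacobian d e x) *v covector_of A c x v e"
    using de assms transition_jacobian_cocycle[of d e c x, symmetric]
    by (simp add: covector_of_def matrix_vector_mul_assoc matrix_transpose_mul del: transpose_matrix_vector)
qed (auto simp: covector_of_def)

lemma covector_of_components:
  assumes "is_covector A x \<xi>" "c \<in> A" "x \<in> chart_dom c"
  shows "covector_of A c x (\<xi> c) = \<xi>"
proof
  fix d
  show "covector_of A c x (\<xi> c) d = \<xi> d"
  proof (cases "d \<in> A \<and> x \<in> chart_dom d")
    case True
    then have "\<xi> d = transpose (transition_jacobian d c x) *v \<xi> c"
      using assms unfolding is_covector_def by blast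
    then show ?thesis using True by (simp add: covector_of_def)
  next
    case False
    then have "\<xi> d = 0" using assms(1) unfolding is_covector_def by blast
    then show ?thesis using False by (auto simp: covector_of_def)
  qed
qed

lemma covector_of_punctured:
  assumes "c \<in> A" "x \<in> chart_dom c" "v \<noteq> 0"
  shows "(x, covector_of A c x v) \<in> punctured_cotangent A"
  using is_covector_covector_of[OF assms(1,2)] covector_of_self[OF assms(1,2), of v] assms(3)
  by (auto simp: punctured_cotangent_def)

lemma punctured_component_nonzero:
  assumes "(x, \<xi>) \<in> punctured_cotangent A" "c \<in> A" "x \<in> chart_dom c"
  shows "\<xi> c \<noteq> 0"
proof
  assume "\<xi> c = 0"
  moreover have "covector_of A c x (\<xi> c) = \<xi>"
    using covector_of_components assms by (auto simp: punctured_cotangent_def)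
  ultimately have "\<xi> = (\<lambda>c. 0)" by (auto simp: covector_of_def)
  then show False using assms(1) by (simp add: punctured_cotangent_def)
qed

lemma covector_pairing:
  assumes "is_covector A x \<xi>" "c \<in> A" "d \<in> A" "x \<in> chart_dom c" "x \<in> chart_dom d"
  shows "\<xi> d \<bullet> (transition_jacobian c d x *v w) = \<xi> c \<bullet> w"
  using assms unfolding is_covector_def by (metis IntI transpose_matrix_vector_inner)

lemma has_vector_derivative_change_chart:
  assumes cd: "c \<in> A" "d \<in> A" "\<gamma> s \<in> chart_dom c" "\<gamma> s \<in> chart_dom d"
    and \<gamma>: "continuous (at s within I) \<gamma>" and s: "s \<in> I"
    and der: "((\<lambda>r. coord c (\<gamma> r)) has_vector_derivative w) (at s within I)"
  shows "((\<lambda>r. coord d (\<gamma> r)) has_vector_derivative transition_jacobian c d (\<gamma> s) *v w) (at s within I)"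
proof -
  have "((\<lambda>r. (coord d \<circ> coord_inv c) (coord c (\<gamma> r))) has_derivative
      (\<lambda>h. transition_jacobian c d (\<gamma> s) *v (h *\<^sub>R w))) (at s within I)"
    using has_derivative_compose[OF der[unfolded has_vector_derivative_def] 
        transition_has_derivative[OF cd]] .
  then have "((\<lambda>r. (coord d \<circ> coord_inv c) (coord c (\<gamma> r))) has_vector_derivative
      transition_jacobian c d (\<gamma> s) *v w) (at s within I)"
    by (simp add: has_vector_derivative_def matrix_vector_mult_scaleR)
  moreover have "eventually (\<lambda>r. \<gamma> r \<in> chart_dom c) (at s within I)"
    using \<gamma> open_chart_dom[OF cd(1)] cd(3) unfolding continuous_within
    by (auto dest: topological_tendstoD)
  then have "eventually (\<lambda>r. (coord d \<circ> coord_inv c) (coord c (\<gamma> r)) = coord d (\<gamma> r)) (at s within I)"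
    by eventually_elim (simp add: cd(1))
  ultimately show ?thesis
    unfolding has_vector_derivative_def
    by (rule has_derivative_transform_eventually) (use cd s in auto)
qed

end

locale riemannian_atlas = atlas A for A :: "('m::t2_space, 'n::finite) chart set" +
  fixes g :: "('m, 'n) metric"
  assumes metric: "riemannian_metric A g"
begin

lemma metric_smooth: "c \<in> A \<Longrightarrow> smooth_on (coord c ` chart_dom c) (g c)"
  and metric_symmetric: "c \<in> A \<Longrightarrow> u \<in> coord c ` chart_dom c \<Longrightarrow> transpose (g c u) = g c u"
  and metric_positive: "c \<in> A \<Longrightarrow> u \<in> coord c ` chart_dom c \<Longrightarrow> v \<noteq> 0 \<Longrightarrow> v \<bullet> (g c u *v v) > 0"
  and metric_transform: "c \<in> A \<Longrightarrow> d \<in> A \<Longrightarrow> x \<in> chart_dom c \<Longrightarrow> x \<in> chart_dom d \<Longrightarrow>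
    g c (coord c x) = transpose (transition_jacobian c d x) ** g d (coord d x) ** transition_jacobian c d x"
  using metric unfolding riemannian_metric_def by blast+

lemma metric_nonneg: "c \<in> A \<Longrightarrow> u \<in> coord c ` chart_dom c \<Longrightarrow> v \<bullet> (g c u *v v) \<ge> 0"
  using metric_positive[of c u v] by (cases "v = 0") (auto simp: less_imp_le)

lemma metric_isCont: "c \<in> A \<Longrightarrow> u \<in> coord c ` chart_dom c \<Longrightarrow> isCont (g c) u"
  using smooth_on_imp_continuous_on[OF metric_smooth] open_chart_image
  by (metis continuous_on_eq_continuous_at)

lemma metric_invertible:
  assumes "c \<in> A" "u \<in> coord c ` chart_dom c"
  shows "invertible (g c u)"
proof -
  have "\<forall>x. g c u *v x = 0 \<longrightarrow> x = 0"
    using metric_positive[OF assms] by (metis inner_zero_right less_irrefl)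
  then show ?thesis
    using matrix_left_invertible_ker invertible_left_inverse by blast
qed

lemma metric_inverse:
  assumes "c \<in> A" "u \<in> coord c ` chart_dom c"
  shows "g c u ** inv_metric g c u = mat 1" "inv_metric g c u ** g c u = mat 1"
  using someI_ex[OF metric_invertible[OF assms, unfolded invertible_def]]
  by (auto simp: matrix_inv_def)

lemma metric_change_chart:
  assumes "c \<in> A" "d \<in> A" "x \<in> chart_dom c" "x \<in> chart_dom d"
  shows "(transition_jacobian c d x *v w) \<bullet> (g d (coord d x) *v (transition_jacobian c d x *v w))
    = w \<bullet> (g c (coord c x) *v w)"
  unfolding metric_transform[OF assms]
  by (metis inner_commute matrix_vector_mul_assoc transpose_matrix_vector_inner)

text \<open>
  Raising the index of the covector turns the quadratic form of the inverse metric into that of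
  the metric.
\<close>

lemma ham_positive:
  assumes "(x, \<xi>) \<in> punctured_cotangent A"
  shows "ham A g (x, \<xi>) > 0"
proof -
  let ?c = "chart_at A x"
  let ?u = "coord ?c x" let ?v = "\<xi> ?c"
  have c: "?c \<in> A" "?u \<in> coord ?c ` chart_dom ?c"
    using chart_at_in_atlas in_chart_at by auto
  have v: "?v \<noteq> 0"
    using punctured_component_nonzero[OF assms] chart_at_in_atlas in_chart_at by blast
  define z where "z = inv_metric g ?c ?u *v ?v"
  have vz: "?v = g ?c ?u *v z"
    by (simp add: z_def matrix_vector_mul_assoc metric_inverse[OF c])
  then have "z \<noteq> 0" using v by auto
  have "(\<Sum>\<alpha>\<in>UNIV. \<Sum>\<beta>\<in>UNIV. inv_metric g ?c ?u $ \<alpha> $ \<beta> * ?v $ \<alpha> * ?v $ \<beta>) = ?v \<bullet> z"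
    by (simp add: inner_vec_def z_def matrix_vector_mult_def sum_distrib_left mult_ac)
  also have "\<dots> = z \<bullet> (g ?c ?u *v z)" using vz by (simp add: inner_commute)
  also have "\<dots> > 0" by (rule metric_positive[OF c \<open>z \<noteq> 0\<close>])
  finally show ?thesis by (simp add: ham_def ham_coord_def Let_def)
qed

end

section \<open>Length of curves in a chart\<close>

lemma velocity_eqI:
  assumes "((\<lambda>r. coord c (\<gamma> r)) has_vector_derivative w) (at s within {a..b})" "a < b" "s \<in> {a..b}"
  shows "velocity {a..b} c \<gamma> s = w"
  unfolding velocity_def using vector_derivative_within_closed_interval assms by blast

lemma velocity_works:
  assumes "(\<lambda>r. coord c (\<gamma> r)) differentiable (at s within I)"
  shows "((\<lambda>r. coord c (\<gamma> r)) has_vector_derivative velocity I c \<gamma> s) (at s within I)"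
  using assms unfolding velocity_def vector_derivative_works .

context riemannian_atlas
begin

text \<open>
  At a break point of a piecewise smooth curve the one-sided velocities may differ, so the interval
  within which the velocity is taken is a parameter here.
\<close>

definition speed_within :: "real set \<Rightarrow> (real \<Rightarrow> 'm) \<Rightarrow> real \<Rightarrow> real" where
  "speed_within I \<gamma> s =
     (let c = chart_at A (\<gamma> s); v = velocity I c \<gamma> s in sqrt (v \<bullet> (g c (coord c (\<gamma> s)) *v v)))"

lemma speed_eq_speed_within: "speed A g \<gamma> s = speed_within {0..1} \<gamma> s"
  by (simp add: speed_def speed_within_def)

lemma speed_within_in_chart:
  assumes "c \<in> A" "\<gamma> s \<in> chart_dom c" "a < b" "s \<in> {a..b}" "continuous (at s within {a..b}) \<gamma>"
    and "((\<lambda>r. coord c (\<gamma> r)) has_vector_derivative w) (at s within {a..b})"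
  shows "speed_within {a..b} \<gamma> s = sqrt (w \<bullet> (g c (coord c (\<gamma> s)) *v w))"
proof -
  let ?d = "chart_at A (\<gamma> s)"
  have d: "?d \<in> A" "\<gamma> s \<in> chart_dom ?d" using chart_at_in_atlas in_chart_at by auto
  have "velocity {a..b} ?d \<gamma> s = transition_jacobian c ?d (\<gamma> s) *v w"
    using has_vector_derivative_change_chart[OF assms(1) d(1) assms(2) d(2) assms(5,4,6)] assms(3,4)
    by (rule velocity_eqI)
  then show ?thesis
    by (simp add: speed_within_def Let_def metric_change_chart[OF assms(1) d(1) assms(2) d(2)])
qed

lemma speed_nonneg: "speed A g \<gamma> s \<ge> 0"
  using metric_nonneg chart_at_in_atlas in_chart_at by (simp add: speed_def Let_def)

lemma curve_length_nonneg: "curve_length A g \<gamma> \<ge> 0"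
  unfolding curve_length_def
  by (cases "speed A g \<gamma> integrable_on {0..1}")
    (auto simp: speed_nonneg not_integrable_integral intro: integral_nonneg)

lemma continuous_on_speed_within:
  assumes "a < b" "C1_curve_on A {a..b} \<gamma>"
  shows "continuous_on {a..b} (speed_within {a..b} \<gamma>)"
  unfolding continuous_on_def
proof
  fix s assume s: "s \<in> {a..b}"
  let ?c = "chart_at A (\<gamma> s)"
  have c: "?c \<in> A" "\<gamma> s \<in> chart_dom ?c" using chart_at_in_atlas in_chart_at by auto
  let ?v = "velocity {a..b} ?c \<gamma>"
  let ?f = "\<lambda>r. sqrt (?v r \<bullet> (g ?c (coord ?c (\<gamma> r)) *v ?v r))"
  have \<gamma>: "(\<gamma> \<longlongrightarrow> \<gamma> s) (at s within {a..b})"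
    using assms(2) s by (auto simp: C1_curve_on_def continuous_on_def)
  have v: "(?v \<longlongrightarrow> ?v s) (at s within {a..b})"
    using assms(2) s c unfolding C1_curve_on_def continuous_within by blast
  have "isCont (\<lambda>x. g ?c (coord ?c x)) (\<gamma> s)"
    using isCont_o2[OF isCont_coord[OF c] metric_isCont[OF c(1)]] c by auto
  then have "((\<lambda>r. g ?c (coord ?c (\<gamma> r))) \<longlongrightarrow> g ?c (coord ?c (\<gamma> s))) (at s within {a..b})"
    using \<gamma> by (rule isCont_tendsto_compose)
  then have lim: "(?f \<longlongrightarrow> ?f s) (at s within {a..b})"
    using v unfolding inner_vec_def matrix_vector_mult_def
    by (auto intro!: tendsto_intros)
  have "eventually (\<lambda>r. \<gamma> r \<in> chart_dom ?c) (at s within {a..b})"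
    using \<gamma> open_chart_dom[OF c(1)] c(2) by (auto dest: topological_tendstoD)
  moreover have "eventually (\<lambda>r. r \<in> {a..b}) (at s within {a..b})"
    by (simp add: eventually_at_filter)
  ultimately have near: "eventually (\<lambda>r. \<gamma> r \<in> chart_dom ?c \<and> r \<in> {a..b}) (at s within {a..b})"
    by (rule eventually_conj)
  have f: "?f r = speed_within {a..b} \<gamma> r" if "\<gamma> r \<in> chart_dom ?c" "r \<in> {a..b}" for r
    using assms c that
    by (intro speed_within_in_chart[symmetric] velocity_works)
      (auto simp: C1_curve_on_def continuous_on_eq_continuous_within)
  have "eventually (\<lambda>r. ?f r = speed_within {a..b} \<gamma> r) (at s within {a..b})"
    using near by eventually_elim (rule f; simp)
  with lim have "(speed_within {a..b} \<gamma> \<longlongrightarrow> ?f s) (at s within {a..b})"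
    by (rule Lim_transform_eventually)
  then show "(speed_within {a..b} \<gamma> \<longlongrightarrow> speed_within {a..b} \<gamma> s) (at s within {a..b})"
    using f[of s] s c by simp
qed

text \<open>
  \<open>curve_length\<close> is 0 for a curve whose speed is not integrable, so lower bounds on the length depend
  on the integrability stated here.
\<close>

lemma piecewise_C1_curve_regularity:
  assumes "piecewise_C1_curve A \<gamma>"
  obtains S where "finite S" "0 \<in> S" "1 \<in> S" "continuous_on {0..1} \<gamma>" "speed A g \<gamma> integrable_on {0..1}"
    "\<And>s c. s \<in> {0..1} - S \<Longrightarrow> c \<in> A \<Longrightarrow> \<gamma> s \<in> chart_dom c \<Longrightarrow> (\<lambda>r. coord c (\<gamma> r)) differentiable (at s)"
proof -
  obtain k and \<tau> :: "nat \<Rightarrow> real" where \<tau>: "\<tau> 0 = 0" "\<tau> k = 1"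
    and step: "\<And>i. i < k \<Longrightarrow> \<tau> i < \<tau> (Suc i) \<and> C1_curve_on A {\<tau> i..\<tau> (Suc i)} \<gamma>"
    using assms unfolding piecewise_C1_curve_def by blast
  have mono: "\<tau> i \<le> \<tau> j" if "i \<le> j" "j \<le> k" for i j
    using that
  proof (induction j rule: dec_induct)
    case (step n)
    then show ?case using \<open>\<And>i. i < k \<Longrightarrow> _\<close>[of n] by auto
  qed auto
  define S where "S = \<tau> ` {..k}"
  have main: "continuous_on {0..\<tau> j} \<gamma> \<and> speed A g \<gamma> integrable_on {0..\<tau> j} \<and>
    (\<forall>s\<in>{0..\<tau> j} - S. \<forall>c\<in>A. \<gamma> s \<in> chart_dom c \<longrightarrow> (\<lambda>r. coord c (\<gamma> r)) differentiable (at s))"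
    if "j \<le> k" for j
    using that
  proof (induction j)
    case 0
    have "0 \<in> S" using \<tau> by (force simp: S_def)
    then show ?case using \<tau>(1) integrable_on_refl[of "speed A g \<gamma>" 0] by (auto simp: )
  next
    case (Suc j)
    then have j: "j < k" "j \<le> k" by auto
    define a b where "a = \<tau> j" and "b = \<tau> (Suc j)"
    have ab: "0 \<le> a" "a < b" "b \<le> 1" "a \<in> S" "b \<in> S" and C1: "C1_curve_on A {a..b} \<gamma>"
      using step[OF j(1)] mono[of 0 j] mono[of "Suc j" k] Suc.prems \<tau> by (auto simp: a_def b_def S_def)
    have un: "{0..b} = {0..a} \<union> {a..b}" using ab by auto
    have inner: "at s within {0..1} = at s" "at s within {a..b} = at s" if "s \<in> {a<..<b}" for s
      using that ab by (auto intro!: at_within_interior)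
    have "continuous_on {0..b} \<gamma>"
      unfolding un using Suc j C1 by (intro continuous_on_closed_Un) (auto simp: a_def C1_curve_on_def)
    moreover have "speed A g \<gamma> integrable_on {0..b}"
    proof (rule Henstock_Kurzweil_Integration.integrable_combine)
      show "speed A g \<gamma> integrable_on {0..a}" using Suc j by (simp add: a_def)
      have "speed_within {a..b} \<gamma> integrable_on {a..b}"
        using continuous_on_speed_within[OF ab(2) C1] integrable_continuous_real by blast
      then show "speed A g \<gamma> integrable_on {a..b}"
      proof (rule integrable_spike_finite[of "{a, b}", rotated 2])
        fix s assume "s \<in> {a..b} - {a, b}"
        then have "s \<in> {a<..<b}" by auto
        then show "speed A g \<gamma> s = speed_within {a..b} \<gamma> s"
          using inner by (simp add: speed_eq_speed_within speed_within_def velocity_def)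
      qed simp
    qed (use ab in auto)
    moreover have "(\<lambda>r. coord c (\<gamma> r)) differentiable (at s)"
      if "s \<in> {0..b} - S" "c \<in> A" "\<gamma> s \<in> chart_dom c" for s c
    proof (cases "s \<le> a")
      case True
      then show ?thesis using Suc j that by (auto simp: a_def)
    next
      case False
      then have s: "s \<in> {a<..<b}" using that ab by (cases "s = b") auto
      then have "(\<lambda>r. coord c (\<gamma> r)) differentiable (at s within {a..b})"
        using C1 that unfolding C1_curve_on_def by simp
      then show ?thesis using inner(2)[OF s] by simp
    qed
    ultimately show ?case by (simp add: b_def)
  qed
  show thesis
  proof (rule that[of S])
    show "finite S" "0 \<in> S" "1 \<in> S" using \<tau> by (force simp: S_def)+
  qed (use main[of k] \<tau> in auto)
qed

text \<open>
  The lower bound is tested against the linear functional \<open>v \<mapsto> e \<bullet> G v / |e|\<close> that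
  calibrates the displacement \<open>e\<close>: by Cauchy--Schwarz it is dominated by the speed, and its
  integral along the curve depends on the endpoints only.
\<close>

lemma displacement_le_curve_length:
  assumes curve: "piecewise_C1_curve A \<gamma>" and c: "c \<in> A" and T: "0 \<le> T" "T \<le> 1"
    and dom: "\<And>s. s \<in> {0..T} \<Longrightarrow> \<gamma> s \<in> chart_dom c"
    and G: "transpose G = G" "\<And>v. v \<bullet> (G *v v) \<ge> 0"
    and le: "\<And>s v. s \<in> {0..T} \<Longrightarrow> v \<bullet> (G *v v) \<le> v \<bullet> (g c (coord c (\<gamma> s)) *v v)"
    and e: "e = coord c (\<gamma> T) - coord c (\<gamma> 0)"
  shows "sqrt (e \<bullet> (G *v e)) \<le> curve_length A g \<gamma>"
proof (cases "sqrt (e \<bullet> (G *v e)) = 0")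
  case True
  then show ?thesis using curve_length_nonneg by simp
next
  case False
  define N where "N = sqrt (e \<bullet> (G *v e))"
  have N: "N > 0" using False G(2)[of e] by (simp add: N_def)
  obtain S where S: "finite S" "0 \<in> S" "1 \<in> S" "continuous_on {0..1} \<gamma>" "speed A g \<gamma> integrable_on {0..1}"
    "\<And>s c. s \<in> {0..1} - S \<Longrightarrow> c \<in> A \<Longrightarrow> \<gamma> s \<in> chart_dom c \<Longrightarrow> (\<lambda>r. coord c (\<gamma> r)) differentiable (at s)"
    using piecewise_C1_curve_regularity[OF curve] by blast
  define a where "a = (1 / N) *\<^sub>R (G *v e)"
  have a: "a \<bullet> v = (e \<bullet> (G *v v)) / N" for v
    by (simp add: a_def) (metis G(1) dot_lmul_matrix transpose_matrix_vector)
  have deriv: "((\<lambda>r. coord c (\<gamma> r)) has_vector_derivative velocity {0..1} c \<gamma> s) (at s)"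
    and bound: "a \<bullet> velocity {0..1} c \<gamma> s \<le> speed A g \<gamma> s" if s: "s \<in> {0..T} - S" for s
  proof -
    have "s \<noteq> 0" "s \<noteq> 1" using s S by auto
    then have s01: "s \<in> {0<..<1}" using s T by auto
    then have at: "at s within {0..1} = at s" by (intro at_within_interior) auto
    show d: "((\<lambda>r. coord c (\<gamma> r)) has_vector_derivative velocity {0..1} c \<gamma> s) (at s)"
      using velocity_works[of c \<gamma> s "{0..1}"] S(6)[of s c] s T c dom at by auto
    let ?v = "velocity {0..1} c \<gamma> s"
    have "e \<bullet> (G *v ?v) \<le> N * sqrt (?v \<bullet> (G *v ?v))"
      unfolding N_def by (rule positive_definite_Cauchy_Schwarz[OF G])
    then have "a \<bullet> ?v \<le> sqrt (?v \<bullet> (G *v ?v))"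
      using N by (simp add: a field_simps)
    also have "\<dots> \<le> sqrt (?v \<bullet> (g c (coord c (\<gamma> s)) *v ?v))"
      using le[of s ?v] s by simp
    also have "\<dots> = speed A g \<gamma> s"
      unfolding speed_eq_speed_within
    proof (intro speed_within_in_chart[symmetric])
      show "continuous (at s within {0..1}) \<gamma>"
        using S(4) s01 by (auto simp: continuous_on_eq_continuous_within)
    qed (use d s s01 at dom[of s] c in auto)
    finally show "a \<bullet> ?v \<le> speed A g \<gamma> s" .
  qed
  have cont: "continuous_on {0..T} (\<lambda>s. a \<bullet> coord c (\<gamma> s))"
  proof (intro continuous_on_inner continuous_on_const continuous_on_compose2[OF continuous_on_coord[OF c]])
    show "continuous_on {0..T} \<gamma>" using S(4) T by (auto intro: continuous_on_subset)
  qed (use dom in auto)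
  have "((\<lambda>s. a \<bullet> velocity {0..1} c \<gamma> s) has_integral (a \<bullet> coord c (\<gamma> T) - a \<bullet> coord c (\<gamma> 0))) {0..T}"
  proof (rule fundamental_theorem_of_calculus_interior_strong[OF S(1) T(1) _ cont])
    fix s assume "s \<in> {0<..<T} - S"
    then have "s \<in> {0..T} - S" by auto
    from has_derivative_inner_right[OF deriv[OF this, unfolded has_vector_derivative_def], of a]
    show "((\<lambda>s. a \<bullet> coord c (\<gamma> s)) has_vector_derivative a \<bullet> velocity {0..1} c \<gamma> s) (at s)"
      by (simp add: has_vector_derivative_def)
  qed
  moreover have "a \<bullet> coord c (\<gamma> T) - a \<bullet> coord c (\<gamma> 0) = N"
  proof -
    have "a \<bullet> coord c (\<gamma> T) - a \<bullet> coord c (\<gamma> 0) = a \<bullet> e" by (simp add: e inner_diff_right)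
    also have "\<dots> = N\<^sup>2 / N" using G(2)[of e] by (simp add: a N_def)
    finally show ?thesis using N by (simp add: power2_eq_square)
  qed
  ultimately have int: "((\<lambda>s. a \<bullet> velocity {0..1} c \<gamma> s) has_integral N) {0..T}" by simp
  have sub: "speed A g \<gamma> integrable_on {0..T}"
    using S(5) T by (auto intro: integrable_on_subinterval)
  have int': "((\<lambda>s. if s \<in> S then speed A g \<gamma> s else a \<bullet> velocity {0..1} c \<gamma> s) has_integral N) {0..T}"
    by (rule has_integral_spike_finite[OF S(1) _ int]) auto
  have "N \<le> integral {0..T} (speed A g \<gamma>)"
    by (rule has_integral_le[OF int' integrable_integral[OF sub]]) (use bound in auto)
  also have "\<dots> \<le> integral {0..1} (speed A g \<gamma>)"
    using T sub S(5) speed_nonneg by (intro integral_subset_le) auto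
  finally show ?thesis by (simp add: N_def curve_length_def)
qed

text \<open>
  Up to the first time at which the curve leaves the open ball it stays in the closed ball, where its
  length dominates the displacement; at that time the displacement has norm \<open>r\<close>, so a curve that is
  shorter than every such displacement never leaves. That the closed ball is compact, hence
  closed in the manifold, keeps the exit point inside the chart.
\<close>

lemma curve_stays_in_ball:
  assumes curve: "piecewise_C1_curve A \<gamma>" and c: "c \<in> A" "\<gamma> 0 \<in> chart_dom c" and r: "r > 0"
    and ball: "cball (coord c (\<gamma> 0)) r \<subseteq> coord c ` chart_dom c"
    and G: "transpose G = G" "\<And>v. v \<bullet> (G *v v) \<ge> 0"
    and le: "\<And>u v. u \<in> cball (coord c (\<gamma> 0)) r \<Longrightarrow> v \<bullet> (G *v v) \<le> v \<bullet> (g c u *v v)"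
    and short: "\<And>e. norm e = r \<Longrightarrow> curve_length A g \<gamma> < sqrt (e \<bullet> (G *v e))"
    and s: "s \<in> {0..1}"
  shows "\<gamma> s \<in> chart_dom c" "coord c (\<gamma> s) \<in> ball (coord c (\<gamma> 0)) r"
proof -
  obtain S where S: "continuous_on {0..1} \<gamma>"
    using piecewise_C1_curve_regularity[OF curve] by blast
  let ?u = "coord c (\<gamma> 0)"
  define W where "W = coord_inv c ` ball ?u r"
  have sub: "ball ?u r \<subseteq> coord c ` chart_dom c" using ball ball_subset_cball by blast
  have W: "open W" unfolding W_def by (rule open_coord_inv_image) (use c sub in auto)
  have W_iff: "x \<in> W \<longleftrightarrow> x \<in> chart_dom c \<and> coord c x \<in> ball ?u r" for x
    unfolding W_def by (rule in_coord_inv_image_iff[OF c(1) sub])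
  have "{0..1} \<inter> \<gamma> -` (- W) = {}"
  proof (rule ccontr)
    assume ne: "{0..1} \<inter> \<gamma> -` (- W) \<noteq> {}"
    have "closed ({0..1} \<inter> \<gamma> -` (- W))"
      by (intro continuous_closed_preimage S closed_Compl W) auto
    then have "compact ({0..1} \<inter> \<gamma> -` (- W))"
      by (simp add: compact_eq_bounded_closed bounded_Int)
    from compact_attains_inf[OF this ne] obtain T where T: "T \<in> {0..1}" "\<gamma> T \<notin> W"
      "\<And>s. s \<in> {0..1} \<Longrightarrow> \<gamma> s \<notin> W \<Longrightarrow> T \<le> s" by auto
    have "\<gamma> 0 \<in> W" using c r by (simp add: W_iff)
    then have T0: "T > 0" using T by (cases "T = 0") auto
    have inW: "\<gamma> s \<in> W" if "s \<in> {0..<T}" for s using T(3)[of s] T(1) that by auto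
    define K where "K = coord_inv c ` cball ?u r"
    have K: "closed K" unfolding K_def by (rule closed_coord_inv_image) (use c ball in auto)
    have "\<gamma> T \<in> K"
    proof (rule Lim_in_closed_set[OF K])
      have "(\<gamma> \<longlongrightarrow> \<gamma> T) (at T within {0..1})"
        using S T(1) by (auto simp: continuous_on_def)
      then show "(\<gamma> \<longlongrightarrow> \<gamma> T) (at T within {0..<T})"
        by (rule tendsto_within_subset) (use T in auto)
      show "at T within {0..<T} \<noteq> bot"
        using T0 by (simp add: at_within_eq_bot_iff)
      show "eventually (\<lambda>s. \<gamma> s \<in> K) (at T within {0..<T})"
        unfolding eventually_at_filter
        by (intro always_eventually) (use inW in \<open>force simp: W_def K_def\<close>)
    qed
    then have KT: "\<gamma> T \<in> chart_dom c" "coord c (\<gamma> T) \<in> cball ?u r"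
      using in_coord_inv_image_iff[OF c(1) ball] by (simp_all add: K_def)
    then have n: "norm (coord c (\<gamma> T) - ?u) = r"
      using T(2) by (auto simp: W_iff dist_norm norm_minus_commute)
    have dom: "\<gamma> s \<in> chart_dom c \<and> coord c (\<gamma> s) \<in> cball ?u r" if "s \<in> {0..T}" for s
      using that inW[of s] KT by (cases "s = T") (auto simp: W_iff)
    have "sqrt ((coord c (\<gamma> T) - ?u) \<bullet> (G *v (coord c (\<gamma> T) - ?u))) \<le> curve_length A g \<gamma>"
      by (rule displacement_le_curve_length[OF curve c(1), of T G]) (use T dom G le in auto)
    then show False using short[OF n] by simp
  qed
  then show "\<gamma> s \<in> chart_dom c" "coord c (\<gamma> s) \<in> ball ?u r"
    using s W_iff by auto
qed

end

section \<open>The squared distance to second order\<close>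

context riemannian_atlas
begin

lemma riem_dist_le_curve_length:
  "piecewise_C1_curve A \<gamma> \<Longrightarrow> riem_dist A g (\<gamma> 0) (\<gamma> 1) \<le> curve_length A g \<gamma>"
  unfolding riem_dist_def
  by (rule cINF_lower) (auto intro!: bdd_belowI[of _ 0] simp: curve_length_nonneg)

lemma coordinate_line:
  assumes c: "c \<in> A" and seg: "\<And>s. s \<in> {0..1} \<Longrightarrow> u + s *\<^sub>R w \<in> coord c ` chart_dom c"
  defines "\<sigma> \<equiv> \<lambda>s. coord_inv c (u + s *\<^sub>R w)"
  shows "piecewise_C1_curve A \<sigma>"
    and "s \<in> {0..1} \<Longrightarrow> speed A g \<sigma> s = sqrt (w \<bullet> (g c (u + s *\<^sub>R w) *v w))"
proof -
  have \<sigma>: "\<sigma> s \<in> chart_dom c" "coord c (\<sigma> s) = u + s *\<^sub>R w" if "s \<in> {0..1}" for s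
    using seg[OF that] coord_coord_inv[OF c] coord_inv_in_dom[OF c] by (auto simp: \<sigma>_def)
  have cont: "continuous_on {0..1} \<sigma>"
    unfolding \<sigma>_def
    by (rule continuous_on_compose2[OF continuous_on_coord_inv[OF c]])
      (auto intro!: continuous_intros simp: seg)
  have contw: "continuous (at s within {0..1}) \<sigma>" if "s \<in> {0..1}" for s
    using cont that by (auto simp: continuous_on_eq_continuous_within)
  have der: "((\<lambda>r. coord c (\<sigma> r)) has_vector_derivative w) (at s within {0..1})" if s: "s \<in> {0..1}" for s
  proof -
    have "((\<lambda>r. u + r *\<^sub>R w) has_vector_derivative w) (at s within {0..1})"
      by (auto intro!: derivative_eq_intros)
    then show ?thesis
      by (rule has_vector_derivative_transform[OF s, rotated]) (simp add: \<sigma>)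
  qed
  have der': "((\<lambda>r. coord d (\<sigma> r)) has_vector_derivative transition_jacobian c d (\<sigma> s) *v w) (at s within {0..1})"
    if "s \<in> {0..1}" "d \<in> A" "\<sigma> s \<in> chart_dom d" for s d
    using has_vector_derivative_change_chart[OF c that(2) \<sigma>(1)[OF that(1)] that(3) contw that(1) der] that
    by simp
  have vel: "velocity {0..1} d \<sigma> s = frechet_derivative (coord d \<circ> coord_inv c) (at (u + s *\<^sub>R w)) w"
    if "s \<in> {0..1}" "d \<in> A" "\<sigma> s \<in> chart_dom d" for s d
  proof -
    have "velocity {0..1} d \<sigma> s = transition_jacobian c d (\<sigma> s) *v w"
      by (rule velocity_eqI[OF der'[OF that]]) (use that in auto)
    also have "\<dots> = frechet_derivative (coord d \<circ> coord_inv c) (at (u + s *\<^sub>R w)) w"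
      using frechet_derivative_at[OF transition_has_derivative[OF c that(2) \<sigma>(1)[OF that(1)] that(3)]]
      by (simp add: \<sigma>(2)[OF that(1)])
    finally show ?thesis .
  qed
  have "C1_curve_on A {0..1} \<sigma>"
    unfolding C1_curve_on_def
  proof (intro conjI ballI impI cont)
    fix d s assume d: "d \<in> A" and s: "s \<in> {0..1::real}" and sd: "\<sigma> s \<in> chart_dom d"
    show "(\<lambda>r. coord d (\<sigma> r)) differentiable (at s within {0..1})"
      using der'[OF s d sd] by (rule differentiableI_vector)
    let ?W = "coord c ` (chart_dom c \<inter> chart_dom d)"
    let ?F = "\<lambda>x. frechet_derivative (coord d \<circ> coord_inv c) (at x) w"
    have W: "open ?W" by (intro open_coord_image open_Int open_chart_dom c d) auto
    have inW: "u + s *\<^sub>R w \<in> ?W" using \<sigma>[OF s] sd by (metis IntI imageI)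
    have "continuous_on ?W ?F"
      by (intro smooth_on_imp_continuous_on smooth_on_frechet_derivative transition_smooth c d)
    then have F: "isCont ?F (u + s *\<^sub>R w)"
      using W inW continuous_on_eq_continuous_at by blast
    have "((\<lambda>r. ?F (u + r *\<^sub>R w)) \<longlongrightarrow> ?F (u + s *\<^sub>R w)) (at s within {0..1})"
      by (rule isCont_tendsto_compose[OF F]) (auto intro!: tendsto_eq_intros)
    moreover have "eventually (\<lambda>r. \<sigma> r \<in> chart_dom d) (at s within {0..1})"
      using contw[OF s] open_chart_dom[OF d] sd unfolding continuous_within
      by (auto dest: topological_tendstoD)
    then have "eventually (\<lambda>r. ?F (u + r *\<^sub>R w) = velocity {0..1} d \<sigma> r) (at s within {0..1})"
      unfolding eventually_at_filter by eventually_elim (simp add: vel[OF _ d])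
    ultimately have "(velocity {0..1} d \<sigma> \<longlongrightarrow> ?F (u + s *\<^sub>R w)) (at s within {0..1})"
      by (rule Lim_transform_eventually)
    then show "continuous (at s within {0..1}) (velocity {0..1} d \<sigma>)"
      unfolding continuous_within vel[OF s d sd] .
  qed
  then show "piecewise_C1_curve A \<sigma>"
    unfolding piecewise_C1_curve_def by (intro exI[of _ 1] exI[of _ real]) simp
  show "speed A g \<sigma> s = sqrt (w \<bullet> (g c (u + s *\<^sub>R w) *v w))" if "s \<in> {0..1}"
    using speed_within_in_chart[of c \<sigma> s 0 1 w] \<sigma>[OF that] contw[OF that] der[OF that] that c
    by (simp add: speed_eq_speed_within)
qed

lemma riem_dist_le_coordinate_line:
  assumes c: "c \<in> A" and seg: "\<And>s. s \<in> {0..1} \<Longrightarrow> u + s *\<^sub>R w \<in> coord c ` chart_dom c"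
    and le: "\<And>s. s \<in> {0..1} \<Longrightarrow> w \<bullet> (g c (u + s *\<^sub>R w) *v w) \<le> k"
  shows "riem_dist A g (coord_inv c u) (coord_inv c (u + w)) \<le> sqrt k"
proof -
  let ?\<sigma> = "\<lambda>s. coord_inv c (u + s *\<^sub>R w)"
  note line = coordinate_line[OF c seg]
  have "(speed A g ?\<sigma> has_integral curve_length A g ?\<sigma>) {0..1}"
    using piecewise_C1_curve_regularity[OF line(1)] unfolding curve_length_def
    by (meson integrable_integral)
  moreover have "((\<lambda>_::real. sqrt k) has_integral sqrt k) {0..1}"
    using has_integral_const_real[of "sqrt k" 0 1] by simp
  ultimately have "curve_length A g ?\<sigma> \<le> sqrt k"
    by (rule has_integral_le) (use line(2) le in auto)
  then show ?thesis
    using riem_dist_le_curve_length[OF line(1)] by simp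
qed

lemma metric_nearly_constant:
  assumes c: "c \<in> A" "u0 \<in> coord c ` chart_dom c" and \<kappa>: "\<kappa> > 0"
  obtains r where "r > 0" "cball u0 r \<subseteq> coord c ` chart_dom c"
    "\<And>u v. u \<in> cball u0 r \<Longrightarrow> (1 - \<kappa>) * (v \<bullet> (g c u0 *v v)) \<le> v \<bullet> (g c u *v v)"
    "\<And>u v. u \<in> cball u0 r \<Longrightarrow> v \<bullet> (g c u *v v) \<le> (1 + \<kappa>) * (v \<bullet> (g c u0 *v v))"
proof -
  obtain m where m: "m > 0" "\<And>v. m * (norm v)\<^sup>2 \<le> v \<bullet> (g c u0 *v v)"
    using positive_definite_bounded_below[OF metric_positive[OF c]] by blast
  let ?n = "real CARD('n)"
  obtain r1 where r1: "r1 > 0" "cball u0 r1 \<subseteq> coord c ` chart_dom c"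
    using open_chart_image[OF c(1)] c(2) open_contains_cball by blast
  have "\<kappa> * m / ?n > 0" using m \<kappa> by simp
  then obtain r2 where r2: "r2 > 0" "\<And>u. dist u u0 < r2 \<Longrightarrow> norm (g c u - g c u0) < \<kappa> * m / ?n"
    using metric_isCont[OF c] unfolding continuous_at_eps_delta dist_norm by blast
  have close: "\<bar>v \<bullet> (g c u *v v) - v \<bullet> (g c u0 *v v)\<bar> \<le> \<kappa> * (v \<bullet> (g c u0 *v v))"
    if "u \<in> cball u0 (min r1 (r2 / 2))" for u v
  proof -
    have "norm (g c u - g c u0) < \<kappa> * m / ?n"
      using that r2(1) by (intro r2(2)) (auto simp: dist_commute)
    then have "?n * norm (g c u - g c u0) * (norm v)\<^sup>2 \<le> ?n * (\<kappa> * m / ?n) * (norm v)\<^sup>2"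
      by (intro mult_right_mono mult_left_mono) auto
    also have "\<dots> = \<kappa> * (m * (norm v)\<^sup>2)" by simp
    also have "\<dots> \<le> \<kappa> * (v \<bullet> (g c u0 *v v))" using m(2) \<kappa> by (intro mult_left_mono) auto
    finally show ?thesis using quadratic_form_perturbation[of v "g c u" "g c u0"] by linarith
  qed
  show thesis
  proof (rule that[of "min r1 (r2 / 2)"])
    show "min r1 (r2 / 2) > 0" "cball u0 (min r1 (r2 / 2)) \<subseteq> coord c ` chart_dom c"
      using r1 r2 by auto
    show "(1 - \<kappa>) * (v \<bullet> (g c u0 *v v)) \<le> v \<bullet> (g c u *v v)"
      "v \<bullet> (g c u *v v) \<le> (1 + \<kappa>) * (v \<bullet> (g c u0 *v v))" if "u \<in> cball u0 (min r1 (r2 / 2))" for u v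
      using close[OF that, of v] by (auto simp: algebra_simps abs_le_iff)
  qed
qed

text \<open>
  A short curve cannot leave a ball in which the metric is nearly constant, so on it the length
  is bounded below by that of the displacement, and the coordinate line gives the matching
  upper bound.
\<close>

lemma riem_dist_squared_expansion:
  assumes c: "c \<in> A" "p \<in> chart_dom c" and e: "e > 0"
  shows "\<exists>\<delta>>0. \<forall>w. norm w < \<delta> \<longrightarrow>
    \<bar>(riem_dist A g (coord_inv c (coord c p + w)) p)\<^sup>2 - w \<bullet> (g c (coord c p) *v w)\<bar> \<le> e * (norm w)\<^sup>2"
proof -
  define u0 where "u0 = coord c p"
  have u0: "u0 \<in> coord c ` chart_dom c" using c by (simp add: u0_def)
  let ?N = "\<lambda>v. v \<bullet> (g c u0 *v v)"
  obtain m where m: "m > 0" "\<And>v. m * (norm v)\<^sup>2 \<le> ?N v"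
    using positive_definite_bounded_below[OF metric_positive[OF c(1) u0]] by blast
  define M where "M = CARD('n) * norm (g c u0) + 1"
  have M: "M > 0" by (auto simp: M_def add_nonneg_pos)
  have NM: "?N v \<le> M * (norm v)\<^sup>2" for v
  proof -
    have "?N v \<le> CARD('n) * norm (g c u0) * (norm v)\<^sup>2" by (rule quadratic_form_le)
    also have "\<dots> \<le> M * (norm v)\<^sup>2" by (intro mult_right_mono) (auto simp: M_def)
    finally show ?thesis .
  qed
  have N0: "?N v \<ge> 0" for v by (rule metric_nonneg[OF c(1) u0])
  define \<kappa> where "\<kappa> = min (1/2) (e / M)"
  have \<kappa>: "\<kappa> > 0" "\<kappa> \<le> 1/2" "\<kappa> * M \<le> e" using e M by (auto simp: \<kappa>_def min_def field_simps)
  obtain r where r: "r > 0" "cball u0 r \<subseteq> coord c ` chart_dom c"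
    and lower: "\<And>u v. u \<in> cball u0 r \<Longrightarrow> (1 - \<kappa>) * ?N v \<le> v \<bullet> (g c u *v v)"
    and upper: "\<And>u v. u \<in> cball u0 r \<Longrightarrow> v \<bullet> (g c u *v v) \<le> (1 + \<kappa>) * ?N v"
    using metric_nearly_constant[OF c(1) u0 \<kappa>(1)] by blast
  define G where "G = (1 - \<kappa>) *\<^sub>R g c u0"
  have G: "v \<bullet> (G *v v) = (1 - \<kappa>) * ?N v" for v
    by (simp add: G_def flip: scaleR_matrix_vector_assoc)
  have Gsym: "transpose G = G"
    using metric_symmetric[OF c(1) u0] by (simp add: G_def transpose_def vec_eq_iff)
  have Gpos: "v \<bullet> (G *v v) \<ge> 0" for v using N0 \<kappa> by (simp add: G)
  \<comment> \<open>The second bound makes the displacement \<open>w\<close> shorter than any displacement of norm \<open>r / 2\<close>.\<close>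
  define \<delta> where "\<delta> = min (r / 2) (r / 2 * sqrt (m / M))"
  have \<delta>: "\<delta> > 0" using r m M by (simp add: \<delta>_def)
  have "\<bar>(riem_dist A g (coord_inv c (u0 + w)) p)\<^sup>2 - ?N w\<bar> \<le> e * (norm w)\<^sup>2"
    if w: "norm w < \<delta>" for w
  proof -
    define x where "x = coord_inv c (u0 + w)"
    have wr: "norm w < r / 2" using w by (simp add: \<delta>_def)
    have "norm w < r / 2 * sqrt (m / M)" using w by (simp add: \<delta>_def)
    then have "(norm w)\<^sup>2 < (r / 2 * sqrt (m / M))\<^sup>2" by (intro power_strict_mono) auto
    also have "\<dots> = (r / 2)\<^sup>2 * (m / M)" by (subst power_mult_distrib) (use m M in simp)
    finally have wM: "M * (norm w)\<^sup>2 < m * (r / 2)\<^sup>2" using M by (simp add: field_simps)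
    have xin: "u0 + w \<in> coord c ` chart_dom c" using r wr by (auto simp: dist_norm)
    have x: "x \<in> chart_dom c" "coord c x = u0 + w"
      using coord_coord_inv[OF c(1) xin] coord_inv_in_dom[OF c(1) xin] by (auto simp: x_def)
    have segr: "(u0 + w) + s *\<^sub>R (- w) \<in> cball u0 r" if "s \<in> {0..1}" for s
    proof -
      have "(u0 + w) + s *\<^sub>R (- w) - u0 = (1 - s) *\<^sub>R w" by (simp add: algebra_simps)
      then have "norm ((u0 + w) + s *\<^sub>R (- w) - u0) \<le> 1 * norm w"
        using that by (simp add: mult_left_le_one_le)
      then show ?thesis using wr r by (simp add: dist_norm norm_minus_commute)
    qed
    have neg: "?N (- w) = ?N w"
      using linear_neg[OF matrix_vector_mul_linear, of "g c u0" w] by simp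
    have up: "riem_dist A g x p \<le> sqrt ((1 + \<kappa>) * ?N w)"
    proof -
      have "coord_inv c (u0 + w + - w) = p" using c by (simp add: u0_def)
      moreover have "riem_dist A g (coord_inv c (u0 + w)) (coord_inv c (u0 + w + - w)) \<le> sqrt ((1 + \<kappa>) * ?N w)"
      proof (rule riem_dist_le_coordinate_line[OF c(1)])
        fix s :: real assume s: "s \<in> {0..1}"
        show "u0 + w + s *\<^sub>R - w \<in> coord c ` chart_dom c" using segr[OF s] r(2) by blast
        show "- w \<bullet> (g c (u0 + w + s *\<^sub>R - w) *v - w) \<le> (1 + \<kappa>) * ?N w"
          using upper[OF segr[OF s], of "- w"] unfolding neg .
      qed
      ultimately show ?thesis by (simp add: x_def)
    qed
    have low: "sqrt ((1 - \<kappa>) * ?N w) \<le> riem_dist A g x p"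
      unfolding riem_dist_def
    proof (rule cINF_greatest)
      show "{\<gamma>. piecewise_C1_curve A \<gamma> \<and> \<gamma> 0 = x \<and> \<gamma> 1 = p} \<noteq> {}"
        using coordinate_line(1)[OF c(1), of "u0 + w" "- w", OF subsetD[OF r(2) segr]] c
        by (auto simp: x_def u0_def intro!: exI[of _ "\<lambda>s. coord_inv c ((u0 + w) + s *\<^sub>R (- w))"])
    next
      fix \<gamma> assume "\<gamma> \<in> {\<gamma>. piecewise_C1_curve A \<gamma> \<and> \<gamma> 0 = x \<and> \<gamma> 1 = p}"
      then have \<gamma>: "piecewise_C1_curve A \<gamma>" "\<gamma> 0 = x" "\<gamma> 1 = p" by auto
      show "sqrt ((1 - \<kappa>) * ?N w) \<le> curve_length A g \<gamma>"
      proof (rule ccontr)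
        assume "\<not> ?thesis"
        then have short: "curve_length A g \<gamma> < sqrt ((1 - \<kappa>) * ?N w)" by simp
        have ball: "cball (coord c (\<gamma> 0)) (r / 2) \<subseteq> cball u0 r"
        proof
          fix u assume "u \<in> cball (coord c (\<gamma> 0)) (r / 2)"
          then have "dist (u0 + w) u \<le> r / 2" by (simp add: \<gamma> x)
          moreover have "dist u0 (u0 + w) \<le> r / 2" using wr by (simp add: dist_norm)
          ultimately show "u \<in> cball u0 r" using dist_triangle[of u0 u "u0 + w"] by simp
        qed
        have stay: "\<gamma> s \<in> chart_dom c \<and> coord c (\<gamma> s) \<in> ball (coord c (\<gamma> 0)) (r / 2)" if "s \<in> {0..1}" for s
        proof -
          have short': "curve_length A g \<gamma> < sqrt (v \<bullet> (G *v v))" if "norm v = r / 2" for v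
          proof -
            have "?N w \<le> ?N v" using NM[of w] wM m(2)[of v] that by simp
            then have "sqrt ((1 - \<kappa>) * ?N w) \<le> sqrt ((1 - \<kappa>) * ?N v)"
              using \<kappa> by (intro real_sqrt_le_mono mult_left_mono) auto
            with short have "curve_length A g \<gamma> < sqrt ((1 - \<kappa>) * ?N v)" by (rule less_le_trans)
            then show ?thesis by (simp add: G)
          qed
          have "cball (coord c (\<gamma> 0)) (r / 2) \<subseteq> coord c ` chart_dom c" using ball r(2) by blast
          moreover have "v \<bullet> (G *v v) \<le> v \<bullet> (g c u *v v)" if "u \<in> cball (coord c (\<gamma> 0)) (r / 2)" for u v
            using lower[of u v] ball that by (auto simp: G)
          moreover have "\<gamma> 0 \<in> chart_dom c" "r / 2 > 0" using x r \<gamma> by auto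
          ultimately show ?thesis
            using curve_stays_in_ball[OF \<gamma>(1) c(1) _ _ _ Gsym Gpos _ short' that] by blast
        qed
        have "sqrt ((coord c (\<gamma> 1) - coord c (\<gamma> 0)) \<bullet> (G *v (coord c (\<gamma> 1) - coord c (\<gamma> 0)))) \<le> curve_length A g \<gamma>"
        proof (rule displacement_le_curve_length[OF \<gamma>(1) c(1) _ _ _ Gsym Gpos _ refl])
          fix s v assume "s \<in> {0..1::real}"
          then have "coord c (\<gamma> s) \<in> cball u0 r" using stay ball ball_subset_cball by blast
          then show "v \<bullet> (G *v v) \<le> v \<bullet> (g c (coord c (\<gamma> s)) *v v)" using lower by (simp add: G)
        qed (use stay in auto)
        moreover have "coord c (\<gamma> 1) - coord c (\<gamma> 0) = - w" using \<gamma> x by (simp add: u0_def)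
        ultimately have "sqrt ((1 - \<kappa>) * ?N (- w)) \<le> curve_length A g \<gamma>" by (simp only: G)
        then show False using short unfolding neg by simp
      qed
    qed
    have nn: "riem_dist A g x p \<ge> 0" by (rule order_trans[OF _ low]) (use N0[of w] \<kappa> in simp)
    have "(riem_dist A g x p)\<^sup>2 \<le> (1 + \<kappa>) * ?N w"
      using power_mono[OF up nn, of 2] N0[of w] \<kappa> by simp
    moreover have "(1 - \<kappa>) * ?N w \<le> (riem_dist A g x p)\<^sup>2"
      using power_mono[OF low, of 2] N0[of w] \<kappa> by simp
    ultimately have "\<bar>(riem_dist A g x p)\<^sup>2 - ?N w\<bar> \<le> \<kappa> * ?N w"
      by (auto simp: algebra_simps abs_le_iff)
    also have "\<dots> \<le> \<kappa> * (M * (norm w)\<^sup>2)" using NM \<kappa> by (intro mult_left_mono) auto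
    also have "\<dots> \<le> e * (norm w)\<^sup>2" using \<kappa>(3) by (simp add: mult_right_mono flip: mult.assoc)
    finally show ?thesis by (simp add: x_def)
  qed
  then show ?thesis using \<delta> by (auto simp: u0_def)
qed

end

section \<open>Parallel transport along short geodesics\<close>

lemma displacement_bound:
  fixes f :: "real \<Rightarrow> 'a::banach"
  assumes der: "\<And>s. s \<in> {0..1} \<Longrightarrow> (f has_vector_derivative f' s) (at s within {0..1})"
    and ab: "0 \<le> a" "a \<le> b" "b \<le> 1"
    and bound: "\<And>s. s \<in> {0..1} \<Longrightarrow> norm (f' s - k) \<le> B"
  shows "norm (f b - f a - (b - a) *\<^sub>R k) \<le> B"
proof -
  have B: "B \<ge> 0" by (rule order_trans[OF norm_ge_zero bound[of 0]]) simp
  have "((\<lambda>s. f s - s *\<^sub>R k) has_vector_derivative f' s - k) (at s within {a..b})" if "s \<in> {a..b}" for s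
    using has_vector_derivative_within_subset[OF der, of s "{a..b}"] that ab
    by (auto intro!: derivative_eq_intros)
  from fundamental_theorem_of_calculus[OF ab(2) this]
  have int: "((\<lambda>s. f' s - k) has_integral f b - b *\<^sub>R k - (f a - a *\<^sub>R k)) {a..b}" .
  have "norm (f b - b *\<^sub>R k - (f a - a *\<^sub>R k)) \<le> B * measure lborel {a..b}"
    by (rule has_integral_bound_real[OF B finite.emptyI int]) (use bound ab in auto)
  also have "\<dots> \<le> B * 1" using ab B by (intro mult_left_mono) auto
  finally show ?thesis by (simp add: algebra_simps)
qed

text \<open>
  If the acceleration is quadratic in the velocity then the velocity cannot vary much along a
  short curve: its variation is at most \<open>K\<close> times its maximum times the length, which is absorbed
  when the length is at most \<open>1/(2K)\<close>.
\<close>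

lemma velocity_bounded_by_length:
  fixes v a :: "real \<Rightarrow> 'a::banach"
  assumes der: "\<And>s. s \<in> {0..1} \<Longrightarrow> (v has_vector_derivative a s) (at s within {0..1})"
    and acc: "\<And>s. s \<in> {0..1} \<Longrightarrow> norm (a s) \<le> K * (norm (v s))\<^sup>2"
    and K: "K \<ge> 0" "2 * K * L \<le> 1"
    and len: "integral {0..1} (\<lambda>s. norm (v s)) \<le> L"
    and s: "s \<in> {0..1}"
  shows "norm (v s) \<le> 2 * L"
proof -
  have cont: "continuous_on {0..1} v"
    by (rule continuous_on_vector_derivative[OF der])
  then have contn: "continuous_on {0..1} (\<lambda>s. norm (v s))" by (intro continuous_intros)
  obtain s0 where s0: "s0 \<in> {0..1}" "\<And>r. r \<in> {0..1} \<Longrightarrow> norm (v s0) \<le> norm (v r)"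
    using continuous_attains_inf[OF compact_Icc _ contn] by auto
  obtain s1 where s1: "s1 \<in> {0..1}" "\<And>r. r \<in> {0..1} \<Longrightarrow> norm (v r) \<le> norm (v s1)"
    using continuous_attains_sup[OF compact_Icc _ contn] by auto
  define V where "V = norm (v s1)"
  have int: "(\<lambda>s. norm (v s)) integrable_on {0..1}"
    using contn integrable_continuous_real by blast
  have "((\<lambda>s. norm (v s0)) has_integral norm (v s0)) {0..1::real}"
    using has_integral_const_real[of "norm (v s0)" 0 1] by simp
  from has_integral_le[OF this integrable_integral[OF int]] s0(2)
  have low: "norm (v s0) \<le> L" using len by force
  have diff: "norm (v q - v p) \<le> K * V * L" if pq: "0 \<le> p" "p \<le> q" "q \<le> 1" for p q
  proof -
    have sub: "{p..q} \<subseteq> {0..1}" using pq by auto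
    have i: "(a has_integral v q - v p) {p..q}"
    proof (rule fundamental_theorem_of_calculus[OF pq(2)])
      fix r assume "r \<in> {p..q}"
      then show "(v has_vector_derivative a r) (at r within {p..q})"
        using has_vector_derivative_within_subset[OF der sub] sub by blast
    qed
    have n: "(\<lambda>s. norm (v s)) integrable_on {p..q}"
      using int sub integrable_on_subinterval by blast
    have "norm (v q - v p) = norm (integral {p..q} a)" using i by (simp add: integral_unique)
    also have "\<dots> \<le> integral {p..q} (\<lambda>s. K * V * norm (v s))"
    proof (rule integral_norm_bound_integral)
      show "a integrable_on {p..q}" using i by (rule has_integral_integrable)
      show "(\<lambda>s. K * V * norm (v s)) integrable_on {p..q}" using n by (rule integrable_on_mult_right)
      fix r assume "r \<in> {p..q}"
      then have r: "r \<in> {0..1}" using sub by auto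
      have "norm (a r) \<le> K * (norm (v r) * norm (v r))" using acc[OF r] by (simp add: power2_eq_square)
      also have "\<dots> \<le> K * (V * norm (v r))"
        using s1(2)[OF r] K by (intro mult_left_mono mult_right_mono) (auto simp: V_def)
      finally show "norm (a r) \<le> K * V * norm (v r)" by simp
    qed
    also have "\<dots> = K * V * integral {p..q} (\<lambda>s. norm (v s))" by simp
    also have "\<dots> \<le> K * V * integral {0..1} (\<lambda>s. norm (v s))"
      using K n int sub by (intro mult_left_mono integral_subset_le) (auto simp: V_def)
    also have "\<dots> \<le> K * V * L" using K len by (intro mult_left_mono) (auto simp: V_def)
    finally show ?thesis .
  qed
  have "norm (v s1 - v s0) \<le> K * V * L"
    using diff[of s0 s1] diff[of s1 s0] s0(1) s1(1) by (cases "s0 \<le> s1") (auto simp: norm_minus_commute)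
  then have "V \<le> norm (v s0) + K * V * L"
    unfolding V_def using norm_triangle_sub[of "v s1" "v s0"] by linarith
  also have "K * V * L \<le> V / 2"
    using mult_right_mono[OF K(2), of V] by (simp add: V_def mult_ac)
  finally have "V \<le> 2 * L" using low by simp
  then show ?thesis using s1(2)[OF s] by (simp add: V_def)
qed

text \<open>
  Both the geodesic equation and the equation of parallel transport have a right-hand side of this
  form; the first index is the free one.
\<close>

definition contract :: "('n \<Rightarrow> 'n \<Rightarrow> 'n \<Rightarrow> real) \<Rightarrow> real ^ 'n \<Rightarrow> real ^ 'n \<Rightarrow> real ^ 'n::finite" where
  "contract C a b = (\<chi> i. \<Sum>j\<in>UNIV. \<Sum>k\<in>UNIV. C i j k * a $ j * b $ k)"

definition coeff_norm :: "('n::finite \<Rightarrow> 'n \<Rightarrow> 'n \<Rightarrow> real) \<Rightarrow> real" where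
  "coeff_norm C = (\<Sum>i\<in>UNIV. \<Sum>j\<in>UNIV. \<Sum>k\<in>UNIV. \<bar>C i j k\<bar>)"

lemma norm_contract_le: "norm (contract C a b) \<le> coeff_norm C * norm a * norm b"
proof -
  have "norm (contract C a b) \<le> (\<Sum>i\<in>UNIV. \<bar>\<Sum>j\<in>UNIV. \<Sum>k\<in>UNIV. C i j k * a $ j * b $ k\<bar>)"
    using norm_le_l1_cart[of "contract C a b"] by (simp add: contract_def)
  also have "\<dots> \<le> (\<Sum>i\<in>UNIV. \<Sum>j\<in>UNIV. \<Sum>k\<in>UNIV. \<bar>C i j k\<bar> * norm a * norm b)"
    by (intro sum_mono order_trans[OF sum_abs] order_trans[OF sum_abs[THEN sum_mono]])
      (auto simp: abs_mult intro!: mult_mono component_le_norm_cart)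
  also have "\<dots> = coeff_norm C * norm a * norm b"
    by (simp add: coeff_norm_def sum_distrib_right)
  finally show ?thesis .
qed

lemma contract_diff_eq:
  "contract C a b - contract C' a' b' =
     contract (\<lambda>i j k. C i j k - C' i j k) a b + contract C' (a - a') b + contract C' a' (b - b')"
  by (simp add: contract_def vec_eq_iff algebra_simps sum.distrib sum_subtractf)

lemma coeff_norm_nonneg: "coeff_norm C \<ge> 0"
  by (simp add: coeff_norm_def sum_nonneg)

text \<open>
  To leading order the curve is the straight segment, and the transported covector is
  \<open>\<xi> + s \<Lambda>\<close> with \<open>\<Lambda>\<close> the transport coefficients at the starting point contracted with \<open>\<xi>\<close> and
  the displacement; hence the factor 1/2. The first-order term is exact since the integral of
  the velocity is the displacement. The hypothesis \<open>K\<^sup>2 * L \<le> \<kappa>\<close> makes the errors that come from the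
  variation of the velocity and of the covector comparable to the error \<open>\<kappa>\<close> of the coefficients.
\<close>

lemma transport_integral_expansion:
  fixes x v a \<zeta> :: "real \<Rightarrow> real ^ 'n" and C :: "real \<Rightarrow> 'n \<Rightarrow> 'n \<Rightarrow> 'n \<Rightarrow> real"
  assumes x: "\<And>s. s \<in> {0..1} \<Longrightarrow> (x has_vector_derivative v s) (at s within {0..1})"
    and v: "\<And>s. s \<in> {0..1} \<Longrightarrow> (v has_vector_derivative a s) (at s within {0..1})"
    and \<zeta>: "\<And>s. s \<in> {0..1} \<Longrightarrow> (\<zeta> has_vector_derivative contract (C s) (\<zeta> s) (v s)) (at s within {0..1})"
    and w: "x 1 - x 0 = w"
    and acc: "\<And>s. s \<in> {0..1} \<Longrightarrow> norm (a s) \<le> K * (norm (v s))\<^sup>2"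
    and speed: "\<And>s. s \<in> {0..1} \<Longrightarrow> norm (v s) \<le> 2 * L"
    and C: "\<And>s. s \<in> {0..1} \<Longrightarrow> coeff_norm (C s) \<le> K" "coeff_norm C0 \<le> K"
       "\<And>s. s \<in> {0..1} \<Longrightarrow> coeff_norm (\<lambda>i j k. C s i j k - C0 i j k) \<le> \<kappa>"
    and small: "4 * K * L \<le> 1" "K\<^sup>2 * L \<le> \<kappa>"
  shows "\<bar>integral {0..1} (\<lambda>s. \<zeta> s \<bullet> v s) - (\<zeta> 0 \<bullet> w + (contract C0 (\<zeta> 0) w \<bullet> w) / 2)\<bar>
           \<le> 40 * \<kappa> * norm (\<zeta> 0) * L\<^sup>2"
proof -
  define \<xi> where "\<xi> = \<zeta> 0"
  define \<Lambda> where "\<Lambda> = contract C0 \<xi> w"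
  have K: "K \<ge> 0" using C(2) coeff_norm_nonneg[of C0] by linarith
  have "0 \<le> 2 * L" by (rule order_trans[OF norm_ge_zero speed[of 0]]) simp
  then have L: "L \<ge> 0" by simp
  have \<kappa>: "\<kappa> \<ge> 0" by (rule order_trans[OF coeff_norm_nonneg C(3)[of 0]]) simp
  have a_le: "norm (a s - 0) \<le> 4 * K * L\<^sup>2" if "s \<in> {0..1}" for s
  proof -
    have "norm (a s) \<le> K * (2 * L)\<^sup>2"
      using acc[OF that] mult_left_mono[OF power_mono[OF speed[OF that] norm_ge_zero, of 2], of K] K by simp
    then show ?thesis by (simp add: power_mult_distrib)
  qed
  have vv: "norm (v q - v p) \<le> 4 * K * L\<^sup>2" if "p \<in> {0..1}" "q \<in> {0..1}" for p q
    using displacement_bound[OF v, of p q 0] displacement_bound[OF v, of q p 0] a_le that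
    by (cases "p \<le> q") (auto simp: norm_minus_commute)
  have wv: "norm (v s - w) \<le> 4 * K * L\<^sup>2" if "s \<in> {0..1}" for s
    using displacement_bound[OF x, of 0 1 "v s" "4 * K * L\<^sup>2"] vv that w
    by (simp add: norm_minus_commute)
  have wl: "norm w \<le> 2 * L"
    using displacement_bound[OF x, of 0 1 0 "2 * L"] speed w by simp
  have cont\<zeta>: "continuous_on {0..1} \<zeta>"
    by (rule continuous_on_vector_derivative[OF \<zeta>])
  have contv: "continuous_on {0..1} v"
    by (rule continuous_on_vector_derivative[OF v])
  obtain s1 where s1: "s1 \<in> {0..1}" "\<And>r. r \<in> {0..1} \<Longrightarrow> norm (\<zeta> r) \<le> norm (\<zeta> s1)"
    using continuous_attains_sup[OF compact_Icc _ continuous_on_norm[OF cont\<zeta>]] by auto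
  define Z where "Z = norm (\<zeta> s1)"
  have d\<zeta>: "norm (contract (C s) (\<zeta> s) (v s) - 0) \<le> 2 * K * L * Z" if s: "s \<in> {0..1}" for s
  proof -
    have "norm (contract (C s) (\<zeta> s) (v s)) \<le> coeff_norm (C s) * norm (\<zeta> s) * norm (v s)"
      by (rule norm_contract_le)
    also have "\<dots> \<le> K * Z * (2 * L)"
      using C(1)[OF s] s1(2)[OF s] speed[OF s] K
      by (intro mult_mono mult_nonneg_nonneg) (auto simp: Z_def coeff_norm_nonneg)
    finally show ?thesis by (simp add: mult_ac)
  qed
  have \<zeta>0: "norm (\<zeta> s - \<xi>) \<le> 2 * K * L * Z" if "s \<in> {0..1}" for s
    using displacement_bound[OF \<zeta>, of 0 s 0] d\<zeta> that by (simp add: \<xi>_def)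
  have Z: "Z \<le> 2 * norm \<xi>"
  proof -
    have "Z \<le> norm \<xi> + 2 * K * L * Z"
      using \<zeta>0[OF s1(1)] norm_triangle_sub[of "\<zeta> s1" \<xi>] unfolding Z_def by linarith
    moreover have "2 * K * L * Z \<le> Z / 2"
      using mult_right_mono[OF small(1), of Z] by (simp add: Z_def)
    ultimately show ?thesis by linarith
  qed
  have \<zeta>1: "norm (\<zeta> s - \<xi>) \<le> 4 * K * L * norm \<xi>" if "s \<in> {0..1}" for s
    using \<zeta>0[OF that] mult_left_mono[OF Z, of "2 * K * L"] K L by (simp add: mult_ac)
  have \<zeta>_le: "norm (\<zeta> s) \<le> 2 * norm \<xi>" if "s \<in> {0..1}" for s
    using s1(2)[OF that] Z by (simp add: Z_def)
  have d\<Lambda>: "norm (contract (C s) (\<zeta> s) (v s) - \<Lambda>) \<le> 16 * \<kappa> * norm \<xi> * L" if s: "s \<in> {0..1}" for s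
  proof -
    have "norm (contract (\<lambda>i j k. C s i j k - C0 i j k) (\<zeta> s) (v s)) \<le> \<kappa> * (2 * norm \<xi>) * (2 * L)"
      using C(3)[OF s] \<zeta>_le[OF s] speed[OF s] \<kappa>
      by (intro order_trans[OF norm_contract_le] mult_mono mult_nonneg_nonneg) (auto simp: coeff_norm_nonneg)
    moreover have "norm (contract C0 (\<zeta> s - \<xi>) (v s)) \<le> K * (4 * K * L * norm \<xi>) * (2 * L)"
      using C(2) \<zeta>1[OF s] speed[OF s] K L
      by (intro order_trans[OF norm_contract_le] mult_mono mult_nonneg_nonneg) (auto simp: coeff_norm_nonneg)
    moreover have "norm (contract C0 \<xi> (v s - w)) \<le> K * norm \<xi> * (4 * K * L\<^sup>2)"
      using C(2) wv[OF s] K L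
      by (intro order_trans[OF norm_contract_le] mult_mono mult_nonneg_nonneg) (auto simp: coeff_norm_nonneg)
    ultimately have "norm (contract (C s) (\<zeta> s) (v s) - \<Lambda>)
      \<le> \<kappa> * (2 * norm \<xi>) * (2 * L) + K * (4 * K * L * norm \<xi>) * (2 * L) + K * norm \<xi> * (4 * K * L\<^sup>2)"
      unfolding \<Lambda>_def contract_diff_eq[of "C s" "\<zeta> s"] by (intro norm_triangle_le add_mono)
    also have "\<dots> = 4 * \<kappa> * norm \<xi> * L + 12 * (K\<^sup>2 * L) * (norm \<xi> * L)"
      by (simp add: power2_eq_square)
    also have "\<dots> \<le> 4 * \<kappa> * norm \<xi> * L + 12 * \<kappa> * (norm \<xi> * L)"
      using small(2) L by (intro add_left_mono mult_right_mono mult_left_mono) auto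
    finally show ?thesis by (simp add: mult_ac)
  qed
  have lin: "norm (\<zeta> s - \<xi> - s *\<^sub>R \<Lambda>) \<le> 16 * \<kappa> * norm \<xi> * L" if "s \<in> {0..1}" for s
    using displacement_bound[OF \<zeta>, of 0 s \<Lambda>] d\<Lambda> that by (simp add: \<xi>_def)
  have main: "((\<lambda>s. \<xi> \<bullet> v s + s * (\<Lambda> \<bullet> w)) has_integral \<xi> \<bullet> w + (\<Lambda> \<bullet> w) / 2) {0..1}"
  proof -
    have "((\<lambda>s. \<xi> \<bullet> x s + s\<^sup>2 * ((\<Lambda> \<bullet> w) / 2)) has_vector_derivative \<xi> \<bullet> v s + s * (\<Lambda> \<bullet> w)) (at s within {0..1})"
      if "s \<in> {0..1}" for s
    proof -
      have "((\<lambda>s. \<xi> \<bullet> x s) has_vector_derivative \<xi> \<bullet> v s) (at s within {0..1})"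
        using has_derivative_inner_right[OF x[OF that, unfolded has_vector_derivative_def], of \<xi>]
        by (simp add: has_vector_derivative_def)
      moreover have "((\<lambda>s. s\<^sup>2 * ((\<Lambda> \<bullet> w) / 2)) has_vector_derivative s * (\<Lambda> \<bullet> w)) (at s within {0..1})"
        by (auto simp flip: has_real_derivative_iff_has_vector_derivative intro!: derivative_eq_intros)
      ultimately show ?thesis by (rule has_vector_derivative_add)
    qed
    from fundamental_theorem_of_calculus[OF _ this]
    show ?thesis using w by (simp add: algebra_simps flip: inner_diff_right)
  qed
  have "((\<lambda>s. \<zeta> s \<bullet> v s) has_integral integral {0..1} (\<lambda>s. \<zeta> s \<bullet> v s)) {0..1}"
    by (intro integrable_integral integrable_continuous_real continuous_on_inner cont\<zeta> contv)
  from has_integral_diff[OF this main]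
  have int: "((\<lambda>s. \<zeta> s \<bullet> v s - (\<xi> \<bullet> v s + s * (\<Lambda> \<bullet> w))) has_integral
     integral {0..1} (\<lambda>s. \<zeta> s \<bullet> v s) - (\<xi> \<bullet> w + (\<Lambda> \<bullet> w) / 2)) {0..1}" .
  have pointwise: "norm (\<zeta> s \<bullet> v s - (\<xi> \<bullet> v s + s * (\<Lambda> \<bullet> w))) \<le> 40 * \<kappa> * norm \<xi> * L\<^sup>2" if s: "s \<in> {0..1}" for s
  proof -
    have "\<zeta> s \<bullet> v s - (\<xi> \<bullet> v s + s * (\<Lambda> \<bullet> w)) = (\<zeta> s - \<xi> - s *\<^sub>R \<Lambda>) \<bullet> v s + s * (\<Lambda> \<bullet> (v s - w))"
      by (simp add: inner_diff_left inner_diff_right algebra_simps)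
    moreover have "\<bar>(\<zeta> s - \<xi> - s *\<^sub>R \<Lambda>) \<bullet> v s\<bar> \<le> (16 * \<kappa> * norm \<xi> * L) * (2 * L)"
      using lin[OF s] speed[OF s] \<kappa> L
      by (intro order_trans[OF Cauchy_Schwarz_ineq2] mult_mono) auto
    moreover have "\<bar>s * (\<Lambda> \<bullet> (v s - w))\<bar> \<le> 1 * ((K * norm \<xi> * (2 * L)) * (4 * K * L\<^sup>2))"
    proof -
      have "norm \<Lambda> \<le> K * norm \<xi> * (2 * L)"
        unfolding \<Lambda>_def using C(2) wl K
        by (intro order_trans[OF norm_contract_le] mult_mono mult_nonneg_nonneg) (auto simp: coeff_norm_nonneg)
      then have "\<bar>\<Lambda> \<bullet> (v s - w)\<bar> \<le> (K * norm \<xi> * (2 * L)) * (4 * K * L\<^sup>2)"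
        using wv[OF s] K L by (intro order_trans[OF Cauchy_Schwarz_ineq2] mult_mono) auto
      then show ?thesis using s unfolding abs_mult by (intro mult_mono) auto
    qed
    moreover have "(K * norm \<xi> * (2 * L)) * (4 * K * L\<^sup>2) = 8 * (K\<^sup>2 * L) * (norm \<xi> * L\<^sup>2)"
      by (simp add: power2_eq_square)
    moreover have "8 * (K\<^sup>2 * L) * (norm \<xi> * L\<^sup>2) \<le> 8 * \<kappa> * (norm \<xi> * L\<^sup>2)"
      using small(2) by (intro mult_right_mono mult_left_mono) auto
    moreover have "(16 * \<kappa> * norm \<xi> * L) * (2 * L) = 32 * \<kappa> * (norm \<xi> * L\<^sup>2)"
      by (simp add: power2_eq_square)
    ultimately show ?thesis by simp
  qed
  have "norm (integral {0..1} (\<lambda>s. \<zeta> s \<bullet> v s) - (\<xi> \<bullet> w + (\<Lambda> \<bullet> w) / 2)) \<le> 40 * \<kappa> * norm \<xi> * L\<^sup>2 * measure lborel {0..1::real}"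
    by (rule has_integral_bound_real[OF _ finite.emptyI int]) (use pointwise \<kappa> in auto)
  then show ?thesis by (simp add: \<xi>_def \<Lambda>_def)
qed

section \<open>The phase to second order\<close>

context riemannian_atlas
begin

lemma christoffel_symmetric:
  assumes "c \<in> A" "u \<in> coord c ` chart_dom c"
  shows "christoffel g c u \<alpha> \<beta> \<gamma> = christoffel g c u \<alpha> \<gamma> \<beta>"
proof -
  have "pdiff \<delta> (\<lambda>w. g c w $ \<beta> $ \<gamma>) u = pdiff \<delta> (\<lambda>w. g c w $ \<gamma> $ \<beta>) u" for \<delta>
  proof (rule pdiff_cong)
    have "g c w $ \<beta> $ \<gamma> = g c w $ \<gamma> $ \<beta>" if "w \<in> coord c ` chart_dom c" for w
      using arg_cong[OF metric_symmetric[OF assms(1) that], of "\<lambda>M. M $ \<gamma> $ \<beta>"]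
      by (simp add: transpose_def)
    then show "eventually (\<lambda>w. g c w $ \<beta> $ \<gamma> = g c w $ \<gamma> $ \<beta>) (nhds u)"
      using open_chart_image[OF assms(1)] assms(2) eventually_nhds by blast
  qed
  then show ?thesis by (simp add: christoffel_def add.commute)
qed

text \<open>
  By Cramer's rule the entries of the inverse are rational functions of the entries of the metric.
\<close>

lemma isCont_inv_metric:
  assumes c: "c \<in> A" "u0 \<in> coord c ` chart_dom c"
  shows "isCont (\<lambda>u. inv_metric g c u $ i $ j) u0"
proof -
  define f where "f u = det (\<chi> a b. if b = i then axis j 1 $ a else g c u $ a $ b) / det (g c u)" for u
  have eq: "inv_metric g c u $ i $ j = f u" if u: "u \<in> coord c ` chart_dom c" for u
  proof -
    have "det (g c u) \<noteq> 0" using metric_invertible[OF c(1) u] invertible_det_nz by blast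
    moreover have "g c u *v (inv_metric g c u *v axis j 1) = axis j 1"
      by (simp add: matrix_vector_mul_assoc metric_inverse[OF c(1) u])
    ultimately have "inv_metric g c u *v axis j 1 =
        (\<chi> k. det (\<chi> a b. if b = k then axis j 1 $ a else g c u $ a $ b) / det (g c u))"
      using cramer by blast
    then have "(inv_metric g c u *v axis j 1) $ i = f u" by (simp add: f_def)
    then show ?thesis by (simp add: matrix_vector_mult_basis column_def)
  qed
  have comp: "isCont (\<lambda>u. g c u $ a $ b) u0" for a b
    by (intro continuous_intros metric_isCont c)
  have "isCont f u0"
    unfolding f_def
  proof (rule isCont_divide)
    show "det (g c u0) \<noteq> 0" using metric_invertible[OF c] invertible_det_nz by blast
    show "isCont (\<lambda>u. det (g c u)) u0"
      unfolding det_def by (intro continuous_intros comp)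
    have "isCont (\<lambda>u. (if b = i then axis j 1 $ a else g c u $ a $ b)) u0" for a b
      using comp by (cases "b = i") auto
    then show "isCont (\<lambda>u. det (\<chi> a b. if b = i then axis j 1 $ a else g c u $ a $ b)) u0"
      unfolding det_def by (simp only: vec_lambda_beta) (intro continuous_intros)
  qed
  moreover have "eventually (\<lambda>u. inv_metric g c u $ i $ j = f u) (nhds u0)"
    using open_chart_image[OF c(1)] c(2) eq eventually_nhds by blast
  ultimately show ?thesis by (simp add: isCont_cong)
qed

lemma isCont_christoffel:
  assumes c: "c \<in> A" "u0 \<in> coord c ` chart_dom c"
  shows "isCont (\<lambda>u. christoffel g c u \<alpha> \<beta> \<gamma>) u0"
proof -
  have "isCont (\<lambda>u. pdiff k (\<lambda>w. g c w $ i $ j) u) u0" for i j k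
  proof -
    let ?D = "\<lambda>u. frechet_derivative (g c) (at u) (axis k 1)"
    have "continuous_on (coord c ` chart_dom c) ?D"
      by (intro smooth_on_imp_continuous_on smooth_on_frechet_derivative metric_smooth c)
    then have "isCont ?D u0" using c open_chart_image continuous_on_eq_continuous_at by blast
    then have "isCont (\<lambda>u. ?D u $ i $ j) u0" by (intro continuous_intros)
    moreover have "pdiff k (\<lambda>w. g c w $ i $ j) u = ?D u $ i $ j" if "u \<in> coord c ` chart_dom c" for u
    proof -
      have "(g c has_derivative frechet_derivative (g c) (at u)) (at u)"
        by (rule smooth_on_has_derivative[OF metric_smooth[OF c(1)] that])
      then have "((\<lambda>w. g c w $ i $ j) has_derivative (\<lambda>h. frechet_derivative (g c) (at u) h $ i $ j)) (at u)"
        by (intro bounded_linear.has_derivative[OF bounded_linear_vec_nth])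
      then show ?thesis by (rule pdiff_eq_frechet_derivative)
    qed
    then have "eventually (\<lambda>u. pdiff k (\<lambda>w. g c w $ i $ j) u = ?D u $ i $ j) (nhds u0)"
      using open_chart_image[OF c(1)] c(2) eventually_nhds by blast
    ultimately show ?thesis by (simp add: isCont_cong)
  qed
  then show ?thesis
    unfolding christoffel_def by (intro continuous_intros isCont_inv_metric c)
qed

lemma geodesic_imp_piecewise_C1_curve:
  assumes "geodesic A g \<gamma>"
  shows "piecewise_C1_curve A \<gamma>"
proof -
  have "C1_curve_on A {0..1} \<gamma>"
    using assms unfolding C1_curve_on_def geodesic_def
    by (blast intro: has_vector_derivative_continuous)
  then show ?thesis
    unfolding piecewise_C1_curve_def by (intro exI[of _ 1] exI[of _ real]) simp
qed

text \<open>The matrix \<open>\<Gamma>\<^sup>\<rho>\<^sub>\<alpha>\<^sub>\<beta> \<xi>\<^sub>\<rho>\<close>, which is the real part of the Hessian of the phase.\<close>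

definition christoffel_form :: "('m, 'n) chart \<Rightarrow> real ^ 'n \<Rightarrow> real ^ 'n \<Rightarrow> real ^ 'n ^ 'n" where
  "christoffel_form c u \<xi> = (\<chi> \<alpha> \<beta>. \<Sum>\<rho>\<in>UNIV. christoffel g c u \<rho> \<alpha> \<beta> * \<xi> $ \<rho>)"

text \<open>
  The shortest geodesic to a nearby point has length \<open>O(|w|)\<close>, since the coordinate line already has;
  so it stays in a small ball where all coefficients are bounded and nearly constant, and the
  expansion in Euclidean space applies with \<open>L\<close> a multiple of \<open>|w|\<close>.
\<close>

lemma covector_integral_expansion:
  assumes c: "c \<in> A" "p \<in> chart_dom c" and e: "e > 0"
  shows "\<exists>\<delta>>0. \<forall>w. norm w < \<delta> \<longrightarrow> (\<forall>\<gamma> \<zeta>.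
    shortest_geodesic A g p (coord_inv c (coord c p + w)) \<gamma> \<longrightarrow> parallel_along A g \<gamma> \<zeta> \<longrightarrow> \<zeta> 0 c = \<xi> \<longrightarrow>
    \<bar>covector_integral A \<gamma> \<zeta> - (\<xi> \<bullet> w + (w \<bullet> (christoffel_form c (coord c p) \<xi> *v w)) / 2)\<bar>
      \<le> e * (norm w)\<^sup>2)"
proof -
  define u0 where "u0 = coord c p"
  have u0: "u0 \<in> coord c ` chart_dom c" using c by (simp add: u0_def)
  let ?N = "\<lambda>v. v \<bullet> (g c u0 *v v)"
  obtain m where m: "m > 0" "\<And>v. m * (norm v)\<^sup>2 \<le> ?N v"
    using positive_definite_bounded_below[OF metric_positive[OF c(1) u0]] by blast
  define M where "M = CARD('n) * norm (g c u0) + 1"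
  have M: "M > 0" by (auto simp: M_def add_nonneg_pos)
  have NM: "?N v \<le> M * (norm v)\<^sup>2" for v
  proof -
    have "?N v \<le> CARD('n) * norm (g c u0) * (norm v)\<^sup>2" by (rule quadratic_form_le)
    also have "\<dots> \<le> M * (norm v)\<^sup>2" by (intro mult_right_mono) (auto simp: M_def)
    finally show ?thesis .
  qed
  have N0: "?N v \<ge> 0" for v by (rule metric_nonneg[OF c(1) u0])
  obtain r where r: "r > 0" "cball u0 r \<subseteq> coord c ` chart_dom c"
    and lower: "\<And>u v. u \<in> cball u0 r \<Longrightarrow> (1 - 1/2) * ?N v \<le> v \<bullet> (g c u *v v)"
    and upper: "\<And>u v. u \<in> cball u0 r \<Longrightarrow> v \<bullet> (g c u *v v) \<le> (1 + 1/2) * ?N v"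
    using metric_nearly_constant[OF c(1) u0, of "1/2"] by auto
  define Cg where "Cg u = (\<lambda>\<alpha> \<beta> \<sigma>. - christoffel g c u \<alpha> \<beta> \<sigma>)" for u
  define Ct where "Ct u = (\<lambda>\<alpha> \<rho> \<beta>. christoffel g c u \<rho> \<alpha> \<beta>)" for u
  define k where "k = sqrt (m / 2)"
  define k' where "k' = sqrt (3 / 2 * M)"
  define B where "B = k' / k"
  have k: "k > 0" "k' > 0" "B > 0" using m M by (auto simp: k_def k'_def B_def)
  \<comment> \<open>\<open>B\<close> converts \<open>|w|\<close> into a bound on the Euclidean length of the geodesic; \<open>\<kappa>\<close> is chosen so that the
    error bound \<open>40 \<kappa> |\<xi>| L\<^sup>2\<close> with \<open>L = B |w|\<close> is at most \<open>e |w|\<^sup>2\<close>.\<close>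
  define D where "D = 40 * (norm \<xi> + 1) * B\<^sup>2"
  define \<kappa> where "\<kappa> = e / D"
  have D: "D > 0" using k by (auto simp: D_def add_nonneg_pos)
  then have \<kappa>: "\<kappa> > 0" "\<kappa> * D = e" using e by (auto simp: \<kappa>_def)
  have \<kappa>e: "40 * \<kappa> * norm \<xi> * B\<^sup>2 \<le> e"
  proof -
    have "\<kappa> * (40 * norm \<xi> * B\<^sup>2) \<le> \<kappa> * D"
      using \<kappa> by (intro mult_left_mono) (auto simp: D_def algebra_simps)
    then show ?thesis using \<kappa>(2) by (simp add: mult_ac)
  qed
  have Cg: "isCont (\<lambda>u. coeff_norm (Cg u)) u0"
    unfolding coeff_norm_def Cg_def by (intro continuous_intros isCont_christoffel c(1) u0)
  have Ct: "isCont (\<lambda>u. coeff_norm (\<lambda>i j k. Ct u i j k - Ct u0 i j k)) u0"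
    unfolding coeff_norm_def Ct_def by (intro continuous_intros isCont_christoffel c(1) u0)
  have Ct': "isCont (\<lambda>u. coeff_norm (Ct u)) u0"
    unfolding coeff_norm_def Ct_def by (intro continuous_intros isCont_christoffel c(1) u0)
  define K where "K = max (coeff_norm (Cg u0)) (coeff_norm (Ct u0)) + 1"
  have K: "K > 0" using coeff_norm_nonneg[of "Cg u0"] by (simp add: K_def)
  have "eventually (\<lambda>u. coeff_norm (Cg u) < K) (nhds u0)"
    by (rule isCont_eventually_less[OF Cg]) (simp add: K_def)
  moreover have "eventually (\<lambda>u. coeff_norm (Ct u) < K) (nhds u0)"
    by (rule isCont_eventually_less[OF Ct']) (simp add: K_def)
  ultimately have "eventually (\<lambda>u. coeff_norm (Cg u) < K \<and> coeff_norm (Ct u) < K) (nhds u0)"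
    by (rule eventually_conj)
  then obtain r1 where r1: "r1 > 0"
    "\<And>u. dist u u0 < r1 \<Longrightarrow> coeff_norm (Cg u) < K \<and> coeff_norm (Ct u) < K"
    unfolding eventually_nhds_metric by blast
  have z: "coeff_norm (\<lambda>i j k. Ct u0 i j k - Ct u0 i j k) = 0" by (simp add: coeff_norm_def)
  have "eventually (\<lambda>u. coeff_norm (\<lambda>i j k. Ct u i j k - Ct u0 i j k) < \<kappa>) (nhds u0)"
    by (rule isCont_eventually_less[OF Ct]) (use \<kappa> z in simp)
  then obtain r2 where r2: "r2 > 0"
    "\<And>u. dist u u0 < r2 \<Longrightarrow> coeff_norm (\<lambda>i j k. Ct u i j k - Ct u0 i j k) < \<kappa>"
    unfolding eventually_nhds_metric by blast
  define R where "R = min r (r1 / 2)"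
  have R: "R > 0" "R \<le> r" "R < r1" using r r1 by (auto simp: R_def)
  define \<delta> where "\<delta> = min (min R (k * R / k')) (min (min (1 / (4 * K * B)) (\<kappa> / (K\<^sup>2 * B))) (r2 / (3 * B)))"
  have \<delta>: "\<delta> > 0" using R k K \<kappa> r2 by (simp add: \<delta>_def)
  define G where "G = (1/2) *\<^sub>R g c u0"
  have G: "v \<bullet> (G *v v) = ?N v / 2" for v
    by (simp add: G_def flip: scaleR_matrix_vector_assoc)
  have Gsym: "transpose G = G"
    using metric_symmetric[OF c(1) u0] by (simp add: G_def transpose_def vec_eq_iff)
  have Gpos: "v \<bullet> (G *v v) \<ge> 0" for v using N0 by (simp add: G)
  have kN: "k * norm v \<le> sqrt (?N v / 2)" for v
  proof -
    have "k * norm v = sqrt (m / 2 * (norm v)\<^sup>2)" by (subst real_sqrt_mult) (simp add: k_def)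
    also have "\<dots> \<le> sqrt (?N v / 2)" using m(2)[of v] by (intro real_sqrt_le_mono) simp
    finally show ?thesis .
  qed
  have "\<bar>covector_integral A \<gamma> \<zeta> - (\<xi> \<bullet> w + (w \<bullet> (christoffel_form c u0 \<xi> *v w)) / 2)\<bar> \<le> e * (norm w)\<^sup>2"
    if w: "norm w < \<delta>" and sg: "shortest_geodesic A g p (coord_inv c (u0 + w)) \<gamma>"
      and par: "parallel_along A g \<gamma> \<zeta>" and \<zeta>0: "\<zeta> 0 c = \<xi>" for w \<gamma> \<zeta>
  proof -
    define L where "L = B * norm w"
    have geo: "geodesic A g \<gamma>" and \<gamma>: "\<gamma> 0 = p" "\<gamma> 1 = coord_inv c (u0 + w)"
      and len: "curve_length A g \<gamma> = riem_dist A g p (coord_inv c (u0 + w))"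
      using sg unfolding shortest_geodesic_def by auto
    note curve = geodesic_imp_piecewise_C1_curve[OF geo]
    have wr: "norm w < R" "norm w < k * R / k'" "norm w < 1 / (4 * K * B)" "norm w < \<kappa> / (K\<^sup>2 * B)" "norm w < r2 / (3 * B)"
      using w by (auto simp: \<delta>_def)
    have L: "4 * K * L \<le> 1" "K\<^sup>2 * L \<le> \<kappa>" "3 * L < r2" "L \<ge> 0"
      using wr k K by (auto simp: L_def field_simps)
    have segr: "u0 + s *\<^sub>R w \<in> cball u0 r" if "s \<in> {0..1}" for s
    proof -
      have "norm (s *\<^sub>R w) \<le> 1 * norm w" using that by (simp add: mult_left_le_one_le)
      then show ?thesis using wr R by (simp add: dist_norm)
    qed
    have "riem_dist A g (coord_inv c u0) (coord_inv c (u0 + w)) \<le> sqrt ((1 + 1/2) * ?N w)"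
      by (rule riem_dist_le_coordinate_line[OF c(1)]) (use segr r(2) upper[OF segr, of _ w] in auto)
    also have "\<dots> \<le> sqrt (3 / 2 * M * (norm w)\<^sup>2)" using NM[of w] by (intro real_sqrt_le_mono) simp
    also have "\<dots> = k' * norm w" by (subst real_sqrt_mult) (simp add: k'_def)
    finally have short: "curve_length A g \<gamma> \<le> k' * norm w"
      using c by (simp add: len u0_def)
    have kR: "k' * norm w < k * R" using wr(2) k by (simp add: field_simps)
    have stay: "\<gamma> s \<in> chart_dom c \<and> coord c (\<gamma> s) \<in> ball u0 R" if "s \<in> {0..1}" for s
    proof -
      have start: "coord c (\<gamma> 0) = u0" "\<gamma> 0 \<in> chart_dom c" using \<gamma> c by (auto simp: u0_def)
      have sub: "cball u0 R \<subseteq> cball u0 r" using R by auto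
      then have ball: "cball u0 R \<subseteq> coord c ` chart_dom c" using r(2) by blast
      have le: "v \<bullet> (G *v v) \<le> v \<bullet> (g c u *v v)" if "u \<in> cball u0 R" for u v
        using lower[OF subsetD[OF sub that], of v] by (simp add: G)
      have "curve_length A g \<gamma> < sqrt (v \<bullet> (G *v v))" if "norm v = R" for v
        using kN[of v] kR short that by (simp add: G)
      from curve_stays_in_ball[OF curve c(1) start(2) R(1), unfolded start(1), OF ball Gsym Gpos le this that]
      show ?thesis by blast
    qed
    define x where "x s = coord c (\<gamma> s)" for s
    define v where "v = velocity {0..1} c \<gamma>"
    have x0: "x 0 = u0" "x 1 - x 0 = w"
    proof -
      have "u0 + w \<in> coord c ` chart_dom c" using segr[of 1] r(2) by auto
      then show "x 0 = u0" "x 1 - x 0 = w"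
        using \<gamma> c coord_coord_inv[OF c(1), of "u0 + w"] by (auto simp: x_def u0_def)
    qed
    have xR: "x s \<in> cball u0 r" "dist (x s) u0 < r1" if "s \<in> {0..1}" for s
      using stay[OF that] R by (auto simp: x_def dist_commute)
    have dx: "(x has_vector_derivative v s) (at s within {0..1})" if "s \<in> {0..1}" for s
      using geo stay[OF that] c(1) that velocity_works unfolding geodesic_def v_def x_def by blast
    have dv: "(v has_vector_derivative contract (Cg (x s)) (v s) (v s)) (at s within {0..1})" if "s \<in> {0..1}" for s
    proof -
      have "contract (Cg (x s)) (v s) (v s) =
        (\<chi> \<alpha>. - (\<Sum>\<beta>\<in>UNIV. \<Sum>\<sigma>\<in>UNIV. christoffel g c (x s) \<alpha> \<beta> \<sigma> * v s $ \<beta> * v s $ \<sigma>))"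
        by (simp add: contract_def Cg_def sum_negf vec_eq_iff)
      then show ?thesis
        using geo stay[OF that] c(1) that unfolding geodesic_def v_def x_def by simp
    qed
    have d\<zeta>: "((\<lambda>s. \<zeta> s c) has_vector_derivative contract (Ct (x s)) (\<zeta> s c) (v s)) (at s within {0..1})" if "s \<in> {0..1}" for s
      using par stay[OF that] c(1) that unfolding parallel_along_def v_def x_def contract_def Ct_def by blast
    have cont\<gamma>: "continuous (at s within {0..1}) \<gamma>" if "s \<in> {0..1}" for s
      using geo that by (auto simp: geodesic_def continuous_on_eq_continuous_within)
    have acc: "norm (contract (Cg (x s)) (v s) (v s)) \<le> K * (norm (v s))\<^sup>2" if "s \<in> {0..1}" for s
    proof -
      have "coeff_norm (Cg (x s)) \<le> K" using r1(2)[OF xR(2)[OF that]] by simp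
      then have "coeff_norm (Cg (x s)) * norm (v s) * norm (v s) \<le> K * norm (v s) * norm (v s)"
        by (intro mult_right_mono) auto
      then show ?thesis using norm_contract_le[of "Cg (x s)" "v s" "v s"] by (simp add: power2_eq_square)
    qed
    have speed: "k * norm (v s) \<le> speed A g \<gamma> s" if "s \<in> {0..1}" for s
    proof -
      have "k * norm (v s) \<le> sqrt (?N (v s) / 2)" by (rule kN)
      also have "\<dots> \<le> sqrt (v s \<bullet> (g c (x s) *v v s))"
        using lower[OF xR(1)[OF that], of "v s"] by (intro real_sqrt_le_mono) simp
      also have "\<dots> = speed A g \<gamma> s"
        unfolding speed_eq_speed_within x_def
        using stay[OF that] dx[OF that] cont\<gamma>[OF that] that c(1)
        by (intro speed_within_in_chart[symmetric]) (auto simp: x_def[abs_def])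
      finally show ?thesis .
    qed
    have intL: "integral {0..1} (\<lambda>s. norm (v s)) \<le> L"
    proof -
      have "continuous_on {0..1} v" by (rule continuous_on_vector_derivative[OF dv])
      then have "(\<lambda>s. norm (v s)) integrable_on {0..1}"
        by (intro integrable_continuous_real continuous_intros)
      from has_integral_mult_right[OF integrable_integral[OF this], of k]
      have 1: "((\<lambda>s. k * norm (v s)) has_integral k * integral {0..1} (\<lambda>s. norm (v s))) {0..1}" .
      have 2: "(speed A g \<gamma> has_integral curve_length A g \<gamma>) {0..1}"
        using piecewise_C1_curve_regularity[OF curve] unfolding curve_length_def
        by (meson integrable_integral)
      have "k * integral {0..1} (\<lambda>s. norm (v s)) \<le> k' * norm w"
        using has_integral_le[OF 1 2] speed short by force
      then show ?thesis using k by (simp add: L_def B_def field_simps)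
    qed
    have v_le: "norm (v s) \<le> 2 * L" if "s \<in> {0..1}" for s
      by (rule velocity_bounded_by_length[OF dv acc _ _ intL that]) (use K L in auto)
    have xr2: "dist (x s) u0 < r2" if "s \<in> {0..1}" for s
    proof -
      have "norm (x s - x 0 - (s - 0) *\<^sub>R 0) \<le> 2 * L"
        by (rule displacement_bound[OF dx]) (use that v_le in auto)
      then show ?thesis using L x0 r2 by (simp add: dist_norm)
    qed
    have "\<bar>integral {0..1} (\<lambda>s. \<zeta> s c \<bullet> v s) - (\<zeta> 0 c \<bullet> w + (contract (Ct u0) (\<zeta> 0 c) w \<bullet> w) / 2)\<bar>
           \<le> 40 * \<kappa> * norm (\<zeta> 0 c) * L\<^sup>2"
    proof (rule transport_integral_expansion[OF dx dv d\<zeta> x0(2) acc v_le])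
      show "coeff_norm (Ct (x s)) \<le> K" if "s \<in> {0..1}" for s
        using r1(2)[OF xR(2)[OF that]] by simp
      show "coeff_norm (Ct u0) \<le> K" by (simp add: K_def)
      show "coeff_norm (\<lambda>i j k. Ct (x s) i j k - Ct u0 i j k) \<le> \<kappa>" if "s \<in> {0..1}" for s
        using r2(2)[OF xr2[OF that]] by simp
    qed (use L in auto)
    moreover have "contract (Ct u0) \<xi> w \<bullet> w = w \<bullet> (christoffel_form c u0 \<xi> *v w)"
    proof -
      have "contract (Ct u0) \<xi> w = christoffel_form c u0 \<xi> *v w"
        unfolding contract_def Ct_def christoffel_form_def matrix_vector_mult_def vec_eq_iff
        by (simp add: sum_distrib_right) (intro allI sum.swap)
      then show ?thesis by (simp add: inner_commute)
    qed
    moreover have "covector_integral A \<gamma> \<zeta> = integral {0..1} (\<lambda>s. \<zeta> s c \<bullet> v s)"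
      unfolding covector_integral_def
    proof (rule integral_cong)
      fix s :: real assume s: "s \<in> {0..1}"
      let ?d = "chart_at A (\<gamma> s)"
      have d: "?d \<in> A" "\<gamma> s \<in> chart_dom ?d" using chart_at_in_atlas in_chart_at by auto
      have cs: "\<gamma> s \<in> chart_dom c" using stay[OF s] by simp
      have "velocity {0..1} ?d \<gamma> s = transition_jacobian c ?d (\<gamma> s) *v v s"
        using has_vector_derivative_change_chart[OF c(1) d(1) cs d(2) cont\<gamma>[OF s] s dx[OF s, unfolded x_def[abs_def]]] s
        by (intro velocity_eqI) auto
      then show "(let c = chart_at A (\<gamma> s) in \<zeta> s c \<bullet> velocity {0..1} c \<gamma> s) = \<zeta> s c \<bullet> v s"
        using covector_pairing[OF _ c(1) d(1) cs d(2)] par s by (simp add: Let_def parallel_along_def)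
    qed
    ultimately have "\<bar>covector_integral A \<gamma> \<zeta> - (\<xi> \<bullet> w + (w \<bullet> (christoffel_form c u0 \<xi> *v w)) / 2)\<bar>
        \<le> 40 * \<kappa> * norm \<xi> * L\<^sup>2" by (simp add: \<zeta>0)
    also have "\<dots> = (40 * \<kappa> * norm \<xi> * B\<^sup>2) * (norm w)\<^sup>2" by (simp add: L_def power_mult_distrib)
    also have "\<dots> \<le> e * (norm w)\<^sup>2" using \<kappa>e by (intro mult_right_mono) auto
    finally show ?thesis .
  qed
  then show ?thesis using \<delta> by (auto simp: u0_def)
qed

end

type_synonym 'n phase_point = "real \<times> (real ^ 'n) \<times> (real ^ 'n) \<times> (real ^ 'n) \<times> real"

text \<open>
  The parameter \<open>\<epsilon>\<close>, the point \<open>y\<close> and the chart \<open>d\<close> around it are fixed; covectors at \<open>y\<close> are represented by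
  their components \<open>v\<close> in \<open>d\<close>.
\<close>

locale levi_civita_phase_at = riemannian_atlas A g
  for A :: "('m::t2_space, 'n::finite) chart set" and g :: "('m, 'n) metric" +
  fixes X :: "real \<Rightarrow> 'm \<times> ('m, 'n) covector \<Rightarrow> 'm"
    and \<Xi> :: "real \<Rightarrow> 'm \<times> ('m, 'n) covector \<Rightarrow> ('m, 'n) covector"
    and \<phi> :: "real \<Rightarrow> 'm \<Rightarrow> 'm \<times> ('m, 'n) covector \<Rightarrow> real \<Rightarrow> complex"
    and \<epsilon> :: real and y :: 'm and d :: "('m, 'n) chart"
  assumes flow: "hamiltonian_flow A g X \<Xi>"
    and phase: "levi_civita_phase A g X \<Xi> \<phi>"
    and \<epsilon>: "\<epsilon> > 0" and d: "d \<in> A" "y \<in> chart_dom d"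
begin

definition Y :: "real ^ 'n \<Rightarrow> 'm \<times> ('m, 'n) covector" where
  "Y v = (y, covector_of A d y v)"

text \<open>
  The phase in local coordinates, in the form whose smoothness is assumed. Its arguments are time,
  coordinates of \<open>x\<close>, coordinates of the base point, components of the covector, and \<open>\<epsilon>\<close>.
\<close>

definition phase_coord :: "('m, 'n) chart \<Rightarrow> 'n phase_point \<Rightarrow> complex" where
  "phase_coord c = (\<lambda>(t, u, w, v, \<epsilon>).
     \<phi> t (coord_inv c u) (coord_inv d w, covector_of A d (coord_inv d w) v) \<epsilon>)"

definition phase_dom :: "('m, 'n) chart \<Rightarrow> ('n phase_point) set" where
  "phase_dom c = UNIV \<times> coord c ` chart_dom c \<times> coord d ` chart_dom d \<times> (UNIV - {0}) \<times> {0<..}"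

definition pt :: "real \<Rightarrow> real ^ 'n \<Rightarrow> real ^ 'n \<Rightarrow> 'n phase_point" where
  "pt t u v = (t, u, coord d y, v, \<epsilon>)"

definition phase_x :: "('m, 'n) chart \<Rightarrow> real ^ 'n \<Rightarrow> 'n phase_point \<Rightarrow> complex" where
  "phase_x c a z = frechet_derivative (phase_coord c) (at z) (0, a, 0, 0, 0)"

definition phase_xx :: "('m, 'n) chart \<Rightarrow> real ^ 'n \<Rightarrow> real ^ 'n \<Rightarrow> 'n phase_point \<Rightarrow> complex" where
  "phase_xx c a b z = frechet_derivative (phase_x c a) (at z) (0, b, 0, 0, 0)"

lemma phase_coord_pt: "phase_coord c (pt t u v) = \<phi> t (coord_inv c u) (Y v) \<epsilon>"
  using d by (simp add: phase_coord_def pt_def Y_def)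

lemma open_phase_dom: "c \<in> A \<Longrightarrow> open (phase_dom c)"
  unfolding phase_dom_def by (intro open_Times open_chart_image d open_delete open_UNIV open_greaterThan)

lemma pt_in_phase_dom: "u \<in> coord c ` chart_dom c \<Longrightarrow> v \<noteq> 0 \<Longrightarrow> pt t u v \<in> phase_dom c"
  using d \<epsilon> by (auto simp: pt_def phase_dom_def)

lemma phase_coord_smooth: "c \<in> A \<Longrightarrow> smooth_on (phase_dom c) (phase_coord c)"
  using phase d unfolding levi_civita_phase_def smooth_phase_def phase_dom_def phase_coord_def by blast

lemma phase_x_smooth: "c \<in> A \<Longrightarrow> smooth_on (phase_dom c) (phase_x c a)"
  unfolding phase_x_def[abs_def] by (intro smooth_on_frechet_derivative phase_coord_smooth)

lemma phase_xx_smooth: "c \<in> A \<Longrightarrow> smooth_on (phase_dom c) (phase_xx c a b)"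
  unfolding phase_xx_def[abs_def] by (intro smooth_on_frechet_derivative phase_x_smooth)

lemma isCont_on_phase_dom:
  fixes F :: "_ \<Rightarrow> complex"
  assumes "smooth_on (phase_dom c) F" "c \<in> A" "z \<in> phase_dom c"
  shows "isCont F z"
  using smooth_on_imp_continuous_on[OF assms(1)] open_phase_dom[OF assms(2)] assms(3)
    continuous_on_eq_continuous_at by blast

lemma Y_punctured: "v \<noteq> 0 \<Longrightarrow> Y v \<in> punctured_cotangent A"
  unfolding Y_def by (rule covector_of_punctured[OF d])

lemma trajectory: "v \<noteq> 0 \<Longrightarrow> hamiltonian_trajectory A g (Y v) (\<lambda>t. X t (Y v)) (\<lambda>t. \<Xi> t (Y v))"
  using flow Y_punctured by (simp add: hamiltonian_flow_def)

lemma phase_expansion: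
  assumes v: "v \<noteq> 0" and c: "c \<in> A" "X t (Y v) \<in> chart_dom c" and e: "e > 0"
  defines "u0 \<equiv> coord c (X t (Y v))"
  shows "\<exists>\<delta>>0. \<forall>w. norm w < \<delta> \<longrightarrow>
      \<bar>Re (phase_coord c (pt t (u0 + w) v)) - (0 + \<Xi> t (Y v) c \<bullet> w +
        (w \<bullet> (christoffel_form c u0 (\<Xi> t (Y v) c) *v w)) / 2)\<bar> \<le> e * (norm w)\<^sup>2"
    (is "\<exists>\<delta>>0. \<forall>w. _ \<longrightarrow> ?Re w")
    and "\<exists>\<delta>>0. \<forall>w. norm w < \<delta> \<longrightarrow>
      \<bar>Im (phase_coord c (pt t (u0 + w) v)) - (0 + 0 \<bullet> w +
        (w \<bullet> (((\<epsilon> * ham A g (Y v)) *\<^sub>R g c u0) *v w)) / 2)\<bar> \<le> e * (norm w)\<^sup>2"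
    (is "\<exists>\<delta>>0. \<forall>w. _ \<longrightarrow> ?Im w")
proof -
  let ?p = "X t (Y v)" and ?h = "ham A g (Y v)" and ?\<xi> = "\<Xi> t (Y v) c"
  have h: "?h > 0" using ham_positive Y_punctured[OF v] by (metis surj_pair)
  obtain N where N: "geodesic_neighbourhood A g ?p N"
    "\<And>x. x \<in> N \<Longrightarrow> \<exists>\<gamma> \<zeta>. shortest_geodesic A g ?p x \<gamma> \<and> parallel_along A g \<gamma> \<zeta> \<and> \<zeta> 0 = \<Xi> t (Y v) \<and>
       \<phi> t x (Y v) \<epsilon> = of_real (covector_integral A \<gamma> \<zeta>)
         + \<i> * of_real \<epsilon> / 2 * of_real ?h * of_real ((riem_dist A g x ?p)\<^sup>2)"
    using phase Y_punctured[OF v] \<epsilon> unfolding levi_civita_phase_def by metis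
  have u0: "u0 \<in> coord c ` chart_dom c" using c by (simp add: u0_def)
  have "isCont (\<lambda>w. coord_inv c (u0 + w)) 0"
    using isCont_o2[of 0 "\<lambda>w. u0 + w" "coord_inv c"] isCont_coord_inv[OF c(1) u0] by simp
  then have "((coord_inv c \<circ> (\<lambda>w. u0 + w)) \<longlongrightarrow> ?p) (nhds 0)"
    using c tendsto_at_iff_tendsto_nhds[of "\<lambda>w. coord_inv c (u0 + w)" 0]
    by (simp add: isCont_def u0_def o_def)
  then have "eventually (\<lambda>w. (coord_inv c \<circ> (\<lambda>w. u0 + w)) w \<in> N) (nhds 0)"
    using N(1) by (auto simp: geodesic_neighbourhood_def dest: topological_tendstoD)
  then obtain \<delta>0 where \<delta>0: "\<delta>0 > 0" "\<And>w. norm w < \<delta>0 \<Longrightarrow> coord_inv c (u0 + w) \<in> N"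
    unfolding eventually_nhds_metric by auto
  obtain \<delta>1 where \<delta>1: "\<delta>1 > 0" "\<And>w \<gamma> \<zeta>. norm w < \<delta>1 \<Longrightarrow>
      shortest_geodesic A g ?p (coord_inv c (u0 + w)) \<gamma> \<Longrightarrow> parallel_along A g \<gamma> \<zeta> \<Longrightarrow> \<zeta> 0 c = ?\<xi> \<Longrightarrow>
      \<bar>covector_integral A \<gamma> \<zeta> - (?\<xi> \<bullet> w + (w \<bullet> (christoffel_form c u0 ?\<xi> *v w)) / 2)\<bar> \<le> e * (norm w)\<^sup>2"
    using covector_integral_expansion[OF c e, of ?\<xi>] unfolding u0_def by metis
  define e' where "e' = 2 * e / (\<epsilon> * ?h)"
  have e': "e' > 0" "\<epsilon> * ?h / 2 * e' = e" using e \<epsilon> h by (auto simp: e'_def)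
  obtain \<delta>2 where \<delta>2: "\<delta>2 > 0" "\<And>w. norm w < \<delta>2 \<Longrightarrow>
      \<bar>(riem_dist A g (coord_inv c (u0 + w)) ?p)\<^sup>2 - w \<bullet> (g c u0 *v w)\<bar> \<le> e' * (norm w)\<^sup>2"
    using riem_dist_squared_expansion[OF c e'(1)] unfolding u0_def by blast
  have "?Re w \<and> ?Im w" if w: "norm w < min \<delta>0 (min \<delta>1 \<delta>2)" for w
  proof -
    let ?x = "coord_inv c (u0 + w)"
    let ?r = "(riem_dist A g ?x ?p)\<^sup>2"
    obtain \<gamma> \<zeta> where \<gamma>: "shortest_geodesic A g ?p ?x \<gamma>" "parallel_along A g \<gamma> \<zeta>" "\<zeta> 0 = \<Xi> t (Y v)"
      "\<phi> t ?x (Y v) \<epsilon> = of_real (covector_integral A \<gamma> \<zeta>)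
         + \<i> * of_real \<epsilon> / 2 * of_real ?h * of_real ?r"
      using N(2)[OF \<delta>0(2)] w by (metis min_less_iff_conj)
    have re: "Re (phase_coord c (pt t (u0 + w) v)) = covector_integral A \<gamma> \<zeta>"
      and im: "Im (phase_coord c (pt t (u0 + w) v)) = \<epsilon> * ?h / 2 * ?r"
      unfolding phase_coord_pt \<gamma>(4) by simp_all
    have 1: "?Re w"
      using \<delta>1(2)[OF _ \<gamma>(1,2)] w \<gamma>(3) by (simp add: re)
    have "Im (phase_coord c (pt t (u0 + w) v)) - (0 + 0 \<bullet> w + (w \<bullet> (((\<epsilon> * ?h) *\<^sub>R g c u0) *v w)) / 2)
        = \<epsilon> * ?h / 2 * (?r - w \<bullet> (g c u0 *v w))"
      by (simp add: im algebra_simps flip: scaleR_matrix_vector_assoc)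
    also have "\<bar>\<dots>\<bar> \<le> \<epsilon> * ?h / 2 * (e' * (norm w)\<^sup>2)"
      using \<delta>2(2)[of w] w \<epsilon> h unfolding abs_mult by (intro mult_mono) auto
    also have "\<dots> = e * (norm w)\<^sup>2" using e'(2) by (metis mult.assoc)
    finally show ?thesis using 1 by blast
  qed
  then have *: "\<exists>\<delta>>0. \<forall>w. norm w < \<delta> \<longrightarrow> ?Re w \<and> ?Im w"
    using \<delta>0(1) \<delta>1(1) \<delta>2(1) by (intro exI[of _ "min \<delta>0 (min \<delta>1 \<delta>2)"]) auto
  then show "\<exists>\<delta>>0. \<forall>w. norm w < \<delta> \<longrightarrow> ?Re w" "\<exists>\<delta>>0. \<forall>w. norm w < \<delta> \<longrightarrow> ?Im w" by blast+
qed

lemma has_derivative_Re_Im: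
  assumes "(f has_vector_derivative D) (at s)"
  shows "((\<lambda>s. Re (f s)) has_real_derivative Re D) (at s)" "((\<lambda>s. Im (f s)) has_real_derivative Im D) (at s)"
  using bounded_linear.has_vector_derivative[OF bounded_linear_Re assms]
    bounded_linear.has_vector_derivative[OF bounded_linear_Im assms]
  by (simp_all add: has_real_derivative_iff_has_vector_derivative)

lemma has_derivative_pt:
  assumes "(U has_derivative U') (at x)" "(V has_derivative V') (at x)"
  shows "((\<lambda>x. pt t (U x) (V x)) has_derivative (\<lambda>h. (0, U' h, 0, V' h, 0))) (at x)"
  unfolding pt_def by (intro has_derivative_Pair has_derivative_const assms)

lemma pt_shift: "pt t u v + s *\<^sub>R (0, a, 0, 0, 0) = pt t (u + s *\<^sub>R a) v"
  by (simp add: pt_def)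

text \<open>
  These identities hold for every nonzero \<open>v\<close>, so the first one can be differentiated in \<open>v\<close>. The second one
  evaluates the resulting term with \<open>x\<close>-derivatives only, and its imaginary part is positive definite.
\<close>

lemma phase_derivatives_on_flow:
  assumes v: "v \<noteq> 0" and c: "c \<in> A" "X t (Y v) \<in> chart_dom c"
  defines "u0 \<equiv> coord c (X t (Y v))"
  shows "phase_x c a (pt t u0 v) = of_real (\<Xi> t (Y v) c \<bullet> a)"
    and "phase_xx c a b (pt t u0 v) = Complex (b \<bullet> (christoffel_form c u0 (\<Xi> t (Y v) c) *v a))
           (\<epsilon> * ham A g (Y v) * (b \<bullet> (g c u0 *v a)))"
proof -
  let ?S = "coord c ` chart_dom c" and ?\<xi> = "\<Xi> t (Y v) c"
  have S: "open ?S" "u0 \<in> ?S" using open_chart_image c by (auto simp: u0_def)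
  have 1: "((\<lambda>s. phase_coord c (pt t (u + s *\<^sub>R a) v)) has_vector_derivative phase_x c a (pt t u v)) (at 0)"
    if "u \<in> ?S" for u
    using has_derivative_along_line[of "phase_coord c" _ "pt t u v" 0 "(0, a, 0, 0, 0)",
        unfolded pt_shift scaleR_zero_left add_0_right,
        OF smooth_on_has_derivative[OF phase_coord_smooth[OF c(1)] pt_in_phase_dom[OF that v]]]
    unfolding phase_x_def .
  have 2: "((\<lambda>s. phase_x c a (pt t (u + s *\<^sub>R b) v)) has_vector_derivative phase_xx c a b (pt t u v)) (at 0)"
    if "u \<in> ?S" for u
    using has_derivative_along_line[of "phase_x c a" _ "pt t u v" 0 "(0, b, 0, 0, 0)",
        unfolded pt_shift scaleR_zero_left add_0_right,
        OF smooth_on_has_derivative[OF phase_x_smooth[OF c(1)] pt_in_phase_dom[OF that v]]]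
    unfolding phase_xx_def .
  have 3: "isCont (\<lambda>u. phase_xx c a b (pt t u v)) u0"
  proof (rule isCont_o2[where f = "\<lambda>u. pt t u v" and g = "phase_xx c a b"])
    show "isCont (\<lambda>u. pt t u v) u0" unfolding pt_def by (intro continuous_intros)
    show "isCont (phase_xx c a b) (pt t u0 v)"
      by (rule isCont_on_phase_dom[OF phase_xx_smooth[OF c(1)] c(1) pt_in_phase_dom[OF S(2) v]])
  qed
  have sym: "transpose (christoffel_form c u0 ?\<xi>) = christoffel_form c u0 ?\<xi>"
    using christoffel_symmetric[OF c(1) S(2)]
    by (simp add: christoffel_form_def transpose_def vec_eq_iff)
  have symg: "transpose ((\<epsilon> * ham A g (Y v)) *\<^sub>R g c u0) = (\<epsilon> * ham A g (Y v)) *\<^sub>R g c u0"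
    using metric_symmetric[OF c(1) S(2)] by (simp add: transpose_def vec_eq_iff)
  note re = derivatives_from_quadratic_expansion[OF S has_derivative_Re_Im(1)[OF 1]
    has_derivative_Re_Im(1)[OF 2] _ sym phase_expansion(1)[OF v c, folded u0_def]]
  note im = derivatives_from_quadratic_expansion[OF S has_derivative_Re_Im(2)[OF 1]
    has_derivative_Re_Im(2)[OF 2] _ symg phase_expansion(2)[OF v c, folded u0_def]]
  show "phase_x c a (pt t u0 v) = of_real (?\<xi> \<bullet> a)"
    using re(1) im(1) 3 by (simp add: complex_eq_iff continuous_Re continuous_Im)
  show "phase_xx c a b (pt t u0 v) = Complex (b \<bullet> (christoffel_form c u0 ?\<xi> *v a))
           (\<epsilon> * ham A g (Y v) * (b \<bullet> (g c u0 *v a)))"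
    using re(2) im(2) 3
    by (simp add: complex_eq_iff continuous_Re continuous_Im flip: scaleR_matrix_vector_assoc)
qed

section \<open>Regularity of the flow in the initial covector\<close>

text \<open>
  Differentiability of the flow in the initial covector is read off from the smoothness of the phase:
  the position \<open>X t (Y v)\<close> solves the equation \<open>im_gradient c (t, v) u = 0\<close>, which is nondegenerate. Trajectories
  enter through their continuity in time and their common starting point \<open>y\<close>.
\<close>

definition im_gradient :: "('m, 'n) chart \<Rightarrow> real \<times> (real ^ 'n) \<Rightarrow> real ^ 'n \<Rightarrow> real ^ 'n" where
  "im_gradient c z u = (\<chi> \<alpha>. Im (phase_x c (axis \<alpha> 1) (pt (fst z) u (snd z))))"

definition im_hessian :: "('m, 'n) chart \<Rightarrow> real \<times> (real ^ 'n) \<Rightarrow> real ^ 'n \<Rightarrow> real ^ 'n ^ 'n" where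
  "im_hessian c z u = (\<chi> \<alpha> \<beta>. Im (phase_xx c (axis \<alpha> 1) (axis \<beta> 1) (pt (fst z) u (snd z))))"

lemma vec_has_derivative:
  fixes f :: "'b::real_normed_vector \<Rightarrow> real ^ 'k"
  assumes "\<And>i. ((\<lambda>x. f x $ i) has_derivative (\<lambda>h. f' h $ i)) (at a)"
  shows "(f has_derivative f') (at a)"
  using assms unfolding has_derivative_componentwise_within[of f f' a UNIV]
  by (auto simp: Basis_vec_def inner_axis)

lemma frechet_phase_x_expand:
  assumes c: "c \<in> A" "z \<in> phase_dom c"
  shows "frechet_derivative (phase_x c a) (at z) (0, h, 0, 0, 0) = (\<Sum>\<beta>\<in>UNIV. h $ \<beta> *\<^sub>R phase_xx c a (axis \<beta> 1) z)"
proof -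
  let ?D = "frechet_derivative (phase_x c a) (at z)"
  have lin: "linear ?D"
    using smooth_on_has_derivative[OF phase_x_smooth[OF c(1)] c(2)] has_derivative_linear by blast
  then have l: "linear (\<lambda>h. ?D (0, h, 0, 0, 0))"
    by (intro linearI) (use linear_add[OF lin, symmetric] linear_scale[OF lin, symmetric] in simp_all)
  have "?D (0, (\<Sum>\<beta>\<in>UNIV. h $ \<beta> *\<^sub>R axis \<beta> 1), 0, 0, 0) = (\<Sum>\<beta>\<in>UNIV. h $ \<beta> *\<^sub>R ?D (0, axis \<beta> 1, 0, 0, 0))"
    using linear_sum[OF l, of "\<lambda>\<beta>. h $ \<beta> *\<^sub>R axis \<beta> 1" UNIV] linear_scale[OF l] by simp
  moreover have "(\<Sum>\<beta>\<in>UNIV. h $ \<beta> *\<^sub>R axis \<beta> 1) = h"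
    using basis_expansion[of h] by (simp add: scalar_mult_eq_scaleR)
  ultimately show ?thesis by (simp add: phase_xx_def)
qed

lemma im_gradient_has_derivative:
  assumes c: "c \<in> A" "u \<in> coord c ` chart_dom c" "snd z \<noteq> 0"
  shows "(im_gradient c z has_derivative (\<lambda>h. im_hessian c z u *v h)) (at u)"
proof (rule vec_has_derivative)
  fix \<alpha>
  let ?z = "pt (fst z) u (snd z)"
  have z: "?z \<in> phase_dom c" by (rule pt_in_phase_dom[OF c(2,3)])
  have "((\<lambda>u. pt (fst z) u (snd z)) has_derivative (\<lambda>h. (0, h, 0, 0, 0))) (at u)"
    by (intro has_derivative_pt has_derivative_ident has_derivative_const)
  from has_derivative_compose[OF this smooth_on_has_derivative[OF phase_x_smooth[OF c(1)] z]]
  have "((\<lambda>u. phase_x c (axis \<alpha> 1) (pt (fst z) u (snd z))) has_derivative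
     (\<lambda>h. frechet_derivative (phase_x c (axis \<alpha> 1)) (at ?z) (0, h, 0, 0, 0))) (at u)" .
  from bounded_linear.has_derivative[OF bounded_linear_Im this]
  show "((\<lambda>u. im_gradient c z u $ \<alpha>) has_derivative (\<lambda>h. (im_hessian c z u *v h) $ \<alpha>)) (at u)"
    by (simp add: im_gradient_def im_hessian_def frechet_phase_x_expand[OF c(1) z] matrix_vector_mult_def mult.commute)
qed

lemma isCont_vec:
  fixes f :: "'b::t2_space \<Rightarrow> 'c::t2_space ^ 'k"
  assumes "\<And>i. isCont (\<lambda>x. f x $ i) x"
  shows "isCont f x"
  using assms unfolding isCont_def by (intro vec_tendstoI)

lemma isCont_im_hessian:
  assumes c: "c \<in> A" "u \<in> coord c ` chart_dom c" "snd z \<noteq> 0"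
  shows "isCont (\<lambda>(z, u). im_hessian c z u) (z, u)"
proof (intro isCont_vec)
  fix \<alpha> \<beta>
  have z: "pt (fst z) u (snd z) \<in> phase_dom c" by (rule pt_in_phase_dom[OF c(2,3)])
  have "isCont (\<lambda>x. pt (fst (fst x)) (snd x) (snd (fst x))) (z, u)"
    unfolding pt_def by (intro continuous_intros)
  then have "isCont (\<lambda>x. phase_xx c (axis \<alpha> 1) (axis \<beta> 1) (pt (fst (fst x)) (snd x) (snd (fst x)))) (z, u)"
    by (rule isCont_o2) (use isCont_on_phase_dom[OF phase_xx_smooth[OF c(1)] c(1) z] in simp)
  then have "isCont (\<lambda>x. Im (phase_xx c (axis \<alpha> 1) (axis \<beta> 1) (pt (fst (fst x)) (snd x) (snd (fst x))))) (z, u)"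
    by (rule continuous_Im)
  then show "isCont (\<lambda>x. (case x of (z, u) \<Rightarrow> im_hessian c z u) $ \<alpha> $ \<beta>) (z, u)"
    by (simp add: im_hessian_def case_prod_beta)
qed

lemma isCont_im_gradient:
  assumes c: "c \<in> A" "u \<in> coord c ` chart_dom c" "snd z \<noteq> 0"
  shows "isCont (\<lambda>z. im_gradient c z u) z"
proof (intro isCont_vec)
  fix \<alpha>
  have z: "pt (fst z) u (snd z) \<in> phase_dom c" by (rule pt_in_phase_dom[OF c(2,3)])
  have "isCont (\<lambda>x. pt (fst x) u (snd x)) z"
    unfolding pt_def by (intro continuous_intros)
  then have "isCont (\<lambda>x. phase_x c (axis \<alpha> 1) (pt (fst x) u (snd x))) z"
    by (rule isCont_o2) (use isCont_on_phase_dom[OF phase_x_smooth[OF c(1)] c(1) z] in simp)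
  then have "isCont (\<lambda>x. Im (phase_x c (axis \<alpha> 1) (pt (fst x) u (snd x)))) z"
    by (rule continuous_Im)
  then show "isCont (\<lambda>x. im_gradient c x u $ \<alpha>) z" by (simp add: im_gradient_def)
qed

lemma im_gradient_zero:
  assumes "v \<noteq> 0" "c \<in> A" "X t (Y v) \<in> chart_dom c"
  shows "im_gradient c (t, v) (coord c (X t (Y v))) = 0"
  by (simp add: im_gradient_def vec_eq_iff phase_derivatives_on_flow(1)[OF assms])

lemma im_hessian_on_flow:
  assumes "v \<noteq> 0" "c \<in> A" "X t (Y v) \<in> chart_dom c"
  shows "im_hessian c (t, v) (coord c (X t (Y v))) = (\<epsilon> * ham A g (Y v)) *\<^sub>R g c (coord c (X t (Y v)))"
proof -
  let ?g = "g c (coord c (X t (Y v)))"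
  have "axis \<beta> 1 \<bullet> (?g *v axis \<alpha> 1) = ?g $ \<alpha> $ \<beta>" for \<alpha> \<beta>
    using arg_cong[OF metric_symmetric[OF assms(2) imageI[OF assms(3)]], of "\<lambda>M. M $ \<beta> $ \<alpha>"]
    by (simp add: transpose_def inner_axis' matrix_vector_mult_basis column_def)
  then show ?thesis
    by (simp add: im_hessian_def vec_eq_iff phase_derivatives_on_flow(2)[OF assms])
qed

text \<open>
  On the flow the imaginary gradient vanishes and the imaginary Hessian is a positive multiple of
  the metric. So near a point of the flow the position is the only zero of the imaginary gradient,
  with a quantitative bound.
\<close>

lemma im_gradient_strongly_monotone:
  assumes v0: "v0 \<noteq> 0" and c: "c \<in> A" "X t0 (Y v0) \<in> chart_dom c"
  defines "u0 \<equiv> coord c (X t0 (Y v0))"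
  obtains m \<delta> where "m > 0" "\<delta> > 0" "ball u0 \<delta> \<subseteq> coord c ` chart_dom c" "\<And>z. z \<in> ball (t0, v0) \<delta> \<Longrightarrow> snd z \<noteq> 0"
    "\<And>z u u'. z \<in> ball (t0, v0) \<delta> \<Longrightarrow> u \<in> ball u0 \<delta> \<Longrightarrow> u' \<in> ball u0 \<delta> \<Longrightarrow>
       m * norm (u - u') \<le> norm (im_gradient c z u - im_gradient c z u')"
proof -
  have u0: "u0 \<in> coord c ` chart_dom c" using c by (simp add: u0_def)
  obtain r1 where r1: "r1 > 0" "ball u0 r1 \<subseteq> coord c ` chart_dom c"
    using open_chart_image[OF c(1)] u0 openE by blast
  define r where "r = min r1 (norm v0)"
  have r: "r > 0" using r1 v0 by (simp add: r_def)
  have nz: "snd z \<noteq> 0" if "z \<in> ball (t0, v0) r" for z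
  proof
    assume "snd z = 0"
    then have "norm v0 \<le> dist (t0, v0) z" using dist_snd_le[of "(t0, v0)" z] by simp
    then show False using that by (simp add: r_def)
  qed
  have h: "ham A g (Y v0) > 0" using ham_positive Y_punctured[OF v0] by (metis surj_pair)
  obtain m \<delta> where m: "m > 0" "\<delta> > 0" "\<delta> \<le> r"
    "\<And>z u u'. z \<in> ball (t0, v0) \<delta> \<Longrightarrow> u \<in> ball u0 \<delta> \<Longrightarrow> u' \<in> ball u0 \<delta> \<Longrightarrow>
       m * norm (u - u') \<le> norm (im_gradient c z u - im_gradient c z u')"
  proof (rule strongly_monotone_near[OF r, of "(t0, v0)" u0 "im_gradient c" "im_hessian c"])
    fix z u assume "z \<in> ball (t0, v0) r" "u \<in> ball u0 r"
    then show "(im_gradient c z has_derivative (*v) (im_hessian c z u)) (at u)"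
      using im_gradient_has_derivative[OF c(1), of u z] nz r1 by (auto simp: r_def)
  next
    show "isCont (\<lambda>(z, u). im_hessian c z u) ((t0, v0), u0)"
      by (rule isCont_im_hessian[OF c(1) u0]) (use v0 in simp)
  next
    fix a :: "real ^ 'n" assume "a \<noteq> 0"
    then show "a \<bullet> (im_hessian c (t0, v0) u0 *v a) > 0"
      using metric_positive[OF c(1) u0] h \<epsilon>
      by (simp add: u0_def im_hessian_on_flow[OF v0 c] flip: scaleR_matrix_vector_assoc)
  qed blast
  show thesis
  proof (rule that[OF m(1,2) _ _ m(4)])
    show "ball u0 \<delta> \<subseteq> coord c ` chart_dom c" using r1 m(3) by (auto simp: r_def)
    show "snd z \<noteq> 0" if "z \<in> ball (t0, v0) \<delta>" for z using nz[of z] that m(3) by auto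
  qed
qed


lemma continuous_flow_in_time: "v \<noteq> 0 \<Longrightarrow> continuous_on UNIV (\<lambda>t. X t (Y v))"
  using trajectory unfolding hamiltonian_trajectory_def by blast

text \<open>
  For \<open>(t, v)\<close> near \<open>(t0, v0)\<close> a position inside the ball around \<open>X t0 (Y v0)\<close> is a zero of the imaginary
  gradient and thus is trapped in the concentric half ball. Membership in the ball is therefore both open
  and closed in \<open>t\<close>: once the trajectory of a nearby covector is in the ball at some time \<open>s\<close>, it
  stays there on the whole time interval, and then strong monotonicity compares it with the
  trajectory of \<open>v0\<close>.
\<close>

lemma continuity_propagates_in_time:
  assumes v0: "v0 \<noteq> 0"
  shows "\<exists>\<delta>>0. \<forall>s\<in>ball t0 \<delta>. \<forall>t\<in>ball t0 \<delta>. isCont (\<lambda>v. X s (Y v)) v0 \<longrightarrow> isCont (\<lambda>v. X t (Y v)) v0"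
proof -
  let ?p = "X t0 (Y v0)"
  define c where "c = chart_at A ?p"
  have c: "c \<in> A" "?p \<in> chart_dom c" using chart_at_in_atlas in_chart_at by (auto simp: c_def)
  define u0 where "u0 = coord c ?p"
  obtain m \<rho> where m: "m > 0" and \<rho>: "\<rho> > 0" "ball u0 \<rho> \<subseteq> coord c ` chart_dom c"
    and nz: "\<And>z. z \<in> ball (t0, v0) \<rho> \<Longrightarrow> snd z \<noteq> 0"
    and mono: "\<And>z u u'. z \<in> ball (t0, v0) \<rho> \<Longrightarrow> u \<in> ball u0 \<rho> \<Longrightarrow> u' \<in> ball u0 \<rho> \<Longrightarrow>
       m * norm (u - u') \<le> norm (im_gradient c z u - im_gradient c z u')"
    using im_gradient_strongly_monotone[OF v0 c] unfolding u0_def by blast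
  have u0: "u0 \<in> ball u0 \<rho>" using \<rho> by simp
  define W where "W = coord_inv c ` ball u0 \<rho>"
  define K where "K = coord_inv c ` cball u0 (\<rho> / 2)"
  have sub: "cball u0 (\<rho> / 2) \<subseteq> ball u0 \<rho>" using \<rho>(1) by auto
  have W: "open W" unfolding W_def by (rule open_coord_inv_image[OF c(1) open_ball \<rho>(2)])
  have K: "closed K" unfolding K_def
    by (rule closed_coord_inv_image[OF c(1) compact_cball]) (use sub \<rho>(2) in blast)
  have W_iff: "x \<in> W \<longleftrightarrow> x \<in> chart_dom c \<and> coord c x \<in> ball u0 \<rho>" for x
    unfolding W_def by (rule in_coord_inv_image_iff[OF c(1) \<rho>(2)])
  have K_iff: "x \<in> K \<longleftrightarrow> x \<in> chart_dom c \<and> coord c x \<in> cball u0 (\<rho> / 2)" for x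
    unfolding K_def by (rule in_coord_inv_image_iff[OF c(1)]) (use sub \<rho>(2) in blast)
  have "isCont (\<lambda>z. im_gradient c z u0) (t0, v0)"
    by (rule isCont_im_gradient[OF c(1)]) (use u0 \<rho> v0 in auto)
  moreover have "im_gradient c (t0, v0) u0 = 0"
    unfolding u0_def by (rule im_gradient_zero[OF v0 c])
  ultimately obtain \<rho>1 where \<rho>1: "\<rho>1 > 0" "\<And>z. dist z (t0, v0) < \<rho>1 \<Longrightarrow> norm (im_gradient c z u0) < m * (\<rho> / 2)"
    unfolding continuous_at_eps_delta using m \<rho>(1) by (metis dist_0_norm dist_commute half_gt_zero mult_pos_pos)
  define \<rho>2 where "\<rho>2 = min \<rho> \<rho>1 / 2"
  have \<rho>2: "\<rho>2 > 0" using \<rho> \<rho>1 by (simp add: \<rho>2_def)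
  have near: "(t, v) \<in> ball (t0, v0) \<rho>" "dist (t, v) (t0, v0) < \<rho>1" if "dist t t0 < \<rho>2" "dist v v0 < \<rho>2" for t v
  proof -
    have "dist (t, v) (t0, v0) \<le> dist t t0 + dist v v0"
      using sqrt_sum_squares_le_sum[of "dist t t0" "dist v v0"] by (simp add: dist_Pair_Pair)
    then show "(t, v) \<in> ball (t0, v0) \<rho>" "dist (t, v) (t0, v0) < \<rho>1"
      using that by (auto simp: \<rho>2_def dist_commute)
  qed
  \<comment> \<open>The gradient at the centre is too small for a zero in the outer half of the ball.\<close>
  have trap: "X t (Y v) \<in> W \<longleftrightarrow> X t (Y v) \<in> K" if tv: "dist t t0 < \<rho>2" "dist v v0 < \<rho>2" for t v
  proof
    assume "X t (Y v) \<in> K"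
    then show "X t (Y v) \<in> W" using sub by (auto simp: W_def K_def)
  next
    assume "X t (Y v) \<in> W"
    then have x: "X t (Y v) \<in> chart_dom c" "coord c (X t (Y v)) \<in> ball u0 \<rho>" by (auto simp: W_iff)
    let ?u = "coord c (X t (Y v))"
    have "v \<noteq> 0" using nz[OF near(1)[OF tv]] by simp
    then have "im_gradient c (t, v) ?u = 0" by (rule im_gradient_zero[OF _ c(1) x(1)])
    then have "m * norm (?u - u0) \<le> norm (im_gradient c (t, v) u0)"
      using mono[OF near(1)[OF tv] x(2) u0] by simp
    also have "\<dots> < m * (\<rho> / 2)" by (rule \<rho>1(2)[OF near(2)[OF tv]])
    finally have "norm (?u - u0) < \<rho> / 2" using m by simp
    then show "X t (Y v) \<in> K" using x by (simp add: K_iff dist_norm norm_minus_commute)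
  qed
  have "isCont (\<lambda>t. X t (Y v0)) t0"
    using continuous_flow_in_time[OF v0] continuous_on_eq_continuous_at open_UNIV by blast
  then have "((\<lambda>t. X t (Y v0)) \<longlongrightarrow> ?p) (nhds t0)"
    using tendsto_at_iff_tendsto_nhds[of "\<lambda>t. X t (Y v0)" t0] by (simp add: isCont_def)
  moreover have "?p \<in> W" using c u0 by (simp add: W_iff flip: u0_def)
  ultimately have "eventually (\<lambda>t. X t (Y v0) \<in> W) (nhds t0)"
    using W by (auto dest: topological_tendstoD)
  then obtain \<rho>3 where \<rho>3: "\<rho>3 > 0" "\<And>t. dist t t0 < \<rho>3 \<Longrightarrow> X t (Y v0) \<in> W"
    unfolding eventually_nhds_metric by blast
  define \<delta> where "\<delta> = min \<rho>2 \<rho>3"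
  let ?I = "ball t0 \<delta>"
  have "isCont (\<lambda>v. X t (Y v)) v0" if s: "s \<in> ?I" and t: "t \<in> ?I" and cont: "isCont (\<lambda>v. X s (Y v)) v0" for s t
  proof -
    have st: "dist s t0 < \<rho>2" "dist t t0 < \<rho>2" "dist s t0 < \<rho>3" "dist t t0 < \<rho>3"
      using s t by (auto simp: \<delta>_def dist_commute)
    have "((\<lambda>v. X s (Y v)) \<longlongrightarrow> X s (Y v0)) (nhds v0)"
      using cont tendsto_at_iff_tendsto_nhds[of "\<lambda>v. X s (Y v)" v0] by (simp add: isCont_def)
    then have "eventually (\<lambda>v. X s (Y v) \<in> W) (nhds v0)"
      using W \<rho>3(2)[OF st(3)] by (auto dest: topological_tendstoD)
    moreover have "eventually (\<lambda>v. dist v v0 < \<rho>2) (nhds v0)"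
      using \<rho>2 by (auto simp: eventually_nhds_metric)
    ultimately have ev: "eventually (\<lambda>v. X s (Y v) \<in> W \<and> dist v v0 < \<rho>2) (nhds v0)"
      by (rule eventually_conj)
    have stay: "X t (Y v) \<in> W" if v: "X s (Y v) \<in> W" "dist v v0 < \<rho>2" for v
    proof -
      have "v \<noteq> 0" using nz[OF near(1)[OF st(1) v(2)]] by simp
      then have cont_t: "continuous_on ?I (\<lambda>t. X t (Y v))"
        using continuous_flow_in_time continuous_on_subset by blast
      let ?T = "?I \<inter> (\<lambda>t. X t (Y v)) -` W"
      have "X r (Y v) \<in> W \<longleftrightarrow> X r (Y v) \<in> K" if "r \<in> ?I" for r
        by (rule trap) (use that v(2) in \<open>simp_all add: \<delta>_def dist_commute\<close>)
      then have "?T = ?I \<inter> (\<lambda>t. X t (Y v)) -` K" by blast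
      then have "closedin (top_of_set ?I) ?T"
        using continuous_closedin_preimage[OF cont_t K] by simp
      moreover have "openin (top_of_set ?I) ?T"
        using continuous_openin_preimage_gen[OF cont_t W] .
      moreover have "connected ?I" by (rule connected_ball)
      ultimately have "?T = {} \<or> ?T = ?I" unfolding connected_clopen by blast
      moreover have "s \<in> ?T" using s v(1) by simp
      ultimately have "t \<in> ?T" using t by (metis empty_iff)
      then show ?thesis by simp
    qed
    let ?u' = "coord c (X t (Y v0))"
    have x': "X t (Y v0) \<in> chart_dom c" "?u' \<in> ball u0 \<rho>"
      using \<rho>3(2)[OF st(4)] by (auto simp: W_iff)
    have "isCont (\<lambda>v. im_gradient c (t, v) ?u') v0"
      using isCont_o2[of v0 "\<lambda>v. (t, v)" "\<lambda>z. im_gradient c z ?u'"]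
        isCont_im_gradient[OF c(1), of ?u' "(t, v0)"] x' v0 by (simp add: continuous_Pair)
    then have "((\<lambda>v. im_gradient c (t, v) ?u') \<longlongrightarrow> 0) (at v0)"
      using im_gradient_zero[OF v0 c(1) x'(1)] by (simp add: isCont_def)
    then have lim: "((\<lambda>v. norm (im_gradient c (t, v) ?u') / m) \<longlongrightarrow> 0) (at v0)"
      using tendsto_divide[OF tendsto_norm tendsto_const, of _ 0 "at v0" m] m by simp
    have ev': "eventually (\<lambda>v. X t (Y v) \<in> W \<and> dist v v0 < \<rho>2) (at v0)"
      using ev stay unfolding eventually_at_filter by (auto elim!: eventually_mono)
    have "((\<lambda>v. coord c (X t (Y v)) - ?u') \<longlongrightarrow> 0) (at v0)"
    proof (rule Lim_null_comparison[OF _ lim])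
      show "eventually (\<lambda>v. norm (coord c (X t (Y v)) - ?u') \<le> norm (im_gradient c (t, v) ?u') / m) (at v0)"
        using ev'
      proof eventually_elim
        case (elim v)
        then have tv: "(t, v) \<in> ball (t0, v0) \<rho>" using near st by blast
        have x: "X t (Y v) \<in> chart_dom c" "coord c (X t (Y v)) \<in> ball u0 \<rho>"
          using elim by (auto simp: W_iff)
        have "v \<noteq> 0" using nz[OF tv] by simp
        then have "m * norm (coord c (X t (Y v)) - ?u') \<le> norm (im_gradient c (t, v) ?u')"
          using mono[OF tv x(2) x'(2)] im_gradient_zero[OF _ c(1) x(1)] by simp
        then show ?case using m by (simp add: field_simps)
      qed
    qed
    then have "((\<lambda>v. coord c (X t (Y v))) \<longlongrightarrow> ?u') (at v0)" by (simp add: LIM_zero_iff)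
    then have "((\<lambda>v. coord_inv c (coord c (X t (Y v)))) \<longlongrightarrow> coord_inv c ?u') (at v0)"
      using isCont_tendsto_compose isCont_coord_inv[OF c(1), of ?u'] x' by blast
    moreover have "eventually (\<lambda>v. coord_inv c (coord c (X t (Y v))) = X t (Y v)) (at v0)"
      using ev' by eventually_elim (simp add: W_iff c(1))
    ultimately have "((\<lambda>v. X t (Y v)) \<longlongrightarrow> coord_inv c ?u') (at v0)"
      by (rule Lim_transform_eventually)
    then show ?thesis using x' c by (simp add: isCont_def)
  qed
  moreover have "\<delta> > 0" using \<rho>2 \<rho>3 by (simp add: \<delta>_def)
  ultimately show ?thesis by blast
qed

text \<open>
  The times at which the flow is continuous in the covector form a clopen set, which contains 0
  since all trajectories start at \<open>y\<close>.
\<close>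

lemma isCont_flow:
  assumes v0: "v0 \<noteq> 0"
  shows "isCont (\<lambda>v. X t (Y v)) v0"
proof -
  let ?T = "{t. isCont (\<lambda>v. X t (Y v)) v0}"
  have "open ?T" "open (- ?T)"
    unfolding open_contains_ball
    using continuity_propagates_in_time[OF v0] by (fastforce intro: centre_in_ball[THEN iffD2])+
  then have "?T = {} \<or> ?T = UNIV" by (metis clopen closed_def)
  moreover have "0 \<in> ?T"
  proof -
    have "X 0 (Y v) = y" if "v \<noteq> 0" for v
      using trajectory[OF that] by (simp add: hamiltonian_trajectory_def Y_def)
    moreover have "eventually (\<lambda>v. v \<noteq> 0) (nhds v0)"
      using v0 by (intro eventually_nhds_in_open[of "- {0}", simplified]) auto
    ultimately have "eventually (\<lambda>v. X 0 (Y v) = y) (nhds v0)"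
      by (auto elim: eventually_mono)
    then have "isCont (\<lambda>v. X 0 (Y v)) v0 \<longleftrightarrow> isCont (\<lambda>v. y) v0" by (rule isCont_cong)
    then show ?thesis by simp
  qed
  ultimately show ?thesis by blast
qed

text \<open>
  The implicit equation \<open>im_gradient c (t, v) u = 0\<close> is linearised along the line \<open>v0 + s e\<close>; its derivative in
  \<open>u\<close> is a positive multiple of the metric, and strong monotonicity yields the Lipschitz bound.
\<close>

lemma differentiable_flow:
  assumes v0: "v0 \<noteq> 0" and c: "c \<in> A" "X t (Y v0) \<in> chart_dom c"
  obtains x' where "((\<lambda>s. coord c (X t (Y (v0 + s *\<^sub>R e)))) has_vector_derivative x') (at 0)"
proof -
  let ?V = "\<lambda>s. v0 + s *\<^sub>R e" and ?x = "\<lambda>s. coord c (X t (Y (v0 + s *\<^sub>R e)))"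
  define u0 where "u0 = coord c (X t (Y v0))"
  have x0: "?x 0 = u0" by (simp add: u0_def)
  have u0: "u0 \<in> coord c ` chart_dom c" using c by (simp add: u0_def)
  obtain m \<rho> where m: "m > 0" and \<rho>: "\<rho> > 0" "ball u0 \<rho> \<subseteq> coord c ` chart_dom c"
    and nz: "\<And>z. z \<in> ball (t, v0) \<rho> \<Longrightarrow> snd z \<noteq> 0"
    and mono: "\<And>z u u'. z \<in> ball (t, v0) \<rho> \<Longrightarrow> u \<in> ball u0 \<rho> \<Longrightarrow> u' \<in> ball u0 \<rho> \<Longrightarrow>
       m * norm (u - u') \<le> norm (im_gradient c z u - im_gradient c z u')"
    using im_gradient_strongly_monotone[OF v0 c] unfolding u0_def by blast
  define \<psi> where "\<psi> = (\<lambda>(u, s). im_gradient c (t, v0 + s *\<^sub>R e) u)"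
  let ?D1 = "\<lambda>\<alpha>. frechet_derivative (phase_x c (axis \<alpha> 1)) (at (pt t u0 v0))"
  define D where "D = (\<lambda>h. \<chi> \<alpha>. Im (?D1 \<alpha> (0, fst h, 0, snd h *\<^sub>R e, 0)))"
  have z0: "pt t u0 v0 \<in> phase_dom c" by (rule pt_in_phase_dom[OF u0 v0])
  have D: "(\<psi> has_derivative D) (at (u0, 0))"
  proof (rule vec_has_derivative)
    fix \<alpha>
    have "((\<lambda>z. pt t (fst z) (v0 + snd z *\<^sub>R e)) has_derivative (\<lambda>h. (0, fst h, 0, snd h *\<^sub>R e, 0))) (at (u0, 0))"
      by (rule has_derivative_pt) (auto intro!: derivative_eq_intros)
    moreover have "(phase_x c (axis \<alpha> 1) has_derivative ?D1 \<alpha>) (at (pt t (fst (u0, 0)) (v0 + snd (u0, 0) *\<^sub>R e)))"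
      using smooth_on_has_derivative[OF phase_x_smooth[OF c(1)] z0] by simp
    ultimately have "((\<lambda>z. phase_x c (axis \<alpha> 1) (pt t (fst z) (v0 + snd z *\<^sub>R e))) has_derivative
        (\<lambda>h. ?D1 \<alpha> (0, fst h, 0, snd h *\<^sub>R e, 0))) (at (u0, 0))"
      by (rule has_derivative_compose)
    from bounded_linear.has_derivative[OF bounded_linear_Im this]
    show "((\<lambda>z. \<psi> z $ \<alpha>) has_derivative (\<lambda>h. D h $ \<alpha>)) (at (u0, 0))"
      by (simp add: \<psi>_def D_def im_gradient_def case_prod_beta)
  qed
  have h: "ham A g (Y v0) > 0" using ham_positive Y_punctured[OF v0] by (metis surj_pair)
  define L where "L w = (1 / (\<epsilon> * ham A g (Y v0))) *\<^sub>R (inv_metric g c u0 *v w)" for w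
  have L: "bounded_linear L"
    unfolding L_def by (intro bounded_linear_intros matrix_vector_mul_bounded_linear)
  have LD: "L (D (a, 0)) = a" for a
  proof -
    have "D (a, 0) = im_hessian c (t, v0) u0 *v a"
      by (simp add: D_def im_hessian_def vec_eq_iff frechet_phase_x_expand[OF c(1) z0] matrix_vector_mult_def mult.commute)
    also have "\<dots> = (\<epsilon> * ham A g (Y v0)) *\<^sub>R (g c u0 *v a)"
      by (simp add: u0_def im_hessian_on_flow[OF v0 c] flip: scaleR_matrix_vector_assoc)
    finally show ?thesis
      using h \<epsilon> by (simp add: L_def matrix_vector_mult_scaleR matrix_vector_mul_assoc metric_inverse[OF c(1) u0])
  qed
  have limV: "(?V \<longlongrightarrow> v0) (nhds 0)"
    using tendsto_at_iff_tendsto_nhds[of ?V 0] by (auto intro!: tendsto_eq_intros)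
  have "((\<lambda>v. X t (Y v)) \<longlongrightarrow> X t (Y v0)) (nhds v0)"
    using isCont_flow[OF v0, of t] tendsto_at_iff_tendsto_nhds[of "\<lambda>v. X t (Y v)" v0] by (simp add: isCont_def)
  from filterlim_compose[OF this limV]
  have limX: "((\<lambda>s. X t (Y (?V s))) \<longlongrightarrow> X t (Y v0)) (nhds 0)" .
  let ?W = "coord_inv c ` ball u0 \<rho>"
  have "X t (Y v0) \<in> ?W"
    unfolding in_coord_inv_image_iff[OF c(1) \<rho>(2)] using c \<rho>(1) by (simp add: u0_def)
  then have "eventually (\<lambda>s. X t (Y (?V s)) \<in> ?W) (nhds 0)"
    using limX open_coord_inv_image[OF c(1) open_ball \<rho>(2)] by (auto dest: topological_tendstoD)
  moreover have "eventually (\<lambda>s. dist (?V s) v0 < \<rho>) (nhds 0)"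
    using limV \<rho>(1) by (rule tendstoD)
  ultimately have ev: "eventually (\<lambda>s. X t (Y (?V s)) \<in> chart_dom c \<and> ?x s \<in> ball u0 \<rho> \<and> (t, ?V s) \<in> ball (t, v0) \<rho> \<and> ?V s \<noteq> 0) (nhds 0)"
  proof eventually_elim
    case (elim s)
    have "(t, ?V s) \<in> ball (t, v0) \<rho>" using elim(2) by (simp add: dist_Pair_Pair dist_commute)
    then show ?case
      using elim(1) nz[of "(t, ?V s)"] unfolding in_coord_inv_image_iff[OF c(1) \<rho>(2)] by simp
  qed
  have zero: "eventually (\<lambda>s. \<psi> (?x s, s) = 0) (nhds 0)"
    using ev by eventually_elim (use im_gradient_zero[OF _ c(1)] in \<open>simp add: \<psi>_def\<close>)
  have \<psi>0: "\<psi> (u0, 0) = 0" using eventually_nhds_x_imp_x[OF zero] by (simp add: u0_def)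
  define C where "C = (norm (D (0, 1)) + 1) / m"
  have "((\<lambda>s. \<psi> ((u0, 0) + s *\<^sub>R (0, 1))) has_vector_derivative D (0, 1)) (at 0)"
    by (rule has_derivative_along_line) (use D in simp)
  then have "((\<lambda>s. \<psi> (u0, s)) has_derivative (\<lambda>s. s *\<^sub>R D (0, 1))) (at 0)"
    by (simp add: has_vector_derivative_def)
  then obtain \<rho>1 where \<rho>1: "\<rho>1 > 0" "\<And>s. norm (s - 0) < \<rho>1 \<Longrightarrow>
      norm (\<psi> (u0, s) - \<psi> (u0, 0) - (s - 0) *\<^sub>R D (0, 1)) \<le> 1 * norm (s - 0)"
    unfolding has_derivative_at_alt by (meson zero_less_one)
  have "eventually (\<lambda>s. norm (s - 0) < \<rho>1) (nhds (0::real))"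
    using \<rho>1(1) by (auto simp: eventually_nhds_metric)
  with ev have lip: "eventually (\<lambda>s. norm (?x s - ?x 0) \<le> C * \<bar>s\<bar>) (nhds 0)"
  proof eventually_elim
    case (elim s)
    have "norm (\<psi> (u0, s)) \<le> norm (\<psi> (u0, s) - s *\<^sub>R D (0, 1)) + norm (s *\<^sub>R D (0, 1))"
      by (metis norm_triangle_ineq diff_add_cancel)
    also have "\<dots> \<le> \<bar>s\<bar> + \<bar>s\<bar> * norm (D (0, 1))" using \<rho>1(2)[OF elim(2)] \<psi>0 by simp
    finally have "norm (\<psi> (u0, s)) \<le> (norm (D (0, 1)) + 1) * \<bar>s\<bar>" by (simp add: algebra_simps)
    moreover have "m * norm (?x s - u0) \<le> norm (\<psi> (u0, s))"
      using mono[of "(t, ?V s)" "?x s" u0] elim(1) \<rho>(1) im_gradient_zero[OF _ c(1), of "?V s" t]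
      by (simp add: \<psi>_def)
    ultimately have "norm (?x s - u0) \<le> C * \<bar>s\<bar>" using m by (simp add: C_def field_simps)
    then show ?case by (simp only: x0)
  qed
  have "(\<psi> has_derivative D) (at (?x 0, 0))" using D by (simp only: x0)
  from implicit_curve_has_vector_derivative[OF this L LD zero lip]
  show thesis by (rule that)
qed

text \<open>
  Differentiating \<open>\<phi>\<^sub>x = \<xi>\<^sup>*\<close> at \<open>x = x\<^sup>*\<close> in the covector gives \<open>\<phi>\<^sub>x\<^sub>x \<partial>x\<^sup>* + \<phi>\<^sub>x\<^sub>\<eta> = \<partial>\<xi>\<^sup>*\<close>.
\<close>

lemma phase_mixed_derivative:
  fixes \<alpha> \<mu> :: 'n
  assumes v0: "v0 \<noteq> 0" and c: "c \<in> A" "X t (Y v0) \<in> chart_dom c"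
  defines "u0 \<equiv> coord c (X t (Y v0))"
  defines "q \<equiv> \<lambda>\<beta>. pdiff \<mu> (\<lambda>v. coord c (X t (Y v)) $ \<beta>) v0"
  shows "pdiff \<mu> (\<lambda>v. pdiff \<alpha> (\<lambda>u. \<phi> t (coord_inv c u) (Y v) \<epsilon>) u0) v0 =
    of_real (pdiff \<mu> (\<lambda>v. \<Xi> t (Y v) c $ \<alpha>) v0)
      - (\<Sum>\<beta>\<in>UNIV. of_real (q \<beta>) * Complex (christoffel_form c u0 (\<Xi> t (Y v0) c) $ \<alpha> $ \<beta>)
           (\<epsilon> * ham A g (Y v0) * g c u0 $ \<alpha> $ \<beta>))"
proof -
  let ?e = "axis \<mu> 1 :: real ^ 'n"
  let ?V = "\<lambda>s. v0 + s *\<^sub>R ?e" and ?x = "\<lambda>s. coord c (X t (Y (v0 + s *\<^sub>R ?e)))"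
  let ?f = "phase_x c (axis \<alpha> 1)"
  let ?D = "frechet_derivative ?f (at (pt t u0 v0))"
  have u0: "u0 \<in> coord c ` chart_dom c" using c by (simp add: u0_def)
  have z0: "pt t u0 v0 \<in> phase_dom c" by (rule pt_in_phase_dom[OF u0 v0])
  have fD: "(?f has_derivative ?D) (at (pt t u0 v0))"
    by (rule smooth_on_has_derivative[OF phase_x_smooth[OF c(1)] z0])
  then have lin: "linear ?D" by (rule has_derivative_linear)
  obtain x' where x': "(?x has_vector_derivative x') (at 0)"
    using differentiable_flow[OF v0 c] by blast
  have q: "q \<beta> = x' $ \<beta>" for \<beta>
    unfolding q_def
    by (rule pdiff_eqI) (rule bounded_linear.has_vector_derivative[OF bounded_linear_vec_nth x'])
  have limV: "(?V \<longlongrightarrow> v0) (nhds 0)"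
    using tendsto_at_iff_tendsto_nhds[of ?V 0] by (auto intro!: tendsto_eq_intros)
  have evV: "eventually (\<lambda>s. ?V s \<noteq> 0) (nhds 0)"
    using tendsto_imp_eventually_ne[OF limV v0] .
  have "((\<lambda>v. X t (Y v)) \<longlongrightarrow> X t (Y v0)) (nhds v0)"
    using isCont_flow[OF v0, of t] tendsto_at_iff_tendsto_nhds[of "\<lambda>v. X t (Y v)" v0] by (simp add: isCont_def)
  from filterlim_compose[OF this limV]
  have "eventually (\<lambda>s. X t (Y (?V s)) \<in> chart_dom c) (nhds 0)"
    using open_chart_dom[OF c(1)] c(2) by (auto dest: topological_tendstoD)
  with evV have on_flow: "eventually (\<lambda>s. ?f (pt t (?x s) (?V s)) = of_real (\<Xi> t (Y (?V s)) c $ \<alpha>)) (nhds 0)"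
    by eventually_elim (simp add: phase_derivatives_on_flow(1)[OF _ c(1)] inner_axis)
  have Vder: "(?V has_derivative (\<lambda>h. h *\<^sub>R ?e)) (at 0)" by (auto intro!: derivative_eq_intros)
  have total: "((\<lambda>s. ?f (pt t (?x s) (?V s))) has_vector_derivative ?D (0, x', 0, ?e, 0)) (at 0)"
  proof -
    have "((\<lambda>s. pt t (?x s) (?V s)) has_derivative (\<lambda>h. (0, h *\<^sub>R x', 0, h *\<^sub>R ?e, 0))) (at 0)"
      by (rule has_derivative_pt[OF x'[unfolded has_vector_derivative_def] Vder])
    moreover have "(?f has_derivative ?D) (at (pt t (?x 0) (?V 0)))" using fD by (simp add: u0_def)
    ultimately have "((\<lambda>s. ?f (pt t (?x s) (?V s))) has_derivative (\<lambda>h. ?D (0, h *\<^sub>R x', 0, h *\<^sub>R ?e, 0))) (at 0)"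
      by (rule has_derivative_compose)
    moreover have "?D (0, h *\<^sub>R x', 0, h *\<^sub>R ?e, 0) = h *\<^sub>R ?D (0, x', 0, ?e, 0)" for h
      using linear_scale[OF lin, of h "(0, x', 0, ?e, 0)"] by simp
    ultimately show ?thesis by (simp add: has_vector_derivative_def)
  qed
  have "((\<lambda>s. ?f (pt t (?x s) (?V s))) has_vector_derivative ?D (0, x', 0, ?e, 0)) (at 0)
    \<longleftrightarrow> ((\<lambda>s. of_real (\<Xi> t (Y (?V s)) c $ \<alpha>)) has_vector_derivative ?D (0, x', 0, ?e, 0)) (at 0)"
    by (rule has_vector_derivative_cong_ev)
      (use eventually_mono[OF on_flow] eventually_nhds_x_imp_x[OF on_flow] in auto)
  with total have "((\<lambda>s. of_real (\<Xi> t (Y (?V s)) c $ \<alpha>) :: complex) has_vector_derivative ?D (0, x', 0, ?e, 0)) (at 0)"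
    by blast
  from has_derivative_Re_Im[OF this]
  have "((\<lambda>s. \<Xi> t (Y (?V s)) c $ \<alpha>) has_real_derivative Re (?D (0, x', 0, ?e, 0))) (at 0)"
    and "((\<lambda>s. 0) has_real_derivative Im (?D (0, x', 0, ?e, 0))) (at 0)" by simp_all
  then have "pdiff \<mu> (\<lambda>v. \<Xi> t (Y v) c $ \<alpha>) v0 = Re (?D (0, x', 0, ?e, 0))" "Im (?D (0, x', 0, ?e, 0)) = 0"
    by (auto intro!: pdiff_eqI simp: has_real_derivative_iff_has_vector_derivative
        dest: vector_derivative_unique_at[OF has_vector_derivative_const])
  then have 1: "?D (0, x', 0, ?e, 0) = of_real (pdiff \<mu> (\<lambda>v. \<Xi> t (Y v) c $ \<alpha>) v0)"
    by (simp add: complex_eq_iff)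
  have 2: "pdiff \<mu> (\<lambda>v. pdiff \<alpha> (\<lambda>u. \<phi> t (coord_inv c u) (Y v) \<epsilon>) u0) v0 = ?D (0, 0, 0, ?e, 0)"
  proof -
    have inner: "pdiff \<alpha> (\<lambda>u. \<phi> t (coord_inv c u) (Y v) \<epsilon>) u0 = ?f (pt t u0 v)" if "v \<noteq> 0" for v
    proof (rule pdiff_eqI)
      have "((\<lambda>s. phase_coord c (pt t (u0 + s *\<^sub>R axis \<alpha> 1) v)) has_vector_derivative ?f (pt t u0 v)) (at 0)"
        using has_derivative_along_line[of "phase_coord c" _ "pt t u0 v" 0 "(0, axis \<alpha> 1, 0, 0, 0)",
          unfolded pt_shift scaleR_zero_left add_0_right,
          OF smooth_on_has_derivative[OF phase_coord_smooth[OF c(1)] pt_in_phase_dom[OF u0 that]]]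
        unfolding phase_x_def .
      then show "((\<lambda>s. \<phi> t (coord_inv c (u0 + s *\<^sub>R axis \<alpha> 1)) (Y v) \<epsilon>) has_vector_derivative ?f (pt t u0 v)) (at 0)"
        by (simp add: phase_coord_pt)
    qed
    have "eventually (\<lambda>v. v \<noteq> 0) (nhds v0)"
      using v0 by (intro eventually_nhds_in_open[of "- {0}", simplified]) auto
    then have "pdiff \<mu> (\<lambda>v. pdiff \<alpha> (\<lambda>u. \<phi> t (coord_inv c u) (Y v) \<epsilon>) u0) v0 = pdiff \<mu> (\<lambda>v. ?f (pt t u0 v)) v0"
      by (intro pdiff_cong) (auto elim!: eventually_mono simp: inner)
    also have "\<dots> = ?D (0, 0, 0, ?e, 0)"
    proof -
      have "((\<lambda>v. pt t u0 v) has_derivative (\<lambda>h. (0, 0, 0, h, 0))) (at v0)"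
        by (rule has_derivative_pt[OF has_derivative_const has_derivative_ident])
      from has_derivative_compose[OF this fD] show ?thesis
        by (rule pdiff_eq_frechet_derivative)
    qed
    finally show ?thesis .
  qed
  have "?D (0, x', 0, ?e, 0) = ?D (0, x', 0, 0, 0) + ?D (0, 0, 0, ?e, 0)"
    using linear_add[OF lin, of "(0, x', 0, 0, 0)" "(0, 0, 0, ?e, 0)"] by simp
  moreover have "?D (0, x', 0, 0, 0) = (\<Sum>\<beta>\<in>UNIV. of_real (q \<beta>) * Complex (christoffel_form c u0 (\<Xi> t (Y v0) c) $ \<alpha> $ \<beta>)
           (\<epsilon> * ham A g (Y v0) * g c u0 $ \<alpha> $ \<beta>))"
  proof -
    have "phase_xx c (axis \<alpha> 1) (axis \<beta> 1) (pt t u0 v0) =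
      Complex (christoffel_form c u0 (\<Xi> t (Y v0) c) $ \<alpha> $ \<beta>) (\<epsilon> * ham A g (Y v0) * g c u0 $ \<alpha> $ \<beta>)" for \<beta>
    proof -
      have "axis \<beta> 1 \<bullet> (M *v axis \<alpha> 1) = M $ \<beta> $ \<alpha>" for M :: "real ^ 'n ^ 'n"
        by (simp add: inner_axis' matrix_vector_mult_basis column_def)
      moreover have "g c u0 $ \<beta> $ \<alpha> = g c u0 $ \<alpha> $ \<beta>"
        using arg_cong[OF metric_symmetric[OF c(1) u0], of "\<lambda>M. M $ \<alpha> $ \<beta>"] by (simp add: transpose_def)
      moreover have "christoffel_form c u0 \<xi> $ \<beta> $ \<alpha> = christoffel_form c u0 \<xi> $ \<alpha> $ \<beta>" for \<xi>
        using christoffel_symmetric[OF c(1) u0] by (simp add: christoffel_form_def)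
      ultimately show ?thesis
        unfolding u0_def by (simp add: phase_derivatives_on_flow(2)[OF v0 c])
    qed
    then show ?thesis
      by (simp add: frechet_phase_x_expand[OF c(1) z0] q scaleR_conv_of_real)
  qed
  ultimately show ?thesis using 1 2 by (simp add: algebra_simps)
qed

end

section \<open>The mixed derivative of the phase\<close>

theorem theorem10p2:
  fixes A :: "('m::t2_space, 'n::finite) chart set"
    and g :: "('m, 'n) metric"
    and X :: "real \<Rightarrow> 'm \<times> ('m, 'n) covector \<Rightarrow> 'm"
    and \<Xi> :: "real \<Rightarrow> 'm \<times> ('m, 'n) covector \<Rightarrow> ('m, 'n) covector"
    and \<phi> :: "real \<Rightarrow> 'm \<Rightarrow> 'm \<times> ('m, 'n) covector \<Rightarrow> real \<Rightarrow> complex"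
    and q p :: "'n \<Rightarrow> 'n \<Rightarrow> real"
    and \<epsilon> t :: real
    and y :: 'm and \<eta> :: "('m, 'n) covector"
    and c d :: "('m, 'n) chart"
  assumes "CARD('n) \<ge> 2"
    and "connected_closed_manifold A"
    and "riemannian_metric A g"
    and "hamiltonian_flow A g X \<Xi>"
    and "levi_civita_phase A g X \<Xi> \<phi>"
    and "\<epsilon> > 0"
    and "(y, \<eta>) \<in> punctured_cotangent A"
    and "c \<in> A" and "X t (y, \<eta>) \<in> chart_dom c"
    and "d \<in> A" and "y \<in> chart_dom d"
    and q_def: "\<And>\<alpha> \<mu>. q \<alpha> \<mu> =
        pdiff \<mu> (\<lambda>v. coord c (X t (y, covector_of A d y v)) $ \<alpha>) (\<eta> d)"
    and p_def: "\<And>\<alpha> \<mu>. p \<alpha> \<mu> =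
        (\<Sum>\<gamma>\<in>UNIV. inv_metric g c (coord c (X t (y, \<eta>))) $ \<alpha> $ \<gamma> *
          (pdiff \<mu> (\<lambda>v. \<Xi> t (y, covector_of A d y v) c $ \<gamma>) (\<eta> d)
            - (\<Sum>\<rho>\<in>UNIV. \<Sum>\<beta>\<in>UNIV. christoffel g c (coord c (X t (y, \<eta>))) \<rho> \<gamma> \<beta> *
                 \<Xi> t (y, \<eta>) c $ \<rho> *
                 pdiff \<mu> (\<lambda>v. coord c (X t (y, covector_of A d y v)) $ \<beta>) (\<eta> d))))"
  shows "pdiff \<mu>
           (\<lambda>v. pdiff \<alpha> (\<lambda>u. \<phi> t (coord_inv c u) (y, covector_of A d y v) \<epsilon>) (coord c (X t (y, \<eta>))))
           (\<eta> d) =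
         (\<Sum>\<beta>\<in>UNIV. of_real (g c (coord c (X t (y, \<eta>))) $ \<alpha> $ \<beta>) *
            (of_real (p \<beta> \<mu>) - \<i> * of_real \<epsilon> * of_real (ham A g (y, \<eta>)) * of_real (q \<beta> \<mu>)))"
proof -
  interpret levi_civita_phase_at A g X \<Xi> \<phi> \<epsilon> y d
    using assms by unfold_locales (auto simp: connected_closed_manifold_def)
  have cov: "is_covector A y \<eta>" using assms(7) by (simp add: punctured_cotangent_def)
  have Y: "Y (\<eta> d) = (y, \<eta>)" by (simp add: Y_def covector_of_components[OF cov d])
  have v0: "\<eta> d \<noteq> 0" using punctured_component_nonzero[OF assms(7) d] .
  have c: "c \<in> A" "X t (Y (\<eta> d)) \<in> chart_dom c" using assms(8,9) by (simp_all add: Y)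
  define u0 where "u0 = coord c (X t (y, \<eta>))"
  define G where "G = g c u0"
  define r where "r \<gamma> = pdiff \<mu> (\<lambda>v. \<Xi> t (Y v) c $ \<gamma>) (\<eta> d)
      - (\<Sum>\<beta>\<in>UNIV. christoffel_form c u0 (\<Xi> t (y, \<eta>) c) $ \<gamma> $ \<beta> * q \<beta> \<mu>)" for \<gamma>
  have u0: "u0 \<in> coord c ` chart_dom c" using assms(9) by (simp add: u0_def)
  have q: "q \<beta> \<mu> = pdiff \<mu> (\<lambda>v. coord c (X t (Y v)) $ \<beta>) (\<eta> d)" for \<beta>
    by (simp add: q_def Y_def)
  have p: "(\<chi> \<beta>. p \<beta> \<mu>) = inv_metric g c u0 *v (\<chi> \<gamma>. r \<gamma>)"
  proof -
    have "(\<Sum>\<rho>\<in>UNIV. \<Sum>\<beta>\<in>UNIV. christoffel g c u0 \<rho> \<gamma> \<beta> * \<Xi> t (y, \<eta>) c $ \<rho> * q \<beta> \<mu>)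
      = (\<Sum>\<beta>\<in>UNIV. christoffel_form c u0 (\<Xi> t (y, \<eta>) c) $ \<gamma> $ \<beta> * q \<beta> \<mu>)" for \<gamma>
      by (subst sum.swap) (simp add: christoffel_form_def sum_distrib_right)
    then show ?thesis
      by (simp add: vec_eq_iff p_def matrix_vector_mult_def r_def Y_def flip: u0_def q_def)
  qed
  \<comment> \<open>The metric cancels the inverse metric in the definition of \<open>p\<close>.\<close>
  have "G *v (\<chi> \<beta>. p \<beta> \<mu>) = (\<chi> \<gamma>. r \<gamma>)"
    by (simp add: p G_def matrix_vector_mul_assoc metric_inverse[OF c(1) u0])
  then have Gp: "(\<Sum>\<beta>\<in>UNIV. G $ \<alpha> $ \<beta> * p \<beta> \<mu>) = r \<alpha>"
    by (simp add: vec_eq_iff matrix_vector_mult_def)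
  note mixed = phase_mixed_derivative[OF v0 c, of \<mu> \<alpha>, folded q, unfolded Y, folded u0_def]
  have "pdiff \<mu> (\<lambda>v. pdiff \<alpha> (\<lambda>u. \<phi> t (coord_inv c u) (Y v) \<epsilon>) u0) (\<eta> d)
    = Complex (r \<alpha>) (- (\<Sum>\<beta>\<in>UNIV. q \<beta> \<mu> * (\<epsilon> * ham A g (y, \<eta>) * G $ \<alpha> $ \<beta>)))"
    by (simp add: mixed complex_eq_iff r_def G_def mult.commute)
  also have "\<dots> = (\<Sum>\<beta>\<in>UNIV. of_real (G $ \<alpha> $ \<beta>) *
            (of_real (p \<beta> \<mu>) - \<i> * of_real \<epsilon> * of_real (ham A g (y, \<eta>)) * of_real (q \<beta> \<mu>)))"
    by (simp add: complex_eq_iff sum_negf mult_ac flip: Gp)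
  finally show ?thesis by (simp add: Y_def u0_def G_def)
qed

end
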